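(* The set $$\left\{\frac{\phi_{2,k}}{|\phi_{2,k}|_{H_0^1(0,1)}} : k\in\mathcal I_2\right\}\cup\left\{\frac{\psi_{j,k}}{|\psi_{j,k}|_{H_0^1(0,1)}} : j\ge 2,\ k\in\mathcal I_j\right\}$$ is a Riesz basis of $H_0^1(0,1)$, where $|\cdot|_{H_0^1(0,1)}$ denotes the $H_0^1(0,1)$-seminorm, $|f|_{H_0^1(0,1)}=\left(\int_0^1 |f'(x)|^2\,dx\right)^{1/2}$.
   Context: Scaling functions: $\phi(x)=\frac{x^2}{2}$ on $[0,1]$, $-x^2+3x-\frac32$ on $[1,2]$, $\frac{x^2}{2}-3x+\frac92$ on $[2,3]$, and $0$ otherwise. $\phi_b(x)=-\frac{9x^2}{4}+3x$ on $[0,1]$, $\frac{3x^2}{4}-3x+3$ on $[1,2]$, and $0$ otherwise. Wavelets: $\psi(x)=-\frac12\phi(2x-1)+\frac12\phi(2x-2)$ and $\psi_b(x)=-\frac12\phi_b(2x)+\frac12\phi(2x)$. For $j\ge 2$ let $\mathcal I_j=\{k\in\mathbb Z: 1\le k\le 2^j\}$, and for $x\in[0,1]$ put $\phi_{j,k}(x)=2^{j/2}\phi(2^jx-k+2)$ for $k=2,\dots,2^j-1$, $\phi_{j,1}(x)=2^{j/2}\phi_b(2^jx)$, $\phi_{j,2^j}(x)=2^{j/2}\phi_b(2^j(1-x))$; $\psi_{j,k}(x)=2^{j/2}\psi(2^jx-k+2)$ for $k=2,\dots,2^j-1$, $\psi_{j,1}(x)=2^{j/2}\psi_b(2^jx)$,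 $\psi_{j,2^j}(x)=-2^{j/2}\psi_b(2^j(1-x))$. A countable family $\{\psi_\lambda\}_{\lambda\in\mathcal J}$ in a Hilbert space $H$ is a Riesz basis of $H$ if the closure of its span is $H$ and there are constants $c,C\in(0,\infty)$ such that $c\|\mathbf b\|_2\le\left\|\sum_{\lambda}b_\lambda\psi_\lambda\right\|_H\le C\|\mathbf b\|_2$ for all $\mathbf b=\{b_\lambda\}\in l^2(\mathcal J)$, where $\|\mathbf b\|_2=\left(\sum_\lambda b_\lambda^2\right)^{1/2}$. All function spaces are real. *)

theory Defs
  imports "HOL-Analysis.Analysis"
begin

definition phi :: "real \<Rightarrow> real" where
  "phi x =
    (if 0 \<le> x \<and> x \<le> 1 then x^2 / 2
     else if 1 \<le> x \<and> x \<le> 2 then - (x^2) + 3 * x - 3 / 2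
     else if 2 \<le> x \<and> x \<le> 3 then x^2 / 2 - 3 * x + 9 / 2
     else 0)"

definition phi_b :: "real \<Rightarrow> real" where
  "phi_b x =
    (if 0 \<le> x \<and> x \<le> 1 then - (9 * x^2 / 4) + 3 * x
     else if 1 \<le> x \<and> x \<le> 2 then 3 * x^2 / 4 - 3 * x + 3
     else 0)"

definition psi :: "real \<Rightarrow> real" where
  "psi x = - (1/2) * phi (2 * x - 1) + (1/2) * phi (2 * x - 2)"

definition psi_b :: "real \<Rightarrow> real" where
  "psi_b x = - (1/2) * phi_b (2 * x) + (1/2) * phi (2 * x)"

definition wavelet_index :: "nat \<Rightarrow> int set" where
  "wavelet_index j = {k. 1 \<le> k \<and> k \<le> 2 ^ j}"

text \<open>
  Functions on the unit interval are represented by functions on the reals whose values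
  outside it are ignored. Meaningful for \<open>j \<ge> 2\<close> and \<open>k \<in> wavelet_index j\<close>.
\<close>

definition phi_jk :: "nat \<Rightarrow> int \<Rightarrow> real \<Rightarrow> real" where
  "phi_jk j k x =
    (if k = 1 then 2 powr (real j / 2) * phi_b (2 ^ j * x)
     else if k = 2 ^ j then 2 powr (real j / 2) * phi_b (2 ^ j * (1 - x))
     else 2 powr (real j / 2) * phi (2 ^ j * x - of_int k + 2))"

definition psi_jk :: "nat \<Rightarrow> int \<Rightarrow> real \<Rightarrow> real" where
  "psi_jk j k x =
    (if k = 1 then 2 powr (real j / 2) * psi_b (2 ^ j * x)
     else if k = 2 ^ j then - (2 powr (real j / 2)) * psi_b (2 ^ j * (1 - x))
     else 2 powr (real j / 2) * psi (2 ^ j * x - of_int k + 2))"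

abbreviation unit_measure :: "real measure" where
  "unit_measure \<equiv> lebesgue_on {0<..<1}"

text \<open>
  Elements of the function spaces below are functions rather than classes modulo equality
  almost everywhere; all predicates and (semi)norms depend only on the class.
\<close>

definition L2_space :: "(real \<Rightarrow> real) set" where
  "L2_space = {f. f \<in> borel_measurable unit_measure \<and> integrable unit_measure (\<lambda>x. (f x)^2)}"

definition L2_norm :: "(real \<Rightarrow> real) \<Rightarrow> real" where
  "L2_norm f = sqrt (LINT x|unit_measure. (f x)^2)"

definition test_functions :: "(real \<Rightarrow> real) set" where
  "test_functions =
    {u. (\<forall>n x. (deriv ^^ n) u differentiable (at x)) \<and>
        (\<exists>K. compact K \<and> K \<subseteq> {0<..<1} \<and> (\<forall>x. x \<notin> K \<longrightarrow> u x = 0))}"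

definition has_weak_deriv :: "(real \<Rightarrow> real) \<Rightarrow> (real \<Rightarrow> real) \<Rightarrow> bool" where
  "has_weak_deriv f g \<longleftrightarrow>
    (\<forall>u\<in>test_functions.
      (LINT x|unit_measure. f x * deriv u x) = - (LINT x|unit_measure. g x * u x))"

definition H1_space :: "(real \<Rightarrow> real) set" where
  "H1_space = {f \<in> L2_space. \<exists>g\<in>L2_space. has_weak_deriv f g}"

text \<open>The weak derivative is unique only up to equality almost everywhere.\<close>

definition weak_deriv :: "(real \<Rightarrow> real) \<Rightarrow> real \<Rightarrow> real" where
  "weak_deriv f = (SOME g. g \<in> L2_space \<and> has_weak_deriv f g)"

definition H1_seminorm :: "(real \<Rightarrow> real) \<Rightarrow> real" where
  "H1_seminorm f = L2_norm (weak_deriv f)"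

definition H1_norm :: "(real \<Rightarrow> real) \<Rightarrow> real" where
  "H1_norm f = sqrt ((L2_norm f)^2 + (H1_seminorm f)^2)"

definition closure_in ::
  "('x \<Rightarrow> real) set \<Rightarrow> (('x \<Rightarrow> real) \<Rightarrow> real) \<Rightarrow> ('x \<Rightarrow> real) set \<Rightarrow> ('x \<Rightarrow> real) set" where
  "closure_in H nrm S = {u\<in>H. \<forall>\<epsilon>>0. \<exists>v\<in>S. nrm (\<lambda>x. u x - v x) < \<epsilon>}"

definition H01_space :: "(real \<Rightarrow> real) set" where
  "H01_space = closure_in H1_space H1_norm test_functions"

definition lin_span :: "'i set \<Rightarrow> ('i \<Rightarrow> 'x \<Rightarrow> real) \<Rightarrow> ('x \<Rightarrow> real) set" where
  "lin_span J f = {(\<lambda>x. \<Sum>i\<in>F. a i * f i x) | a F. finite F \<and> F \<subseteq> J}"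

text \<open>
  The sum over the countable index set is the limit, in the norm of the space, of the net of
  finite partial sums.
\<close>

definition has_sum_in ::
  "('x \<Rightarrow> real) set \<Rightarrow> (('x \<Rightarrow> real) \<Rightarrow> real) \<Rightarrow> ('i \<Rightarrow> 'x \<Rightarrow> real) \<Rightarrow> 'i set \<Rightarrow> ('x \<Rightarrow> real) \<Rightarrow> bool" where
  "has_sum_in H nrm f J s \<longleftrightarrow>
    s \<in> H \<and>
    ((\<lambda>F. nrm (\<lambda>x. s x - (\<Sum>i\<in>F. f i x))) \<longlongrightarrow> 0) (finite_subsets_at_top J)"

definition l2_space :: "'i set \<Rightarrow> ('i \<Rightarrow> real) set" where
  "l2_space J = {b. (\<lambda>i. (b i)^2) summable_on J}"

definition l2_norm :: "'i set \<Rightarrow> ('i \<Rightarrow> real) \<Rightarrow> real" where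
  "l2_norm J b = sqrt (\<Sum>\<^sub>\<infinity>i\<in>J. (b i)^2)"

definition riesz_basis ::
  "('x \<Rightarrow> real) set \<Rightarrow> (('x \<Rightarrow> real) \<Rightarrow> real) \<Rightarrow> 'i set \<Rightarrow> ('i \<Rightarrow> 'x \<Rightarrow> real) \<Rightarrow> bool" where
  "riesz_basis H nrm J f \<longleftrightarrow>
    countable J \<and> (\<forall>i\<in>J. f i \<in> H) \<and>
    closure_in H nrm (lin_span J f) = H \<and>
    (\<exists>c>0. \<exists>C>0. \<forall>b\<in>l2_space J.
      \<exists>s. has_sum_in H nrm (\<lambda>i x. b i * f i x) J s \<and>
          c * l2_norm J b \<le> nrm s \<and> nrm s \<le> C * l2_norm J b)"

end

theory Submission
  imports Defs
begin

text \<open>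
  Differentiation is an isometry from \<open>H_0^1(0,1)\<close> with the seminorm onto the mean-zero part of
  \<open>L^2(0,1)\<close>, and it maps the basis functions to continuous piecewise linear functions. In nodal
  values on the dyadic grids, passing from level \<open>j\<close> to level \<open>j + 1\<close> is the two-scale map
  \<open>(c, d) \<mapsto> two_scale (2^j) c d\<close> with \<open>c\<close> the coarse nodal values and \<open>d\<close> the wavelet
  coefficients. Two quadratic forms, both comparable with the \<open>L^2\<close> norm of the piecewise linear
  function, serve as Lyapunov functions: the trapezoidal form \<open>(x^2 + y^2) / 2\<close> per cell grows by at
  most a multiple of \<open>|d|^2\<close> in each step (upper Riesz bound), while the form
  \<open>(3 x^2 + 4 x y + 3 y^2) / 10\<close>, with less weight on high frequencies than the \<open>L^2\<close> norm, grows by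
  at least a multiple of \<open>|d|^2\<close> (lower Riesz bound). Both inequalities hold cell by cell after adding
  a telescoping term. The span is dense because the two-scale map is onto, being a diagonally dominant
  tridiagonal system.
\<close>

section \<open>Smooth functions and test functions\<close>

text \<open>Normalising by the seminorm is what lets one pair of constants serve all levels. A
  wavelet of level j then has a derivative with nodal values of squared size comparable with 2^j,
  while integration over 2^(j+1) cells brings the factor 2^-(j+1). Level j thus contributes to both
  Lyapunov functions an amount comparable with the plain sum of its squared coefficients, and adding
  up the levels loses nothing. The Riesz property is asserted in the full norm, whereas the
  estimates concern derivatives; the Poincare inequality bridges the two at the cost of a factor 2.
  Elements of the spaces are functions on the line of which only the values in the unit interval
  count, weak derivatives are choices, and H_0^1 is a closure of test functions. Hence derivatives
  are carried explicitly, as continuous functions with a given primitive, and such primitives are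
  shown to be limits of test functions by approximating the derivative, correcting its mean and
  integrating. Infinite sums exist because H^1 is complete.\<close>

definition smooth :: "(real \<Rightarrow> real) \<Rightarrow> bool" where
  "smooth u \<longleftrightarrow> (\<forall>n x. (deriv ^^ n) u differentiable (at x))"

text \<open>Iterated derivatives of a concrete function need no formula: they stay in any class
  closed under differentiation, by induction on the order.\<close>

lemma smooth_coinduct:
  assumes "u \<in> A" and step: "\<And>w. w \<in> A \<Longrightarrow> \<exists>w'\<in>A. \<forall>x. (w has_real_derivative w' x) (at x)"
  shows "smooth u"
proof -
  have "(deriv ^^ n) u \<in> A" for n
  proof (induction n)
    case 0
    then show ?case using assms(1) by simp
  next
    case (Suc n)
    obtain w' where w': "w' \<in> A" "\<forall>x. ((deriv ^^ n) u has_real_derivative w' x) (at x)"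
      using step[OF Suc.IH] by blast
    have "deriv ((deriv ^^ n) u) = w'"
      using w'(2) by (intro ext DERIV_imp_deriv) blast
    then show ?case using w'(1) by simp
  qed
  then show ?thesis
    unfolding smooth_def using step by (meson real_differentiable_def)
qed

lemma smooth_DERIV:
  assumes "smooth u"
  shows "(u has_real_derivative deriv u x) (at x)"
proof -
  have "(deriv ^^ 0) u differentiable (at x)"
    using assms unfolding smooth_def by blast
  then show ?thesis
    by (simp add: DERIV_deriv_iff_real_differentiable)
qed

lemma smooth_deriv:
  assumes "smooth u"
  shows "smooth (deriv u)"
  unfolding smooth_def
proof (intro allI)
  fix n x
  have "(deriv ^^ Suc n) u differentiable (at x)"
    using assms unfolding smooth_def by blast
  then show "(deriv ^^ n) (deriv u) differentiable (at x)"
    by (simp add: funpow_swap1)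
qed

lemma smooth_continuous_on: "smooth u \<Longrightarrow> continuous_on S u"
  by (meson DERIV_isCont continuous_at_imp_continuous_on smooth_DERIV)

lemma smooth_antideriv:
  assumes "smooth v" "\<And>x. (u has_real_derivative v x) (at x)"
  shows "smooth u"
proof (rule smooth_coinduct[of u "insert u (Collect smooth)"])
  fix w assume "w \<in> insert u (Collect smooth)"
  then have "w = u \<or> smooth w" by blast
  then show "\<exists>w'\<in>insert u (Collect smooth). \<forall>x. (w has_real_derivative w' x) (at x)"
    using assms smooth_DERIV[of w] smooth_deriv[of w] by blast
qed simp

lemma smooth_lincomb:
  assumes "smooth u" "smooth v"
  shows "smooth (\<lambda>x. a * u x + b * v x)"
proof (rule smooth_coinduct)
  show "(\<lambda>x. a * u x + b * v x) \<in> {\<lambda>x. a * p x + b * q x |p q. smooth p \<and> smooth q}"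
    using assms by blast
next
  fix w assume "w \<in> {\<lambda>x. a * p x + b * q x |p q. smooth p \<and> smooth q}"
  then obtain p q where w: "w = (\<lambda>x. a * p x + b * q x)" "smooth p" "smooth q" by blast
  have "(w has_real_derivative a * deriv p x + b * deriv q x) (at x)" for x
    unfolding w(1) by (auto intro!: derivative_eq_intros smooth_DERIV w(2,3))
  moreover have "(\<lambda>x. a * deriv p x + b * deriv q x) \<in> {\<lambda>x. a * p x + b * q x |p q. smooth p \<and> smooth q}"
    using smooth_deriv w(2,3) by blast
  ultimately show "\<exists>w'\<in>{\<lambda>x. a * p x + b * q x |p q. smooth p \<and> smooth q}. \<forall>x. (w has_real_derivative w' x) (at x)"
    by (intro bexI[of _ "\<lambda>x. a * deriv p x + b * deriv q x"]) auto
qed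

text \<open>The classical flat function exp(-1/t), divided by powers of t because differentiation
  produces them: the derivative at index k combines the indices k + 1 and k + 2, so their linear
  span is closed under differentiation.\<close>

definition flat_exp :: "nat \<Rightarrow> real \<Rightarrow> real" where
  "flat_exp k t = (if t > 0 then exp (- (1 / t)) / t ^ k else 0)"

lemma flat_exp_tendsto_0: "(flat_exp k \<longlongrightarrow> 0) (at 0)"
proof -
  have "((\<lambda>y::real. y ^ k / exp y) \<longlongrightarrow> 0) at_top"
    by (rule tendsto_power_div_exp_0)
  then have "((\<lambda>t::real. inverse t ^ k / exp (inverse t)) \<longlongrightarrow> 0) (at_right 0)"
    using filterlim_compose[OF _ filterlim_inverse_at_top_right] by blast
  moreover have "\<forall>\<^sub>F t::real in at_right 0. inverse t ^ k / exp (inverse t) = flat_exp k t"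
    unfolding eventually_at_right_field
    by (intro exI[of _ 1]) (auto simp: flat_exp_def field_simps exp_minus)
  ultimately have R: "(flat_exp k \<longlongrightarrow> 0) (at_right 0)"
    by (rule Lim_transform_eventually)
  have "\<forall>\<^sub>F t::real in at_left 0. 0 = flat_exp k t"
    unfolding eventually_at_left_field
    by (intro exI[of _ "-1"]) (auto simp: flat_exp_def)
  then have "(flat_exp k \<longlongrightarrow> 0) (at_left 0)"
    using tendsto_const Lim_transform_eventually by blast
  with R show ?thesis by (simp add: filterlim_at_split)
qed

lemma flat_exp_DERIV:
  "(flat_exp k has_real_derivative - real k * flat_exp (k + 1) t + flat_exp (k + 2) t) (at t)"
proof -
  consider "t > 0" | "t < 0" | "t = 0" by linarith
  then show ?thesis
  proof cases
    case 1
    have D1: "((\<lambda>t. exp (- (1 / t))) has_real_derivative exp (- (1 / t)) * (1 / t^2)) (at t)"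
      using 1 by (auto intro!: derivative_eq_intros simp: power2_eq_square field_simps)
    have D2: "(inverse has_real_derivative - (1 / t^2)) (at t)"
      using 1 by (auto intro!: derivative_eq_intros simp: power2_eq_square field_simps)
    have "((\<lambda>t. exp (- (1 / t)) * inverse t ^ k) has_real_derivative
        exp (- (1 / t)) * (1 / t^2) * inverse t ^ k
         + exp (- (1 / t)) * (real k * inverse t ^ (k - 1) * (- (1 / t^2)))) (at t)"
      by (rule DERIV_cong[OF DERIV_mult[OF D1 DERIV_power[OF D2]]]) (simp add: mult_ac)
    moreover have "exp (- (1 / t)) * (1 / t^2) * inverse t ^ k
         + exp (- (1 / t)) * (real k * inverse t ^ (k - 1) * (- (1 / t^2)))
         = - real k * flat_exp (k + 1) t + flat_exp (k + 2) t"
    proof (cases k)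
      case 0
      then show ?thesis using 1 by (simp add: flat_exp_def power2_eq_square)
    next
      case (Suc m)
      then show ?thesis using 1
        by (simp add: flat_exp_def field_simps power2_eq_square)
    qed
    ultimately have "((\<lambda>t. exp (- (1 / t)) * inverse t ^ k) has_real_derivative
        - real k * flat_exp (k + 1) t + flat_exp (k + 2) t) (at t)"
      by simp
    then show ?thesis
    proof (rule DERIV_cong_ev[THEN iffD1, rotated 3])
      show "\<forall>\<^sub>F x in nhds t. exp (- (1 / x)) * inverse x ^ k = flat_exp k x"
        using eventually_nhds_in_open[of "{0<..}" t] 1
        by (auto elim!: eventually_mono simp: flat_exp_def field_simps)
    qed auto
  next
    case 2
    have "((\<lambda>t::real. 0) has_real_derivative 0) (at t)" by simp
    then show ?thesis
    proof (rule DERIV_cong_ev[THEN iffD1, rotated 3])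
      show "\<forall>\<^sub>F x in nhds t. 0 = flat_exp k x"
        using eventually_nhds_in_open[of "{..<0}" t] 2
        by (auto elim!: eventually_mono simp: flat_exp_def)
    qed (use 2 in \<open>auto simp: flat_exp_def\<close>)
  next
    \<comment> \<open>At the origin the difference quotient is \<open>flat_exp (Suc k)\<close>
      itself, whose limit there is already known to be 0.\<close>
    case 3
    have "\<forall>\<^sub>F h::real in at 0. flat_exp (Suc k) h = (flat_exp k (0 + h) - flat_exp k 0) / h"
      by (auto simp: eventually_at flat_exp_def field_simps intro!: exI[of _ 1])
    with flat_exp_tendsto_0[of "Suc k"]
    have "((\<lambda>h. (flat_exp k (0 + h) - flat_exp k 0) / h) \<longlongrightarrow> 0) (at 0)"
      by (rule Lim_transform_eventually)
    then show ?thesis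
      using 3 by (simp add: DERIV_def flat_exp_def)
  qed
qed

text \<open>Contains the products of polynomials and cutoffs. The generators have derivatives in the
  algebra, so the product rule closes it under differentiation, and no Leibniz formula of higher
  order is needed.\<close>

inductive_set flat_algebra :: "(real \<Rightarrow> real) set" where
  const: "(\<lambda>_. c) \<in> flat_algebra"
| ident: "(\<lambda>x. x) \<in> flat_algebra"
| flat: "(\<lambda>x. flat_exp k (a * x + b)) \<in> flat_algebra"
| add: "u \<in> flat_algebra \<Longrightarrow> v \<in> flat_algebra \<Longrightarrow> (\<lambda>x. u x + v x) \<in> flat_algebra"
| mult: "u \<in> flat_algebra \<Longrightarrow> v \<in> flat_algebra \<Longrightarrow> (\<lambda>x. u x * v x) \<in> flat_algebra"

lemma flat_algebra_smooth:
  assumes "u \<in> flat_algebra"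
  shows "smooth u"
proof (rule smooth_coinduct[OF assms])
  fix w assume "w \<in> flat_algebra"
  then show "\<exists>w'\<in>flat_algebra. \<forall>x. (w has_real_derivative w' x) (at x)"
  proof induction
    case (const c)
    show ?case
      by (rule bexI[of _ "\<lambda>_. 0"]) (auto intro: flat_algebra.const)
  next
    case ident
    show ?case
      by (rule bexI[of _ "\<lambda>_. 1"]) (auto intro: flat_algebra.const)
  next
    case (flat k a b)
    let ?w = "\<lambda>x. a * (- real k * flat_exp (k + 1) (a * x + b) + flat_exp (k + 2) (a * x + b))"
    have "?w \<in> flat_algebra"
      by (intro flat_algebra.mult flat_algebra.add flat_algebra.const flat_algebra.flat)
    moreover have "((\<lambda>x. flat_exp k (a * x + b)) has_real_derivative ?w x) (at x)" for x
      by (rule DERIV_cong[OF DERIV_chain2[OF flat_exp_DERIV]]) (auto intro!: derivative_eq_intros)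
    ultimately show ?case by (intro bexI[of _ ?w] allI)
  next
    case (add u v)
    then obtain u' v' where "u' \<in> flat_algebra" "\<forall>x. (u has_real_derivative u' x) (at x)"
      "v' \<in> flat_algebra" "\<forall>x. (v has_real_derivative v' x) (at x)" by blast
    then show ?case
      by (intro bexI[of _ "\<lambda>x. u' x + v' x"]) (auto intro!: derivative_eq_intros flat_algebra.add)
  next
    case (mult u v)
    then obtain u' v' where *: "u' \<in> flat_algebra" "\<forall>x. (u has_real_derivative u' x) (at x)"
      "v' \<in> flat_algebra" "\<forall>x. (v has_real_derivative v' x) (at x)" by blast
    have "(\<lambda>x. u' x * v x + u x * v' x) \<in> flat_algebra"
      by (intro flat_algebra.add flat_algebra.mult *(1,3) mult.hyps)
    moreover have "((\<lambda>x. u x * v x) has_real_derivative u' x * v x + u x * v' x) (at x)" for x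
      using *(2,4) by (auto intro!: derivative_eq_intros)
    ultimately show ?case by (intro bexI[of _ "\<lambda>x. u' x * v x + u x * v' x"] allI)
  qed
qed

lemma real_polynomial_function_flat_algebra:
  assumes "real_polynomial_function (p :: real \<Rightarrow> real)"
  shows "p \<in> flat_algebra"
  using assms
proof induction
  case (linear f)
  then obtain c where "f = (\<lambda>x. x * c)" by (auto simp: real_bounded_linear)
  then show ?case
    using flat_algebra.mult[OF flat_algebra.ident flat_algebra.const] by simp
qed (auto intro: flat_algebra.intros)

section \<open>Test functions and the approximation of continuous functions by them\<close>

lemma test_functions_iff:
  "u \<in> test_functions \<longleftrightarrow> smooth u \<and>
     (\<exists>K. compact K \<and> K \<subseteq> {0<..<1} \<and> (\<forall>x. x \<notin> K \<longrightarrow> u x = 0))"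
  by (simp add: test_functions_def smooth_def)

text \<open>An interval is wanted because an antiderivative that is 0 to the left of the support may
  be a nonzero constant in the gaps of a general compact set.\<close>

lemma test_function_support:
  assumes "u \<in> test_functions"
  obtains a b where "0 < a" "a \<le> b" "b < 1" "\<And>x. x \<notin> {a..b} \<Longrightarrow> u x = 0"
proof -
  obtain K where K: "compact K" "K \<subseteq> {0<..<1}" "\<And>x. x \<notin> K \<Longrightarrow> u x = 0"
    using assms by (auto simp: test_functions_iff)
  show ?thesis
  proof (cases "K = {}")
    case True
    then show ?thesis using K that[of "1/2" "1/2"] by auto
  next
    case False
    obtain a b where ab: "a \<in> K" "b \<in> K" "\<And>x. x \<in> K \<Longrightarrow> a \<le> x" "\<And>x. x \<in> K \<Longrightarrow> x \<le> b"
      using compact_attains_inf[OF K(1) False] compact_attains_sup[OF K(1) False] by blast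
    show ?thesis
    proof (rule that[of a b])
      show "u x = 0" if "x \<notin> {a..b}" for x
        using K(3)[of x] ab that by auto
    qed (use ab K(2) in auto)
  qed
qed

lemma test_functions_lincomb:
  assumes "u \<in> test_functions" "v \<in> test_functions"
  shows "(\<lambda>x. a * u x + b * v x) \<in> test_functions"
proof -
  obtain K L where "compact K" "K \<subseteq> {0<..<1}" "\<And>x. x \<notin> K \<Longrightarrow> u x = 0"
     "compact L" "L \<subseteq> {0<..<1}" "\<And>x. x \<notin> L \<Longrightarrow> v x = 0"
    using assms by (auto simp: test_functions_iff)
  then show ?thesis
    using assms smooth_lincomb by (auto simp: test_functions_iff intro!: exI[of _ "K \<union> L"])
qed

lemma test_functions_cmult:
  assumes "u \<in> test_functions"
  shows "(\<lambda>x. a * u x) \<in> test_functions"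
  using test_functions_lincomb[OF assms assms, of a 0] by simp

text \<open>A Weierstrass polynomial times a smooth cutoff. As \<open>g\<close> need not vanish at 0
  and 1, uniform convergence is out of reach; pointwise convergence with a common bound is what
  dominated convergence asks for.\<close>

lemma test_function_approx:
  assumes "continuous_on {0..1} g"
  obtains u B where "\<And>n::nat. u n \<in> test_functions"
    "\<And>n x. x \<in> {0<..<1} \<Longrightarrow> \<bar>u n x\<bar> \<le> B"
    "\<And>x. x \<in> {0<..<1} \<Longrightarrow> (\<lambda>n. u n x) \<longlonglongrightarrow> g x"
proof -
  have "\<exists>p. real_polynomial_function p \<and> (\<forall>x\<in>{0..1}. \<bar>g x - p x\<bar> < 1 / real (Suc n))" for n
    by (rule Stone_Weierstrass_real_polynomial_function[OF compact_Icc assms, of "1 / real (Suc n)"]) auto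
  then obtain p where p: "\<And>n. real_polynomial_function (p n)"
      "\<And>n x. x \<in> {0..1} \<Longrightarrow> \<bar>g x - p n x\<bar> < 1 / real (Suc n)"
    by metis
  have "bounded (g ` {0..1})"
    using assms compact_continuous_image compact_imp_bounded compact_Icc by blast
  then have "\<exists>B0. \<forall>x\<in>{0..1}. \<bar>g x\<bar> \<le> B0"
    by (simp add: bounded_iff)
  then obtain B0 where B0: "\<And>x. x \<in> {0..1} \<Longrightarrow> \<bar>g x\<bar> \<le> B0"
    by blast
  \<comment> \<open>The arguments are (n+1) x - 1 and (n+1) (1 - x) - 1. Both are positive only
    between 1/(n+1) and 1 - 1/(n+1), and both tend to infinity at a fixed x in (0,1), where
    exp(-1/t) then tends to 1.\<close>
  define bump where "bump = (\<lambda>n x. flat_exp 0 (real (Suc n) * x + (-1)) * flat_exp 0 (- real (Suc n) * x + (real (Suc n) - 1)))"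
  define u where "u = (\<lambda>n x. p n x * bump n x)"
  show ?thesis
  proof (rule that[of u "B0 + 1"])
    show "u n \<in> test_functions" for n
    proof -
      have "u n \<in> flat_algebra"
        unfolding u_def bump_def
        by (intro flat_algebra.mult flat_algebra.flat real_polynomial_function_flat_algebra p(1))
      moreover have "u n x = 0" if "x \<notin> {1 / real (Suc n) .. 1 - 1 / real (Suc n)}" for x
      proof -
        have "real (Suc n) * x + (-1) \<le> 0 \<or> - real (Suc n) * x + (real (Suc n) - 1) \<le> 0"
          using that by (auto simp: field_simps)
        then show ?thesis by (auto simp: u_def bump_def flat_exp_def)
      qed
      moreover have "{1 / real (Suc n) .. 1 - 1 / real (Suc n)} \<subseteq> {0<..<1}"
      proof
        fix x assume x: "x \<in> {1 / real (Suc n) .. 1 - 1 / real (Suc n)}"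
        have "0 < 1 / real (Suc n)" by simp
        with x show "x \<in> {0<..<1}" unfolding atLeastAtMost_iff greaterThanLessThan_iff by linarith
      qed
      ultimately show ?thesis
        using flat_algebra_smooth by (auto simp: test_functions_iff intro!: exI[of _ "{1 / real (Suc n) .. 1 - 1 / real (Suc n)}"])
    qed
    have flat01: "0 \<le> flat_exp 0 t \<and> flat_exp 0 t \<le> 1" for t
      by (auto simp: flat_exp_def)
    show "\<bar>u n x\<bar> \<le> B0 + 1" if "x \<in> {0<..<1}" for n x
    proof -
      have "\<bar>p n x\<bar> \<le> B0 + 1"
      proof -
        have "1 / real (Suc n) \<le> 1" by simp
        moreover have "x \<in> {0..1}" using that by simp
        ultimately show ?thesis using B0[of x] p(2)[of x n] by linarith
      qed
      moreover have "\<bar>bump n x\<bar> \<le> 1"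
        using flat01 by (auto simp: bump_def abs_mult intro!: mult_le_one)
      ultimately have "\<bar>p n x\<bar> * \<bar>bump n x\<bar> \<le> (B0 + 1) * 1"
        by (intro mult_mono) auto
      then show ?thesis by (simp add: u_def abs_mult)
    qed
    show "(\<lambda>n. u n x) \<longlonglongrightarrow> g x" if x: "x \<in> {0<..<1}" for x
    proof -
      have flat_lim: "(\<lambda>n. flat_exp 0 (X n)) \<longlonglongrightarrow> 1" if "filterlim X at_top sequentially" for X :: "nat \<Rightarrow> real"
      proof -
        have "((\<lambda>t::real. exp (- inverse t)) \<longlongrightarrow> exp (- 0)) at_top"
          by (intro tendsto_exp tendsto_minus tendsto_inverse_0_at_top filterlim_ident)
        moreover have "\<forall>\<^sub>F t::real in at_top. exp (- inverse t) = flat_exp 0 t"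
          using eventually_gt_at_top[of 0] by eventually_elim (auto simp: flat_exp_def inverse_eq_divide)
        ultimately have "(flat_exp 0 \<longlongrightarrow> 1) at_top"
          using Lim_transform_eventually by fastforce
        then show ?thesis using that filterlim_compose by blast
      qed
      have S: "filterlim (\<lambda>n. real (Suc n)) at_top sequentially"
        using filterlim_compose[OF filterlim_real_sequentially filterlim_Suc] by simp
      have t: "filterlim (\<lambda>n. real (Suc n) * y + (-1)) at_top sequentially" if "y > 0" for y
      proof -
        have "filterlim (\<lambda>n. y * real (Suc n)) at_top sequentially"
          by (rule filterlim_tendsto_pos_mult_at_top[OF tendsto_const that S])
        then have "filterlim (\<lambda>n. (-1) + y * real (Suc n)) at_top sequentially"
          by (rule filterlim_tendsto_add_at_top[OF tendsto_const])
        then show ?thesis by (simp add: algebra_simps)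
      qed
      have "(\<lambda>n. bump n x) \<longlonglongrightarrow> 1 * 1"
      proof -
        have "(\<lambda>n. flat_exp 0 (real (Suc n) * x + (-1)) * flat_exp 0 (real (Suc n) * (1 - x) + (-1))) \<longlonglongrightarrow> 1 * 1"
          using x by (intro tendsto_mult flat_lim t) auto
        then show ?thesis by (simp add: bump_def algebra_simps)
      qed
      moreover have "(\<lambda>n. p n x) \<longlonglongrightarrow> g x"
      proof -
        have "(\<lambda>n. 1 / real (Suc n)) \<longlonglongrightarrow> 0"
          using LIMSEQ_inverse_real_of_nat by (simp add: inverse_eq_divide)
        then show ?thesis
        proof (rule metric_tendsto_imp_tendsto)
          show "\<forall>\<^sub>F n in sequentially. dist (p n x) (g x) \<le> dist (1 / real (Suc n)) 0"
            using p(2)[of x] x by (auto simp: dist_real_def intro!: always_eventually less_imp_le simp: abs_minus_commute)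
        qed
      qed
      ultimately have "(\<lambda>n. p n x * bump n x) \<longlonglongrightarrow> g x * (1 * 1)"
        by (intro tendsto_mult)
      then show ?thesis by (simp add: u_def)
    qed
  qed
qed

section \<open>The space of square integrable functions\<close>

lemma finite_measure_unit: "finite_measure unit_measure"
  by (rule finite_measure_lebesgue_on) simp

lemma measure_unit: "measure unit_measure {0<..<1} = 1"
  by (simp add: measure_restrict_space)

lemma L2_spaceI:
  assumes "f \<in> borel_measurable unit_measure" "\<And>x. x \<in> {0<..<1} \<Longrightarrow> \<bar>f x\<bar> \<le> B"
  shows "f \<in> L2_space"
proof -
  interpret finite_measure unit_measure by (rule finite_measure_unit)
  have "integrable unit_measure (\<lambda>x. (f x)^2)"
  proof (rule integrable_const_bound[of _ "B^2"])
    have "(f x)^2 \<le> B^2" if "x \<in> {0<..<1}" for x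
      using assms(2)[OF that] by (simp add: abs_le_square_iff[symmetric])
    then show "AE x in unit_measure. norm ((f x)\<^sup>2) \<le> B\<^sup>2"
      by (intro AE_I2) auto
  qed (use assms(1) in measurable)
  with assms(1) show ?thesis by (simp add: L2_space_def)
qed

lemma L2_space_continuous:
  assumes "continuous_on {0..1} f"
  shows "f \<in> L2_space"
proof -
  have "bounded (f ` {0..1})"
    using assms compact_continuous_image compact_imp_bounded compact_Icc by blast
  then obtain B where "\<forall>x\<in>{0..1}. \<bar>f x\<bar> \<le> B"
    by (auto simp: bounded_iff)
  moreover have "continuous_on {0<..<1} f"
    using assms by (rule continuous_on_subset) auto
  then have "f \<in> borel_measurable unit_measure"
    by (rule continuous_imp_measurable_on_sets_lebesgue) simp
  ultimately show ?thesis by (intro L2_spaceI[of f B]) auto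
qed

lemma L2_space_measurable: "f \<in> L2_space \<Longrightarrow> f \<in> borel_measurable unit_measure"
  by (simp add: L2_space_def)

lemma L2_space_integrable_mult:
  assumes "f \<in> L2_space" "g \<in> L2_space"
  shows "integrable unit_measure (\<lambda>x. f x * g x)"
proof (rule Bochner_Integration.integrable_bound)
  show "integrable unit_measure (\<lambda>x. (f x)^2 + (g x)^2)"
    using assms by (simp add: L2_space_def)
  show "(\<lambda>x. f x * g x) \<in> borel_measurable unit_measure"
    by (intro borel_measurable_times L2_space_measurable assms)
  have "\<bar>f x * g x\<bar> \<le> (f x)^2 + (g x)^2" for x
  proof -
    have "2 * \<bar>f x\<bar> * \<bar>g x\<bar> \<le> (f x)^2 + (g x)^2"
      using sum_squares_bound[of "\<bar>f x\<bar>" "\<bar>g x\<bar>"] by simp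
    moreover have "0 \<le> \<bar>f x\<bar> * \<bar>g x\<bar>" by simp
    ultimately show ?thesis unfolding abs_mult by linarith
  qed
  then show "AE x in unit_measure. norm (f x * g x) \<le> norm ((f x)^2 + (g x)^2)"
    by auto
qed

lemma L2_space_one: "(\<lambda>_. 1) \<in> L2_space"
  by (rule L2_spaceI) auto

lemma L2_space_integrable:
  assumes "f \<in> L2_space"
  shows "integrable unit_measure f"
  using L2_space_integrable_mult[OF assms L2_space_one] by simp

lemma L2_space_lincomb:
  assumes "f \<in> L2_space" "g \<in> L2_space"
  shows "(\<lambda>x. a * f x + b * g x) \<in> L2_space"
proof -
  have "integrable unit_measure (\<lambda>x. a^2 * (f x)^2 + (2 * a * b) * (f x * g x) + b^2 * (g x)^2)"
    using assms L2_space_integrable_mult[OF assms]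
    by (intro Bochner_Integration.integrable_add integrable_mult_right) (auto simp: L2_space_def)
  moreover have "(\<lambda>x. a^2 * (f x)^2 + (2 * a * b) * (f x * g x) + b^2 * (g x)^2) = (\<lambda>x. (a * f x + b * g x)^2)"
    by (auto simp: power2_eq_square algebra_simps)
  moreover have "(\<lambda>x. a * f x + b * g x) \<in> borel_measurable unit_measure"
    by (intro borel_measurable_add borel_measurable_times L2_space_measurable assms borel_measurable_const)
  ultimately show ?thesis
    by (simp add: L2_space_def)
qed

lemma L2_space_diff:
  assumes "f \<in> L2_space" "g \<in> L2_space"
  shows "(\<lambda>x. f x - g x) \<in> L2_space"
  using L2_space_lincomb[OF assms, of 1 "-1"] by simp

lemma L2_space_cmult:
  assumes "f \<in> L2_space"
  shows "(\<lambda>x. a * f x) \<in> L2_space"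
  using L2_space_lincomb[OF assms assms, of a 0] by simp

lemma L2_norm_nonneg: "0 \<le> L2_norm f"
  by (simp add: L2_norm_def)

lemma L2_norm_power2: "(L2_norm f)^2 = (LINT x|unit_measure. (f x)^2)"
  by (simp add: L2_norm_def)

lemma L2_norm_cmult: "L2_norm (\<lambda>x. a * f x) = \<bar>a\<bar> * L2_norm f"
  by (simp add: L2_norm_def power_mult_distrib real_sqrt_mult)

lemma L2_norm_minus_commute: "L2_norm (\<lambda>x. f x - g x) = L2_norm (\<lambda>x. g x - f x)"
  by (simp add: L2_norm_def power2_commute)

lemma L2_norm_lincomb_power2:
  assumes "f \<in> L2_space" "g \<in> L2_space"
  shows "(L2_norm (\<lambda>x. a * f x + b * g x))^2 =
    a^2 * (L2_norm f)^2 + 2 * a * b * (LINT x|unit_measure. f x * g x) + b^2 * (L2_norm g)^2"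
proof -
  have "(L2_norm (\<lambda>x. a * f x + b * g x))^2 =
     (LINT x|unit_measure. a^2 * (f x)^2 + (2 * a * b) * (f x * g x) + b^2 * (g x)^2)"
    unfolding L2_norm_power2
    by (intro Bochner_Integration.integral_cong) (auto simp: power2_eq_square algebra_simps)
  also have "\<dots> = a^2 * (LINT x|unit_measure. (f x)^2) + (2 * a * b) * (LINT x|unit_measure. f x * g x)
      + b^2 * (LINT x|unit_measure. (g x)^2)"
    using assms L2_space_integrable_mult[OF assms] by (simp add: L2_space_def)
  finally show ?thesis by (simp add: L2_norm_power2)
qed

lemma L2_Cauchy_Schwarz:
  assumes "f \<in> L2_space" "g \<in> L2_space"
  shows "\<bar>LINT x|unit_measure. f x * g x\<bar> \<le> L2_norm f * L2_norm g"
proof -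
  define A B C where "A = (L2_norm f)^2" and "B = (LINT x|unit_measure. f x * g x)" and "C = (L2_norm g)^2"
  have quad: "0 \<le> s^2 * A + 2 * s * t * B + t^2 * C" for s t
    using L2_norm_lincomb_power2[OF assms, of s t] zero_le_power2[of "L2_norm (\<lambda>x. s * f x + t * g x)"]
    by (simp add: A_def B_def C_def)
  have "B^2 \<le> A * C"
  proof (cases "C = 0")
    case True
    have "B = 0"
    proof (rule ccontr)
      assume "B \<noteq> 0"
      \<comment> \<open>For C = 0 the form takes the value A - (A + 1) = -1 at this point.\<close>
      then show False using quad[of 1 "- (A + 1) / (2 * B)"] True by (simp add: field_simps)
    qed
    then show ?thesis using True by simp
  next
    case False
    then have C: "C > 0" by (simp add: C_def)
    \<comment> \<open>The form at (C, -B), its minimiser in the second variable up to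
      scaling.\<close>
    have "0 \<le> C * (A * C - B^2)"
      using quad[of C "- B"] by (simp add: power2_eq_square algebra_simps)
    then show ?thesis using C by (simp add: zero_le_mult_iff)
  qed
  then have "\<bar>B\<bar> \<le> sqrt (A * C)"
    by (simp add: real_le_rsqrt)
  then show ?thesis
    by (simp add: A_def B_def C_def real_sqrt_mult L2_norm_nonneg)
qed

lemma L2_norm_triangle:
  assumes "f \<in> L2_space" "g \<in> L2_space"
  shows "L2_norm (\<lambda>x. f x + g x) \<le> L2_norm f + L2_norm g"
proof (rule power2_le_imp_le)
  have "(L2_norm (\<lambda>x. f x + g x))^2 = (L2_norm f)^2 + 2 * (LINT x|unit_measure. f x * g x) + (L2_norm g)^2"
    using L2_norm_lincomb_power2[OF assms, of 1 1] by simp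
  also have "\<dots> \<le> (L2_norm f + L2_norm g)^2"
    using L2_Cauchy_Schwarz[OF assms] by (simp add: power2_sum)
  finally show "(L2_norm (\<lambda>x. f x + g x))^2 \<le> (L2_norm f + L2_norm g)^2" .
qed (simp add: L2_norm_nonneg)

lemma L2_norm_integral_abs_le:
  assumes "f \<in> L2_space"
  shows "(LINT x|unit_measure. \<bar>f x\<bar>) \<le> L2_norm f"
proof -
  have "(\<lambda>x. \<bar>f x\<bar>) \<in> L2_space"
    using assms by (auto simp: L2_space_def)
  from L2_Cauchy_Schwarz[OF this L2_space_one]
  have "\<bar>LINT x|unit_measure. \<bar>f x\<bar>\<bar> \<le> L2_norm (\<lambda>x. \<bar>f x\<bar>) * L2_norm (\<lambda>_. 1)"
    by simp
  moreover have "L2_norm (\<lambda>_. 1) = 1"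
    by (simp add: L2_norm_def measure_unit)
  moreover have "L2_norm (\<lambda>x. \<bar>f x\<bar>) = L2_norm f"
    by (simp add: L2_norm_def)
  ultimately show ?thesis by simp
qed

lemma L2_norm_le_bound:
  assumes "f \<in> borel_measurable unit_measure" "\<And>x. x \<in> {0<..<1} \<Longrightarrow> \<bar>f x\<bar> \<le> B" "0 \<le> B"
  shows "L2_norm f \<le> B"
proof (rule power2_le_imp_le)
  interpret finite_measure unit_measure by (rule finite_measure_unit)
  have "(L2_norm f)^2 \<le> (LINT x|unit_measure. B^2)"
    unfolding L2_norm_power2
  proof (rule integral_mono)
    show "integrable unit_measure (\<lambda>x. (f x)^2)"
      using L2_spaceI[OF assms(1,2)] by (simp add: L2_space_def)
    show "(f x)^2 \<le> B^2" if "x \<in> space unit_measure" for x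
      using assms(2)[of x] that by (simp add: abs_le_square_iff[symmetric])
  qed simp
  then show "(L2_norm f)^2 \<le> B^2" by (simp add: measure_unit)
qed fact

section \<open>Limit theorems and completeness in L^2\<close>

lemma L2_norm_tendsto_0_dominated:
  assumes "\<And>n::nat. u n \<in> borel_measurable unit_measure" "g \<in> borel_measurable unit_measure"
    and B: "\<And>n x. x \<in> {0<..<1} \<Longrightarrow> \<bar>u n x\<bar> \<le> B"
    and lim: "\<And>x. x \<in> {0<..<1} \<Longrightarrow> (\<lambda>n. u n x) \<longlonglongrightarrow> g x"
  shows "(\<lambda>n. L2_norm (\<lambda>x. u n x - g x)) \<longlonglongrightarrow> 0"
proof -
  interpret finite_measure unit_measure by (rule finite_measure_unit)
  have gB: "\<bar>g x\<bar> \<le> B" if "x \<in> {0<..<1}" for x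
    using LIMSEQ_le_const2[OF tendsto_rabs[OF lim[OF that]], of B] B[OF that] by blast
  have "(\<lambda>n. LINT x|unit_measure. (u n x - g x)^2) \<longlonglongrightarrow> (LINT x|unit_measure. (0::real))"
  proof (rule integral_dominated_convergence[where w = "\<lambda>_. (2 * B)^2"])
    show "AE x in unit_measure. (\<lambda>n. (u n x - g x)\<^sup>2) \<longlonglongrightarrow> 0"
    proof (rule AE_I2)
      fix x assume "x \<in> space unit_measure"
      then have "(\<lambda>n. (u n x - g x)^2) \<longlonglongrightarrow> (g x - g x)^2"
        by (intro tendsto_intros lim) simp
      then show "(\<lambda>n. (u n x - g x)^2) \<longlonglongrightarrow> 0" by simp
    qed
    show "AE x in unit_measure. norm ((u n x - g x)\<^sup>2) \<le> (2 * B)\<^sup>2" for n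
    proof (rule AE_I2)
      fix x assume "x \<in> space unit_measure"
      then have "\<bar>u n x - g x\<bar> \<le> \<bar>2 * B\<bar>"
        using B[of x n] gB[of x] by auto
      then show "norm ((u n x - g x)^2) \<le> (2 * B)^2" by (simp add: abs_le_square_iff)
    qed
  qed (use assms(1,2) in auto)
  then have "(\<lambda>n. sqrt (LINT x|unit_measure. (u n x - g x)^2)) \<longlonglongrightarrow> sqrt 0"
    by (intro tendsto_real_sqrt) simp
  then show ?thesis by (simp add: L2_norm_def)
qed

text \<open>Fatou's lemma yields membership in L^2 and the norm bound together, so nothing about the
  integrability of the limit has to be known beforehand.\<close>

lemma L2_norm_Fatou:
  assumes f: "\<And>k::nat. f k \<in> L2_space" and g: "g \<in> borel_measurable unit_measure"
    and lim: "AE x in unit_measure. (\<lambda>k. f k x) \<longlonglongrightarrow> g x"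
    and e: "\<And>k. L2_norm (f k) \<le> e" "0 \<le> e"
  shows "g \<in> L2_space \<and> L2_norm g \<le> e"
proof -
  have m: "f k \<in> borel_measurable unit_measure" "integrable unit_measure (\<lambda>x. (f k x)^2)" for k
    using f by (auto simp: L2_space_def)
  have "(\<integral>\<^sup>+x. ennreal ((g x)^2) \<partial>unit_measure) = (\<integral>\<^sup>+x. liminf (\<lambda>k. ennreal ((f k x)^2)) \<partial>unit_measure)"
  proof (rule nn_integral_cong_AE, use lim in eventually_elim)
    fix x assume "(\<lambda>k. f k x) \<longlonglongrightarrow> g x"
    then have "(\<lambda>k. ennreal ((f k x)^2)) \<longlonglongrightarrow> ennreal ((g x)^2)"
      by (intro tendsto_ennrealI tendsto_power)
    then show "ennreal ((g x)^2) = liminf (\<lambda>k. ennreal ((f k x)^2))"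
      by (rule lim_imp_Liminf[OF sequentially_bot, symmetric])
  qed
  also have "\<dots> \<le> liminf (\<lambda>k. \<integral>\<^sup>+x. ennreal ((f k x)^2) \<partial>unit_measure)"
    using m(1) by (intro nn_integral_liminf) measurable
  also have "\<dots> = liminf (\<lambda>k. ennreal ((L2_norm (f k))^2))"
    using m(2) by (simp add: nn_integral_eq_integral L2_norm_power2)
  also have "\<dots> \<le> liminf (\<lambda>k::nat. ennreal (e^2))"
    using e L2_norm_nonneg by (intro Liminf_mono always_eventually allI ennreal_leI power_mono)
  also have "\<dots> = ennreal (e^2)" by (simp add: Liminf_const)
  finally have le: "(\<integral>\<^sup>+x. ennreal ((g x)^2) \<partial>unit_measure) \<le> ennreal (e^2)" .
  have int: "integrable unit_measure (\<lambda>x. (g x)^2)"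
    using g le by (intro integrableI_bounded) (auto simp: le_less_trans)
  have "ennreal ((L2_norm g)^2) \<le> ennreal (e^2)"
    using le nn_integral_eq_integral[OF int] by (simp add: L2_norm_power2)
  then have "(L2_norm g)^2 \<le> e^2" by simp
  then have "L2_norm g \<le> e" using e(2) by (rule power2_le_imp_le)
  with int g show ?thesis by (simp add: L2_space_def)
qed

text \<open>Riesz-Fischer. Along a subsequence the differences have L^2 norms below (1/2)^k, hence
  also L^1 norms, because the interval has measure 1. Their sum is finite almost everywhere, so the
  subsequence converges there, and Fatou turns the pointwise limit into a norm limit of the whole
  sequence.\<close>

lemma L2_complete:
  assumes f: "\<And>n::nat. f n \<in> L2_space"
    and cauchy: "\<And>e. e > 0 \<Longrightarrow> \<exists>N. \<forall>m\<ge>N. \<forall>n\<ge>N. L2_norm (\<lambda>x. f m x - f n x) < e"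
  obtains g where "g \<in> L2_space" "(\<lambda>n. L2_norm (\<lambda>x. g x - f n x)) \<longlonglongrightarrow> 0"
proof -
  have "\<exists>N. \<forall>m\<ge>N. \<forall>n\<ge>N. L2_norm (\<lambda>x. f m x - f n x) < (1/2)^k" for k
    by (rule cauchy) simp
  then obtain N where N: "\<And>k m n. N k \<le> m \<Longrightarrow> N k \<le> n \<Longrightarrow> L2_norm (\<lambda>x. f m x - f n x) < (1/2)^k"
    by metis
  \<comment> \<open>The sum puts \<open>r m\<close> above every \<open>N k\<close> with k \<le> m,
    whether or not \<open>N\<close> is monotone.\<close>
  define r where "r = (\<lambda>k. k + (\<Sum>i\<le>k. N i))"
  have r: "N k \<le> r m" if "k \<le> m" for k m
    unfolding r_def using that by (intro trans_le_add2 member_le_sum) auto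
  define h where "h = (\<lambda>k x. f (r (Suc k)) x - f (r k) x)"
  have hL2: "h k \<in> L2_space" for k
    unfolding h_def by (intro L2_space_diff f)
  have hm: "h k \<in> borel_measurable unit_measure" for k
    using hL2 by (simp add: L2_space_def)
  have h_le: "(\<integral>\<^sup>+x. ennreal \<bar>h k x\<bar> \<partial>unit_measure) \<le> ennreal ((1/2)^k)" for k
  proof -
    have "(\<integral>\<^sup>+x. ennreal \<bar>h k x\<bar> \<partial>unit_measure) = ennreal (LINT x|unit_measure. \<bar>h k x\<bar>)"
      using L2_space_integrable[OF hL2[of k]] by (intro nn_integral_eq_integral) auto
    also have "\<dots> \<le> ennreal ((1/2)^k)"
      using L2_norm_integral_abs_le[OF hL2[of k]] N[OF r[of k "Suc k"] r[of k k]]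
      by (intro ennreal_leI) (simp add: h_def)
    finally show ?thesis .
  qed
  have "(\<integral>\<^sup>+x. (\<Sum>k. ennreal \<bar>h k x\<bar>) \<partial>unit_measure) = (\<Sum>k. \<integral>\<^sup>+x. ennreal \<bar>h k x\<bar> \<partial>unit_measure)"
    using hm by (intro nn_integral_suminf) measurable
  also have "\<dots> \<le> (\<Sum>k. ennreal ((1/2)^k))"
    by (intro suminf_le h_le) auto
  also have "\<dots> = ennreal (\<Sum>k. (1/2)^k)"
    by (intro suminf_ennreal2) (auto simp: summable_geometric)
  also have "\<dots> < \<infinity>" by simp
  finally have "(\<integral>\<^sup>+x. (\<Sum>k. ennreal \<bar>h k x\<bar>) \<partial>unit_measure) \<noteq> \<infinity>" by simp
  then have "AE x in unit_measure. (\<Sum>k. ennreal \<bar>h k x\<bar>) \<noteq> \<infinity>"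
    using hm by (intro nn_integral_PInf_AE) measurable
  then have conv: "AE x in unit_measure. convergent (\<lambda>k. f (r k) x)"
  proof eventually_elim
    fix x assume "(\<Sum>k. ennreal \<bar>h k x\<bar>) \<noteq> \<infinity>"
    then have "summable (\<lambda>k. \<bar>h k x\<bar>)"
      by (intro summable_suminf_not_top) auto
    then have "summable (\<lambda>k. h k x)"
      by (rule summable_rabs_cancel)
    then have "convergent (\<lambda>n. \<Sum>k<n. h k x)"
      by (simp add: summable_iff_convergent)
    moreover have "(\<Sum>k<n. h k x) = f (r n) x - f (r 0) x" for n
      unfolding h_def by (rule sum_lessThan_telescope)
    ultimately have "convergent (\<lambda>n. f (r n) x - f (r 0) x)"
      by simp
    then have "convergent (\<lambda>n. (f (r n) x - f (r 0) x) + f (r 0) x)"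
      by (intro convergent_add convergent_const)
    then show "convergent (\<lambda>k. f (r k) x)" by simp
  qed
  define g where "g = (\<lambda>x. lim (\<lambda>k. f (r k) x))"
  have fm: "f k \<in> borel_measurable unit_measure" for k
    using f by (simp add: L2_space_def)
  have gm: "g \<in> borel_measurable unit_measure"
    unfolding g_def using fm by measurable
  have g_lim: "AE x in unit_measure. (\<lambda>k. f (r k) x) \<longlonglongrightarrow> g x"
    using conv by eventually_elim (simp add: g_def convergent_LIMSEQ_iff)
  \<comment> \<open>Fatou in the variable \<open>i\<close> with \<open>n\<close> fixed: the Cauchy
    estimate between \<open>f (r (i + k))\<close> and \<open>f n\<close> survives the limit.\<close>
  have close: "(\<lambda>x. g x - f n x) \<in> L2_space \<and> L2_norm (\<lambda>x. g x - f n x) \<le> (1/2)^k" if n: "N k \<le> n" for k n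
  proof (rule L2_norm_Fatou[where f = "\<lambda>i x. f (r (i + k)) x - f n x"])
    show "AE x in unit_measure. (\<lambda>i. f (r (i + k)) x - f n x) \<longlonglongrightarrow> g x - f n x"
      using g_lim by eventually_elim (intro tendsto_diff tendsto_const LIMSEQ_ignore_initial_segment)
    fix i
    have "N k \<le> r (i + k)"
      by (rule r) simp
    then show "L2_norm (\<lambda>x. f (r (i + k)) x - f n x) \<le> (1/2)^k"
      using N[OF _ n] by (simp add: less_imp_le)
  qed (use f fm gm in \<open>auto intro: L2_space_diff\<close>)
  have "(\<lambda>x. 1 * (g x - f (N 0) x) + 1 * f (N 0) x) \<in> L2_space"
    using close[of 0 "N 0"] f by (intro L2_space_lincomb) auto
  then have gL2: "g \<in> L2_space" by simp
  have "(\<lambda>n. L2_norm (\<lambda>x. g x - f n x)) \<longlonglongrightarrow> 0"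
  proof (rule LIMSEQ_I)
    fix e :: real assume "e > 0"
    then obtain k where k: "(1/2)^k < e"
      using real_arch_pow_inv[of e "1/2"] by auto
    show "\<exists>no. \<forall>n\<ge>no. norm (L2_norm (\<lambda>x. g x - f n x) - 0) < e"
      using close[of k] k L2_norm_nonneg by (intro exI[of _ "N k"]) (auto intro: le_less_trans)
  qed
  with gL2 show ?thesis by (rule that)
qed

section \<open>Weak derivatives\<close>

text \<open>Two integrals meet here: Lebesgue on the open interval for norms, gauge on the closed
  interval for the fundamental theorem of calculus. The endpoints are a null set.\<close>

lemma LINT_unit_eqI:
  fixes f :: "real \<Rightarrow> real"
  assumes "integrable unit_measure f" "(f has_integral I) {0..1}"
  shows "(LINT x|unit_measure. f x) = I"
proof -
  have "(f has_integral (LINT x|unit_measure. f x)) {0<..<1}"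
    using has_integral_integral_lebesgue_on[OF assms(1)] by simp
  then have "(f has_integral (LINT x|unit_measure. f x)) {0..1}"
    by (simp add: has_integral_Icc_iff_Ioo)
  then show ?thesis using assms(2) has_integral_unique by blast
qed

lemma test_function_L2:
  assumes "u \<in> test_functions"
  shows "u \<in> L2_space" "deriv u \<in> L2_space"
  using assms
  by (auto simp: test_functions_iff intro!: L2_space_continuous smooth_continuous_on smooth_deriv)

lemma tendsto_L2_inner:
  assumes h: "h \<in> L2_space" and u: "\<And>n::nat. u n \<in> L2_space" and g: "g \<in> L2_space"
    and lim: "(\<lambda>n. L2_norm (\<lambda>x. u n x - g x)) \<longlonglongrightarrow> 0"
  shows "(\<lambda>n. LINT x|unit_measure. u n x * h x) \<longlonglongrightarrow> (LINT x|unit_measure. g x * h x)"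
proof -
  have "(\<lambda>n. (LINT x|unit_measure. u n x * h x) - (LINT x|unit_measure. g x * h x)) \<longlonglongrightarrow> 0"
  proof (rule Lim_null_comparison)
    show "(\<lambda>n. L2_norm (\<lambda>x. u n x - g x) * L2_norm h) \<longlonglongrightarrow> 0"
      using tendsto_mult_right[OF lim, of "L2_norm h"] by simp
    have "(LINT x|unit_measure. u n x * h x) - (LINT x|unit_measure. g x * h x)
        = (LINT x|unit_measure. (u n x - g x) * h x)" for n
      using L2_space_integrable_mult[OF u[of n] h] L2_space_integrable_mult[OF g h]
      by (simp add: left_diff_distrib)
    then show "\<forall>\<^sub>F n in sequentially. norm ((LINT x|unit_measure. u n x * h x) - (LINT x|unit_measure. g x * h x))
        \<le> L2_norm (\<lambda>x. u n x - g x) * L2_norm h"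
      using L2_Cauchy_Schwarz[OF L2_space_diff[OF u g] h] by simp
  qed
  then show ?thesis by (simp add: LIM_zero_iff)
qed

lemma test_function_L2_approx:
  assumes "continuous_on {0..1} g"
  obtains u where "\<And>n::nat. u n \<in> test_functions" "(\<lambda>n. L2_norm (\<lambda>x. u n x - g x)) \<longlonglongrightarrow> 0"
proof -
  obtain u B where u: "\<And>n::nat. u n \<in> test_functions"
    "\<And>n x. x \<in> {0<..<1} \<Longrightarrow> \<bar>u n x\<bar> \<le> B"
    "\<And>x. x \<in> {0<..<1} \<Longrightarrow> (\<lambda>n. u n x) \<longlonglongrightarrow> g x"
    using test_function_approx[OF assms] by metis
  have "(\<lambda>n. L2_norm (\<lambda>x. u n x - g x)) \<longlonglongrightarrow> 0"
    using u test_function_L2(1) L2_space_continuous[OF assms]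
    by (intro L2_norm_tendsto_0_dominated[where B = B]) (auto intro: L2_space_measurable)
  with u(1) show ?thesis by (rule that)
qed

text \<open>Fundamental lemma of the calculus of variations. Orthogonality passes to continuous
  functions by L^2 approximation, and then to sgn h, an almost everywhere limit of continuous
  functions; so the integral of |h| is 0.\<close>

lemma L2_orthogonal_test_functions:
  assumes h: "h \<in> L2_space" and orth: "\<And>u. u \<in> test_functions \<Longrightarrow> (LINT x|unit_measure. u x * h x) = 0"
  shows "AE x in unit_measure. h x = 0"
proof -
  have cont: "(LINT x|unit_measure. g x * h x) = 0" if g: "continuous_on {0..1} g" for g
  proof -
    obtain u where u: "\<And>n::nat. u n \<in> test_functions" "(\<lambda>n. L2_norm (\<lambda>x. u n x - g x)) \<longlonglongrightarrow> 0"
      using test_function_L2_approx[OF g] by blast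
    have "(\<lambda>n. LINT x|unit_measure. u n x * h x) \<longlonglongrightarrow> (LINT x|unit_measure. g x * h x)"
      using u test_function_L2(1) L2_space_continuous[OF g] by (intro tendsto_L2_inner h) auto
    then show ?thesis
      using u(1) orth LIMSEQ_unique by (simp add: tendsto_const_iff)
  qed
  have hm: "h \<in> borel_measurable unit_measure" by (rule L2_space_measurable[OF h])
  have "(\<lambda>x. sgn (h x)) \<in> borel_measurable unit_measure"
    using hm by measurable
  then have "(\<lambda>x. sgn (h x)) measurable_on {0<..<1}"
    by (simp add: measurable_on_iff_borel_measurable)
  then obtain N G where N: "negligible N" and G: "\<And>n. continuous_on UNIV (G n :: real \<Rightarrow> real)"
    "\<And>x. x \<notin> N \<Longrightarrow> (\<lambda>n. G n x) \<longlonglongrightarrow> (if x \<in> {0<..<1} then sgn (h x) else 0)"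
    unfolding measurable_on_def by blast
  \<comment> \<open>Truncation to [-1, 1] keeps the limit, since sgn h lies there, and makes |h| a
    dominating function.\<close>
  define c where "c = (\<lambda>n x. max (-1) (min 1 (G n x)))"
  have c_cont: "continuous_on S (c n)" for n S
    unfolding c_def using G(1) by (intro continuous_intros) (auto intro: continuous_on_subset)
  have AE_N: "AE x in unit_measure. x \<notin> N"
  proof -
    have "AE x in lebesgue. x \<notin> N"
      using N by (simp add: negligible_iff_null_sets AE_not_in)
    then show ?thesis
      by (subst AE_restrict_space_iff) (auto elim: eventually_mono)
  qed
  have "(\<lambda>n. LINT x|unit_measure. c n x * h x) \<longlonglongrightarrow> (LINT x|unit_measure. \<bar>h x\<bar>)"
  proof (rule integral_dominated_convergence[where w = "\<lambda>x. \<bar>h x\<bar>"])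
    show "(\<lambda>x. c n x * h x) \<in> borel_measurable unit_measure" for n
      using L2_space_measurable[OF L2_space_continuous[OF c_cont]] hm by measurable
    show "AE x in unit_measure. (\<lambda>n. c n x * h x) \<longlonglongrightarrow> \<bar>h x\<bar>"
      using AE_N AE_space
    proof eventually_elim
      case (elim x)
      then have "(\<lambda>n. G n x) \<longlonglongrightarrow> sgn (h x)" using G(2)[of x] by simp
      then have "(\<lambda>n. c n x * h x) \<longlonglongrightarrow> max (-1) (min 1 (sgn (h x))) * h x"
        unfolding c_def by (intro tendsto_intros)
      moreover have "max (-1) (min 1 (sgn (h x))) * h x = \<bar>h x\<bar>"
        by (auto simp: sgn_if)
      ultimately show ?case by simp
    qed
    have "\<bar>c n x\<bar> \<le> 1" for n x by (auto simp: c_def)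
    then show "AE x in unit_measure. norm (c n x * h x) \<le> \<bar>h x\<bar>" for n
      by (simp add: abs_mult mult_left_le_one_le)
  qed (use L2_space_integrable[OF h] hm in auto)
  then have "(LINT x|unit_measure. \<bar>h x\<bar>) = 0"
    using cont[OF c_cont] LIMSEQ_unique by (simp add: tendsto_const_iff)
  then have "AE x in unit_measure. \<bar>h x\<bar> = 0"
    using L2_space_integrable[OF h] by (subst (asm) integral_nonneg_eq_0_iff_AE) auto
  then show ?thesis by simp
qed

text \<open>The weak derivative is carried explicitly, because \<open>weak_deriv\<close> is an
  arbitrary choice that cannot be computed; by uniqueness almost everywhere, any partner
  \<open>g\<close> gives the seminorm.\<close>

definition sobolev_pair :: "(real \<Rightarrow> real) \<Rightarrow> (real \<Rightarrow> real) \<Rightarrow> bool" where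
  "sobolev_pair f g \<longleftrightarrow> f \<in> L2_space \<and> g \<in> L2_space \<and> has_weak_deriv f g"

lemma sobolev_pairD:
  assumes "sobolev_pair f g"
  shows "f \<in> L2_space" "g \<in> L2_space" "has_weak_deriv f g"
  using assms by (auto simp: sobolev_pair_def)

lemma H1_space_iff: "f \<in> H1_space \<longleftrightarrow> (\<exists>g. sobolev_pair f g)"
  by (auto simp: H1_space_def sobolev_pair_def)

lemma sobolev_pair_unique:
  assumes "sobolev_pair f g" "sobolev_pair f g'"
  shows "AE x in unit_measure. g x = g' x"
proof -
  note p = sobolev_pairD[OF assms(1)] sobolev_pairD[OF assms(2)]
  have "AE x in unit_measure. g x - g' x = 0"
  proof (rule L2_orthogonal_test_functions)
    show "(\<lambda>x. g x - g' x) \<in> L2_space" by (intro L2_space_diff p)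
    fix u assume u: "u \<in> test_functions"
    have "(LINT x|unit_measure. g x * u x) = (LINT x|unit_measure. g' x * u x)"
      using p(3,6) u unfolding has_weak_deriv_def by fastforce
    moreover have "(LINT x|unit_measure. u x * (g x - g' x))
        = (LINT x|unit_measure. g x * u x) - (LINT x|unit_measure. g' x * u x)"
      using L2_space_integrable_mult[OF p(2) test_function_L2(1)[OF u]]
        L2_space_integrable_mult[OF p(5) test_function_L2(1)[OF u]]
      by (simp add: right_diff_distrib mult.commute)
    ultimately show "(LINT x|unit_measure. u x * (g x - g' x)) = 0" by simp
  qed
  then show ?thesis by simp
qed

lemma H1_seminorm_eq:
  assumes "sobolev_pair f g"
  shows "H1_seminorm f = L2_norm g"
proof -
  have ex: "g \<in> L2_space \<and> has_weak_deriv f g" using assms by (simp add: sobolev_pair_def)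
  have "weak_deriv f \<in> L2_space \<and> has_weak_deriv f (weak_deriv f)"
    unfolding weak_deriv_def by (rule someI[of "\<lambda>g. g \<in> L2_space \<and> has_weak_deriv f g", OF ex])
  then have w: "sobolev_pair f (weak_deriv f)"
    using assms by (simp add: sobolev_pair_def)
  have "(LINT x|unit_measure. (weak_deriv f x)^2) = (LINT x|unit_measure. (g x)^2)"
  proof (rule integral_cong_AE)
    show "AE x in unit_measure. (weak_deriv f x)^2 = (g x)^2"
      using sobolev_pair_unique[OF w assms] by eventually_elim simp
  qed (use L2_space_measurable[OF sobolev_pairD(2)[OF w]] L2_space_measurable[OF sobolev_pairD(2)[OF assms]] in measurable)
  then show ?thesis by (simp add: H1_seminorm_def L2_norm_def)
qed

lemma H1_norm_eq:
  assumes "sobolev_pair f g"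
  shows "H1_norm f = sqrt ((L2_norm f)^2 + (L2_norm g)^2)"
  by (simp add: H1_norm_def H1_seminorm_eq[OF assms])

lemma H1_norm_nonneg: "0 \<le> H1_norm f"
  by (simp add: H1_norm_def)

lemma sobolev_pair_norm_le:
  assumes "sobolev_pair f g"
  shows "L2_norm f \<le> H1_norm f" "L2_norm g \<le> H1_norm f" "H1_norm f \<le> L2_norm f + L2_norm g"
  unfolding H1_norm_eq[OF assms]
  using L2_norm_nonneg sqrt_sum_squares_le_sum[of "L2_norm f" "L2_norm g"]
  by (auto intro!: real_le_rsqrt)

lemma sobolev_pair_lincomb:
  assumes "sobolev_pair f g" "sobolev_pair f' g'"
  shows "sobolev_pair (\<lambda>x. a * f x + b * f' x) (\<lambda>x. a * g x + b * g' x)"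
proof -
  note p = sobolev_pairD[OF assms(1)] sobolev_pairD[OF assms(2)]
  have "has_weak_deriv (\<lambda>x. a * f x + b * f' x) (\<lambda>x. a * g x + b * g' x)"
    unfolding has_weak_deriv_def
  proof
    fix u assume u: "u \<in> test_functions"
    note L = test_function_L2[OF u]
    have "(LINT x|unit_measure. (a * f x + b * f' x) * deriv u x)
      = (LINT x|unit_measure. a * (f x * deriv u x) + b * (f' x * deriv u x))"
      by (simp add: algebra_simps)
    also have "\<dots> = a * (LINT x|unit_measure. f x * deriv u x) + b * (LINT x|unit_measure. f' x * deriv u x)"
      using L2_space_integrable_mult[OF p(1) L(2)] L2_space_integrable_mult[OF p(4) L(2)] by simp
    also have "\<dots> = - (a * (LINT x|unit_measure. g x * u x) + b * (LINT x|unit_measure. g' x * u x))"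
      using p(3,6) u unfolding has_weak_deriv_def by simp
    also have "\<dots> = - (LINT x|unit_measure. a * (g x * u x) + b * (g' x * u x))"
      using L2_space_integrable_mult[OF p(2) L(1)] L2_space_integrable_mult[OF p(5) L(1)] by simp
    also have "\<dots> = - (LINT x|unit_measure. (a * g x + b * g' x) * u x)"
      by (simp add: algebra_simps)
    finally show "(LINT x|unit_measure. (a * f x + b * f' x) * deriv u x)
        = - (LINT x|unit_measure. (a * g x + b * g' x) * u x)" .
  qed
  then show ?thesis
    using p by (simp add: sobolev_pair_def L2_space_lincomb)
qed

lemma sobolev_pair_diff:
  assumes "sobolev_pair f g" "sobolev_pair f' g'"
  shows "sobolev_pair (\<lambda>x. f x - f' x) (\<lambda>x. g x - g' x)"
  using sobolev_pair_lincomb[OF assms, of 1 "-1"] by simp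

lemma H1_space_lincomb:
  assumes "f \<in> H1_space" "g \<in> H1_space"
  shows "(\<lambda>x. a * f x + b * g x) \<in> H1_space"
  using assms sobolev_pair_lincomb unfolding H1_space_iff by blast

lemma H1_space_diff:
  assumes "f \<in> H1_space" "g \<in> H1_space"
  shows "(\<lambda>x. f x - g x) \<in> H1_space"
  using H1_space_lincomb[OF assms, of 1 "-1"] by simp

lemma H1_norm_triangle:
  assumes "f \<in> H1_space" "g \<in> H1_space"
  shows "H1_norm (\<lambda>x. f x + g x) \<le> H1_norm f + H1_norm g"
proof -
  obtain f' g' where p: "sobolev_pair f f'" "sobolev_pair g g'"
    using assms by (auto simp: H1_space_iff)
  note L = sobolev_pairD[OF p(1)] sobolev_pairD[OF p(2)]
  have "sobolev_pair (\<lambda>x. f x + g x) (\<lambda>x. f' x + g' x)"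
    using sobolev_pair_lincomb[OF p, of 1 1] by simp
  then have "H1_norm (\<lambda>x. f x + g x) = sqrt ((L2_norm (\<lambda>x. f x + g x))^2 + (L2_norm (\<lambda>x. f' x + g' x))^2)"
    by (rule H1_norm_eq)
  also have "\<dots> \<le> sqrt ((L2_norm f + L2_norm g)^2 + (L2_norm f' + L2_norm g')^2)"
    by (intro real_sqrt_le_mono add_mono power_mono L2_norm_triangle L L2_norm_nonneg)
  also have "\<dots> \<le> sqrt ((L2_norm f)^2 + (L2_norm f')^2) + sqrt ((L2_norm g)^2 + (L2_norm g')^2)"
    by (rule real_sqrt_sum_squares_triangle_ineq)
  also have "\<dots> = H1_norm f + H1_norm g"
    by (simp add: H1_norm_eq[OF p(1)] H1_norm_eq[OF p(2)])
  finally show ?thesis .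
qed

lemma H1_norm_cmult:
  assumes "f \<in> H1_space"
  shows "H1_norm (\<lambda>x. a * f x) = \<bar>a\<bar> * H1_norm f"
proof -
  obtain g where p: "sobolev_pair f g" using assms by (auto simp: H1_space_iff)
  have "sobolev_pair (\<lambda>x. a * f x) (\<lambda>x. a * g x)"
    using sobolev_pair_lincomb[OF p p, of a 0] by simp
  then have "H1_norm (\<lambda>x. a * f x) = sqrt (a^2 * ((L2_norm f)^2 + (L2_norm g)^2))"
    by (simp add: H1_norm_eq L2_norm_cmult power_mult_distrib distrib_left)
  then show ?thesis by (simp add: real_sqrt_mult H1_norm_eq[OF p])
qed

lemma H1_norm_minus_commute:
  assumes "f \<in> H1_space" "g \<in> H1_space"
  shows "H1_norm (\<lambda>x. f x - g x) = H1_norm (\<lambda>x. g x - f x)"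
  using H1_norm_cmult[OF H1_space_diff[OF assms], of "-1"] by simp

lemma H1_norm_triangle_diff:
  assumes "f \<in> H1_space" "g \<in> H1_space" "h \<in> H1_space"
  shows "H1_norm (\<lambda>x. f x - h x) \<le> H1_norm (\<lambda>x. f x - g x) + H1_norm (\<lambda>x. g x - h x)"
  using H1_norm_triangle[OF H1_space_diff[OF assms(1,2)] H1_space_diff[OF assms(2,3)]] by simp

text \<open>Weak differentiation is a closed operator: functions and derivatives converge separately
  in L^2, and the defining identity survives because it pairs both with fixed elements of
  L^2.\<close>

lemma H1_complete:
  assumes f: "\<And>n::nat. f n \<in> H1_space"
    and cauchy: "\<And>e. e > 0 \<Longrightarrow> \<exists>N. \<forall>m\<ge>N. \<forall>n\<ge>N. H1_norm (\<lambda>x. f m x - f n x) < e"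
  obtains s where "s \<in> H1_space" "(\<lambda>n. H1_norm (\<lambda>x. s x - f n x)) \<longlonglongrightarrow> 0"
proof -
  obtain g where g: "\<And>n. sobolev_pair (f n) (g n)"
    using f unfolding H1_space_iff by metis
  have le: "L2_norm (\<lambda>x. f m x - f n x) \<le> H1_norm (\<lambda>x. f m x - f n x)"
    "L2_norm (\<lambda>x. g m x - g n x) \<le> H1_norm (\<lambda>x. f m x - f n x)" for m n
    using sobolev_pair_norm_le[OF sobolev_pair_diff[OF g g]] by auto
  obtain s where s: "s \<in> L2_space" "(\<lambda>n. L2_norm (\<lambda>x. s x - f n x)) \<longlonglongrightarrow> 0"
  proof (rule L2_complete[of f])
    show "f n \<in> L2_space" for n using g sobolev_pairD by blast
    show "\<exists>N. \<forall>m\<ge>N. \<forall>n\<ge>N. L2_norm (\<lambda>x. f m x - f n x) < e" if "e > 0" for e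
      using cauchy[OF that] le(1) by (meson le_less_trans)
  qed
  obtain t where t: "t \<in> L2_space" "(\<lambda>n. L2_norm (\<lambda>x. t x - g n x)) \<longlonglongrightarrow> 0"
  proof (rule L2_complete[of g])
    show "g n \<in> L2_space" for n using g sobolev_pairD by blast
    show "\<exists>N. \<forall>m\<ge>N. \<forall>n\<ge>N. L2_norm (\<lambda>x. g m x - g n x) < e" if "e > 0" for e
      using cauchy[OF that] le(2) by (meson le_less_trans)
  qed
  have "has_weak_deriv s t"
    unfolding has_weak_deriv_def
  proof
    fix u assume u: "u \<in> test_functions"
    have A: "(\<lambda>n. LINT x|unit_measure. f n x * deriv u x) \<longlonglongrightarrow> (LINT x|unit_measure. s x * deriv u x)"
      using s sobolev_pairD(1)[OF g] test_function_L2[OF u]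
      by (intro tendsto_L2_inner) (auto simp: L2_norm_minus_commute[of _ s])
    have B: "(\<lambda>n. LINT x|unit_measure. g n x * u x) \<longlonglongrightarrow> (LINT x|unit_measure. t x * u x)"
      using t sobolev_pairD(2)[OF g] test_function_L2[OF u]
      by (intro tendsto_L2_inner) (auto simp: L2_norm_minus_commute[of _ t])
    have "(LINT x|unit_measure. f n x * deriv u x) = - (LINT x|unit_measure. g n x * u x)" for n
      using sobolev_pairD(3)[OF g[of n]] u unfolding has_weak_deriv_def by blast
    with A have "(\<lambda>n. - (LINT x|unit_measure. g n x * u x)) \<longlonglongrightarrow> (LINT x|unit_measure. s x * deriv u x)"
      by simp
    then show "(LINT x|unit_measure. s x * deriv u x) = - (LINT x|unit_measure. t x * u x)"
      by (rule LIMSEQ_unique) (rule tendsto_minus[OF B])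
  qed
  with s t have st: "sobolev_pair s t" by (simp add: sobolev_pair_def)
  have "(\<lambda>n. H1_norm (\<lambda>x. s x - f n x)) \<longlonglongrightarrow> 0"
  proof (rule Lim_null_comparison)
    show "(\<lambda>n. L2_norm (\<lambda>x. s x - f n x) + L2_norm (\<lambda>x. t x - g n x)) \<longlonglongrightarrow> 0"
      using tendsto_add[OF s(2) t(2)] by simp
    show "\<forall>\<^sub>F n in sequentially. norm (H1_norm (\<lambda>x. s x - f n x))
        \<le> L2_norm (\<lambda>x. s x - f n x) + L2_norm (\<lambda>x. t x - g n x)"
      using sobolev_pair_norm_le(3)[OF sobolev_pair_diff[OF st g]] by (simp add: H1_norm_nonneg)
  qed
  with st show ?thesis using that H1_space_iff by blast
qed

section \<open>Primitives of continuous functions\<close>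

text \<open>The condition \<open>F 1 = 0\<close> says that \<open>g\<close> has mean zero.\<close>
definition primitive01 :: "(real \<Rightarrow> real) \<Rightarrow> (real \<Rightarrow> real) \<Rightarrow> bool" where
  "primitive01 F g \<longleftrightarrow> continuous_on {0..1} g \<and>
     (\<forall>x\<in>{0..1}. (g has_integral F x) {0..x}) \<and> F 1 = 0"

text \<open>Only \<open>G\<close> must be differentiable on the whole line. Boundary scaling
  functions and wavelets have a kink at an endpoint of the unit interval, so \<open>G\<close> is a
  differentiable continuation that agrees with them inside.\<close>

lemma primitive01I_DERIV:
  assumes "\<And>x. x \<in> {0..1} \<Longrightarrow> F x = G x"
    and "\<And>x. (G has_real_derivative g x) (at x)" "G 0 = 0" "G 1 = 0" "continuous_on {0..1} g"
  shows "primitive01 F g"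
  unfolding primitive01_def
proof (intro conjI ballI)
  fix x :: real assume x: "x \<in> {0..1}"
  have "(g has_integral G x - G 0) {0..x}"
    using x assms(2)
    by (intro fundamental_theorem_of_calculus)
      (auto simp: has_real_derivative_iff_has_vector_derivative intro: has_vector_derivative_at_within)
  then show "(g has_integral F x) {0..x}" using assms(1,3) x by simp
qed (use assms in auto)

lemma primitive01_lincomb:
  assumes "primitive01 F g" "primitive01 F' g'"
  shows "primitive01 (\<lambda>x. a * F x + b * F' x) (\<lambda>x. a * g x + b * g' x)"
  using assms unfolding primitive01_def
  by (auto intro!: continuous_intros has_integral_add has_integral_mult_right)

lemma primitive01_cmult:
  assumes "primitive01 F g"
  shows "primitive01 (\<lambda>x. a * F x) (\<lambda>x. a * g x)"
  using primitive01_lincomb[OF assms assms, of a 0] by simp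

lemma primitive01_diff:
  assumes "primitive01 F g" "primitive01 F' g'"
  shows "primitive01 (\<lambda>x. F x - F' x) (\<lambda>x. g x - g' x)"
  using primitive01_lincomb[OF assms, of 1 "-1"] by simp

lemma primitive01_zero: "primitive01 (\<lambda>_. 0) (\<lambda>_. 0)"
  by (simp add: primitive01_def)

lemma primitive01_sum:
  assumes "finite A" "\<And>i. i \<in> A \<Longrightarrow> primitive01 (F i) (g i)"
  shows "primitive01 (\<lambda>x. \<Sum>i\<in>A. F i x) (\<lambda>x. \<Sum>i\<in>A. g i x)"
  using assms
proof (induction A)
  case empty
  then show ?case by (simp add: primitive01_zero)
next
  case (insert i A)
  then have "primitive01 (F i) (g i)" "primitive01 (\<lambda>x. \<Sum>i\<in>A. F i x) (\<lambda>x. \<Sum>i\<in>A. g i x)" by auto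
  from primitive01_lincomb[OF this, of 1 1] show ?case using insert.hyps by simp
qed

lemma primitive01_cong:
  assumes "primitive01 F g" "\<And>x. x \<in> {0..1} \<Longrightarrow> h x = g x"
  shows "primitive01 F h"
  unfolding primitive01_def
proof (intro conjI ballI)
  show "continuous_on {0..1} h"
    using assms continuous_on_cong unfolding primitive01_def by metis
  fix x :: real assume x: "x \<in> {0..1}"
  then have "(g has_integral F x) {0..x}" using assms(1) by (simp add: primitive01_def)
  then show "(h has_integral F x) {0..x}"
    by (rule has_integral_eq[rotated]) (use x assms(2) in auto)
qed (use assms in \<open>auto simp: primitive01_def\<close>)

lemma primitive01_zero_endpoints:
  assumes "primitive01 F g"
  shows "F 0 = 0" "F 1 = 0"
proof -
  have "\<forall>x\<in>{0..1}. (g has_integral F x) {0..x}"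
    using assms unfolding primitive01_def by blast
  from bspec[OF this, of 0] have "integral {0..0} g = F 0"
    by (intro integral_unique) simp
  then show "F 0 = 0" by simp
  show "F 1 = 0" using assms by (simp add: primitive01_def)
qed

lemma primitive01_derivative:
  assumes "primitive01 F g" "x \<in> {0..1}"
  shows "(F has_vector_derivative g x) (at x within {0..1})"
proof -
  have "((\<lambda>x. integral {0..x} g) has_vector_derivative g x) (at x within {0..1})"
    using assms by (intro integral_has_vector_derivative) (auto simp: primitive01_def)
  moreover have "integral {0..y} g = F y" if "y \<in> {0..1}" for y
    using assms(1) that by (intro integral_unique) (simp add: primitive01_def)
  ultimately show ?thesis
    using assms(2) by (rule_tac has_vector_derivative_transform) auto
qed

lemma primitive01_continuous:
  assumes "primitive01 F g"
  shows "continuous_on {0..1} F"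
  using primitive01_derivative[OF assms]
  by (meson continuous_on_eq_continuous_within has_vector_derivative_continuous)

lemma primitive01_L2:
  assumes "primitive01 F g"
  shows "F \<in> L2_space" "g \<in> L2_space"
  using assms primitive01_continuous by (auto intro!: L2_space_continuous simp: primitive01_def)

text \<open>Integration by parts: F u has the derivative F u' + g u and vanishes at both
  endpoints.\<close>

lemma primitive01_sobolev_pair:
  assumes "primitive01 F g"
  shows "sobolev_pair F g"
proof -
  note L = primitive01_L2[OF assms]
  have "has_weak_deriv F g"
    unfolding has_weak_deriv_def
  proof
    fix u assume u: "u \<in> test_functions"
    note Lu = test_function_L2[OF u]
    have sm: "smooth u" using u by (simp add: test_functions_iff)
    have "((\<lambda>x. F x * u x) has_vector_derivative (F x * deriv u x + g x * u x)) (at x within {0..1})"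
      if "x \<in> {0..1}" for x
      using has_vector_derivative_mult[OF primitive01_derivative[OF assms that], of u "deriv u x"]
        smooth_DERIV[OF sm, of x]
      by (simp add: has_real_derivative_iff_has_vector_derivative has_vector_derivative_at_within)
    then have "((\<lambda>x. F x * deriv u x + g x * u x) has_integral F 1 * u 1 - F 0 * u 0) {0..1}"
      by (intro fundamental_theorem_of_calculus) auto
    then have "((\<lambda>x. F x * deriv u x + g x * u x) has_integral 0) {0..1}"
      using primitive01_zero_endpoints[OF assms] by simp
    then have "(LINT x|unit_measure. F x * deriv u x + g x * u x) = 0"
      using L2_space_integrable_mult[OF L(1) Lu(2)] L2_space_integrable_mult[OF L(2) Lu(1)]
      by (intro LINT_unit_eqI) auto
    then show "(LINT x|unit_measure. F x * deriv u x) = - (LINT x|unit_measure. g x * u x)"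
      using L2_space_integrable_mult[OF L(1) Lu(2)] L2_space_integrable_mult[OF L(2) Lu(1)] by simp
  qed
  with L show ?thesis by (simp add: sobolev_pair_def)
qed

lemma primitive01_H1_space: "primitive01 F g \<Longrightarrow> F \<in> H1_space"
  using primitive01_sobolev_pair H1_space_iff by blast

lemma primitive01_abs_le:
  assumes "primitive01 F g" "x \<in> {0..1}"
  shows "\<bar>F x\<bar> \<le> L2_norm g"
proof -
  have cont: "continuous_on {0..1} g" using assms(1) by (simp add: primitive01_def)
  then have int: "(\<lambda>x. \<bar>g x\<bar>) integrable_on {0..y}" if "y \<in> {0..1}" for y
    using that by (intro integrable_continuous_interval continuous_intros)
      (auto intro: continuous_on_subset)
  have gint: "(g has_integral F x) {0..x}" using assms by (simp add: primitive01_def)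
  have "norm (integral {0..x} g) \<le> integral {0..x} (\<lambda>x. \<bar>g x\<bar>)"
    using gint int[OF assms(2)] by (intro integral_norm_bound_integral) auto
  then have "\<bar>F x\<bar> \<le> integral {0..x} (\<lambda>x. \<bar>g x\<bar>)"
    using integral_unique[OF gint] by simp
  also have "\<dots> \<le> integral {0..1} (\<lambda>x. \<bar>g x\<bar>)"
    using int[OF assms(2)] int[of 1] assms(2) by (intro integral_subset_le) auto
  also have "\<dots> = (LINT x|unit_measure. \<bar>g x\<bar>)"
    using L2_space_integrable[OF primitive01_L2(2)[OF assms(1)]] int[of 1]
    by (intro LINT_unit_eqI[symmetric]) (auto intro: integrable_integral)
  also have "\<dots> \<le> L2_norm g"
    by (rule L2_norm_integral_abs_le[OF primitive01_L2(2)[OF assms(1)]])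
  finally show ?thesis .
qed

text \<open>Poincare inequality with constant 1: |F| is at most the integral of |g|, hence at most
  the L^2 norm of \<open>g\<close>. Full norm and seminorm are therefore interchangeable up to the
  factor 2.\<close>

lemma primitive01_norm:
  assumes "primitive01 F g"
  shows "L2_norm g \<le> H1_norm F" "H1_norm F \<le> 2 * L2_norm g" "H1_seminorm F = L2_norm g"
proof -
  note p = primitive01_sobolev_pair[OF assms]
  show "L2_norm g \<le> H1_norm F" "H1_seminorm F = L2_norm g"
    using sobolev_pair_norm_le(2)[OF p] H1_seminorm_eq[OF p] by auto
  have "L2_norm F \<le> L2_norm g"
    using primitive01_abs_le[OF assms] L2_norm_nonneg
    by (intro L2_norm_le_bound L2_space_measurable primitive01_L2[OF assms]) auto
  then show "H1_norm F \<le> 2 * L2_norm g"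
    using sobolev_pair_norm_le(3)[OF p] by simp
qed

section \<open>Primitives of continuous functions as limits of test functions\<close>

lemma test_function_primitive01:
  assumes "u \<in> test_functions"
  shows "primitive01 u (deriv u)"
proof (rule primitive01I_DERIV)
  have sm: "smooth u" using assms by (simp add: test_functions_iff)
  show "(u has_real_derivative deriv u x) (at x)" for x by (rule smooth_DERIV[OF sm])
  show "continuous_on {0..1} (deriv u)" by (rule smooth_continuous_on[OF smooth_deriv[OF sm]])
  obtain K where "K \<subseteq> {0<..<1}" "\<And>x. x \<notin> K \<Longrightarrow> u x = 0"
    using assms by (auto simp: test_functions_iff)
  then show "u 0 = 0" "u 1 = 0" by force+
qed simp

text \<open>To the left of the support the antiderivative is 0 by construction; to the right it
  equals the total integral, which is 0 by \<open>mean\<close>.\<close>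

lemma test_function_antideriv:
  assumes v: "v \<in> test_functions" and mean: "(LINT x|unit_measure. v x) = 0"
  obtains u where "u \<in> test_functions" "primitive01 u v"
proof -
  obtain a b where ab: "0 < a" "a \<le> b" "b < 1" "\<And>x. x \<notin> {a..b} \<Longrightarrow> v x = 0"
    using test_function_support[OF v] by blast
  have sm: "smooth v" using v by (simp add: test_functions_iff)
  have cont: "continuous_on S v" for S by (rule smooth_continuous_on[OF sm])
  \<comment> \<open>The case split keeps \<open>u\<close> locally constant to the left of
    \<open>a\<close>, negative arguments included, so the integral has to be differentiated only at
    points that are positive.\<close>
  define u where "u = (\<lambda>x. if x \<le> a then 0 else integral {0..x} v)"
  have int0: "integral {x..y} v = 0" if "y \<le> a \<or> b \<le> x" for x y
  proof -
    have "((\<lambda>_. 0) has_integral 0) {x..y}" by simp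
    then have "(v has_integral 0) {x..y}"
    \<comment> \<open>\<open>v\<close> vanishes on the interval except perhaps at \<open>a\<close>
      or \<open>b\<close>, where the support property says nothing; these two points are a null
      set.\<close>
    proof (rule has_integral_spike[where S = "{a, b}", rotated 2])
      show "v z = 0" if "z \<in> {x..y} - {a, b}" for z
        using ab(4)[of z] \<open>y \<le> a \<or> b \<le> x\<close> that by auto
    qed auto
    then show ?thesis by (rule integral_unique)
  qed
  have u_eq: "u x = integral {0..x} v" for x
    using int0[of x 0] by (simp add: u_def)
  have total: "integral {0..1} v = 0"
  proof -
    have "(v has_integral integral {0..1} v) {0..1}"
      using integrable_continuous_interval[OF cont] by (rule integrable_integral)
    then show ?thesis
      using LINT_unit_eqI[OF L2_space_integrable[OF test_function_L2(1)[OF v]]] mean by simp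
  qed
  have u_right: "u x = 0" if "b \<le> x" for x
  proof -
    have *: "integral {0..b} v + integral {b..y} v = integral {0..y} v" if "b \<le> y" for y
      using ab that by (intro Henstock_Kurzweil_Integration.integral_combine integrable_continuous_interval cont) auto
    show ?thesis using *[OF that] *[of 1] int0[where x = b] total ab u_eq by simp
  qed
  have deriv: "(u has_real_derivative v x) (at x)" for x
  proof (cases "x < a")
    case True
    have "((\<lambda>_. 0) has_real_derivative v x) (at x)"
      using ab(4)[of x] True by simp
    then show ?thesis
    proof (rule has_field_derivative_transform_within_open)
      show "open {..<a}" "x \<in> {..<a}" using True by auto
    qed (auto simp: u_def)
  next
    case False
    have "((\<lambda>x. integral {0..x} v) has_real_derivative v x) (at x within {0..x + 1})"
      using False ab cont by (intro integral_has_real_derivative) auto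
    moreover have "at x within {0..x + 1} = at x"
      using False ab by (intro at_within_Icc_at) auto
    moreover have "u = (\<lambda>x. integral {0..x} v)" using u_eq by (intro ext)
    ultimately show ?thesis by simp
  qed
  have "u \<in> test_functions"
    unfolding test_functions_iff
  proof
    show "smooth u" by (rule smooth_antideriv[OF sm deriv])
    show "\<exists>K. compact K \<and> K \<subseteq> {0<..<1} \<and> (\<forall>x. x \<notin> K \<longrightarrow> u x = 0)"
    proof (intro exI[of _ "{a..b}"] conjI allI impI)
      show "u x = 0" if "x \<notin> {a..b}" for x
      proof (cases "x < a")
        case True
        then show ?thesis by (simp add: u_def)
      next
        case False
        then show ?thesis using that by (intro u_right) simp
      qed
    qed (use ab in auto)
  qed
  moreover have "primitive01 u v"
  proof (rule primitive01I_DERIV[OF _ deriv])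
    show "u 0 = 0" using ab by (simp add: u_def)
    show "u 1 = 0" using ab by (intro u_right) simp
  qed (auto intro: cont)
  ultimately show ?thesis by (rule that)
qed

text \<open>Test functions tending to the constant 1 in L^2 have integrals tending to 1, so one of
  them has positive integral and can be rescaled.\<close>

lemma test_function_unit_mass:
  obtains \<eta> where "\<eta> \<in> test_functions" "(LINT x|unit_measure. \<eta> x) = 1"
proof -
  obtain u where u: "\<And>n::nat. u n \<in> test_functions" "(\<lambda>n. L2_norm (\<lambda>x. u n x - 1)) \<longlonglongrightarrow> 0"
    using test_function_L2_approx[of "\<lambda>_. 1"] by auto
  have "(\<lambda>n. LINT x|unit_measure. u n x * 1) \<longlonglongrightarrow> (LINT x|unit_measure. 1 * (1::real))"
    using u test_function_L2(1) by (intro tendsto_L2_inner L2_space_one) auto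
  then have "(\<lambda>n. LINT x|unit_measure. u n x) \<longlonglongrightarrow> 1"
    by (simp add: measure_unit)
  then have "\<forall>\<^sub>F n in sequentially. (LINT x|unit_measure. u n x) > 0"
    by (rule order_tendstoD) simp
  then obtain n where n: "(LINT x|unit_measure. u n x) > 0"
    using eventually_happens trivial_limit_sequentially by blast
  define m where "m = (LINT x|unit_measure. u n x)"
  have "(LINT x|unit_measure. (1/m) * u n x) = 1"
    using n L2_space_integrable[OF test_function_L2(1)[OF u(1)]] by (simp add: m_def)
  then show ?thesis
    using test_functions_cmult[OF u(1)[of n], of "1/m"] that by blast
qed

lemma primitive01_mean:
  assumes "primitive01 F g"
  shows "(LINT x|unit_measure. g x) = 0"
proof (rule LINT_unit_eqI)
  show "integrable unit_measure g"
    by (rule L2_space_integrable[OF primitive01_L2(2)[OF assms]])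
  show "(g has_integral 0) {0..1}"
    using assms by (auto simp: primitive01_def dest!: bspec[of _ _ 1])
qed

lemma test_functions_H1_space: "test_functions \<subseteq> H1_space"
  using test_function_primitive01 primitive01_H1_space by blast

lemma H01_space_subset: "H01_space \<subseteq> H1_space"
  by (auto simp: H01_space_def closure_in_def)

text \<open>L^2 approximation of \<open>g\<close> by test functions is not enough, as only those of
  mean zero have compactly supported antiderivatives. Their means tend to that of \<open>g\<close>,
  which is 0, so subtracting the means times a fixed bump of unit mass is harmless in the
  limit.\<close>

lemma primitive01_H01_space:
  assumes F: "primitive01 F g"
  shows "F \<in> H01_space"
proof -
  have g: "continuous_on {0..1} g" "g \<in> L2_space"
    using F primitive01_L2 by (auto simp: primitive01_def)
  obtain w where w: "\<And>n::nat. w n \<in> test_functions" "(\<lambda>n. L2_norm (\<lambda>x. w n x - g x)) \<longlonglongrightarrow> 0"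
    using test_function_L2_approx[OF g(1)] by blast
  obtain \<eta> where \<eta>: "\<eta> \<in> test_functions" "(LINT x|unit_measure. \<eta> x) = 1"
    by (rule test_function_unit_mass)
  define m where "m = (\<lambda>n. LINT x|unit_measure. w n x)"
  define v where "v = (\<lambda>n x. w n x - m n * \<eta> x)"
  have v: "v n \<in> test_functions" for n
    using test_functions_lincomb[OF w(1) \<eta>(1), of 1 n "- m n"] by (simp add: v_def)
  have mean: "(LINT x|unit_measure. v n x) = 0" for n
    using L2_space_integrable[OF test_function_L2(1)] w(1) \<eta>
    by (simp add: v_def m_def)
  have "\<exists>u. u \<in> test_functions \<and> primitive01 u (v n)" for n
    using test_function_antideriv[OF v[of n] mean[of n]] by blast
  then obtain u where u: "\<And>n. u n \<in> test_functions" "\<And>n. primitive01 (u n) (v n)"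
    by metis
  have "(\<lambda>n. LINT x|unit_measure. w n x * 1) \<longlonglongrightarrow> (LINT x|unit_measure. g x * 1)"
    using w test_function_L2(1) g by (intro tendsto_L2_inner L2_space_one) auto
  then have m0: "m \<longlonglongrightarrow> 0"
    using primitive01_mean[OF F] by (simp add: m_def)
  have le: "H1_norm (\<lambda>x. F x - u n x) \<le> 2 * (L2_norm (\<lambda>x. w n x - g x) + \<bar>m n\<bar> * L2_norm \<eta>)" for n
  proof -
    have "H1_norm (\<lambda>x. F x - u n x) \<le> 2 * L2_norm (\<lambda>x. g x - v n x)"
      by (rule primitive01_norm(2)[OF primitive01_diff[OF F u(2)]])
    also have "L2_norm (\<lambda>x. g x - v n x) = L2_norm (\<lambda>x. (g x - w n x) + m n * \<eta> x)"
      by (simp add: v_def algebra_simps)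
    also have "\<dots> \<le> L2_norm (\<lambda>x. g x - w n x) + L2_norm (\<lambda>x. m n * \<eta> x)"
      using g(2) test_function_L2(1)[OF w(1)] test_function_L2(1)[OF \<eta>(1)]
      by (intro L2_norm_triangle L2_space_diff L2_space_cmult)
    finally show ?thesis by (simp add: L2_norm_cmult L2_norm_minus_commute[of g])
  qed
  have "(\<lambda>n. 2 * (L2_norm (\<lambda>x. w n x - g x) + \<bar>m n\<bar> * L2_norm \<eta>)) \<longlonglongrightarrow> 2 * (0 + \<bar>0\<bar> * L2_norm \<eta>)"
    by (intro tendsto_intros w m0)
  then have lim: "(\<lambda>n. 2 * (L2_norm (\<lambda>x. w n x - g x) + \<bar>m n\<bar> * L2_norm \<eta>)) \<longlonglongrightarrow> 0" by simp
  have "\<exists>v\<in>test_functions. H1_norm (\<lambda>x. F x - v x) < e" if "e > 0" for e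
  proof -
    have "\<forall>\<^sub>F n in sequentially. 2 * (L2_norm (\<lambda>x. w n x - g x) + \<bar>m n\<bar> * L2_norm \<eta>) < e"
      using order_tendstoD(2)[OF lim that] .
    then obtain n where "2 * (L2_norm (\<lambda>x. w n x - g x) + \<bar>m n\<bar> * L2_norm \<eta>) < e"
      using eventually_happens trivial_limit_sequentially by blast
    then show ?thesis using le[of n] u(1)[of n] by (intro bexI[of _ "u n"]) auto
  qed
  then show ?thesis
    using primitive01_H1_space[OF F] by (simp add: H01_space_def closure_in_def)
qed

lemma H01_space_closed:
  assumes "s \<in> H1_space" "\<And>e. e > 0 \<Longrightarrow> \<exists>v\<in>H01_space. H1_norm (\<lambda>x. s x - v x) < e"
  shows "s \<in> H01_space"
proof -
  have "\<exists>t\<in>test_functions. H1_norm (\<lambda>x. s x - t x) < e" if "e > 0" for e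
  proof -
    have e2: "e / 2 > 0" using that by simp
    obtain v where v: "v \<in> H01_space" "H1_norm (\<lambda>x. s x - v x) < e / 2"
      using assms(2)[OF e2] by blast
    with e2 obtain t where t: "t \<in> test_functions" "H1_norm (\<lambda>x. v x - t x) < e / 2"
      unfolding H01_space_def closure_in_def by blast
    have "H1_norm (\<lambda>x. s x - t x) \<le> H1_norm (\<lambda>x. s x - v x) + H1_norm (\<lambda>x. v x - t x)"
      using assms(1) v(1) t(1) H01_space_subset test_functions_H1_space
      by (intro H1_norm_triangle_diff) auto
    then show ?thesis using v(2) t by (intro bexI[of _ t]) auto
  qed
  with assms(1) show ?thesis by (simp add: H01_space_def closure_in_def)
qed

section \<open>The two-scale relation\<close>

text \<open>
  Nodal values on \<open>2 * M\<close> cells of \<open>v + w\<close>, where \<open>v\<close> has nodal values \<open>c\<close> on \<open>M\<close> cells and \<open>w\<close>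
  is the combination of wavelet derivatives with coefficients \<open>d\<close>; \<open>d i\<close> belongs to \<open>k = i + 1\<close>.
  Up to scaling, the derivative of \<open>psi\<close> has nodal values \<open>(-1, 2, -1)\<close> around the midpoint of its
  cell, that of \<open>psi_b\<close> has \<open>(-3, 5/2, -1)\<close>.
\<close>
definition two_scale :: "nat \<Rightarrow> (nat \<Rightarrow> real) \<Rightarrow> (nat \<Rightarrow> real) \<Rightarrow> nat \<Rightarrow> real" where
  "two_scale M c d m = (let i = m div 2 in
     if even m then
       c i - (if i = 0 then 0 else (if i = M then 3 else 1) * d (i - 1))
           - (if i = M then 0 else (if i = 0 then 3 else 1) * d i)
     else (c i + c (Suc i)) / 2 + (if i = 0 \<or> Suc i = M then 5/2 else 2) * d i)"

lemma two_scale_even: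
  "two_scale M c d (2 * i) =
     c i - (if i = 0 then 0 else (if i = M then 3 else 1) * d (i - 1))
         - (if i = M then 0 else (if i = 0 then 3 else 1) * d i)"
  by (simp add: two_scale_def)

lemma two_scale_odd:
  "two_scale M c d (Suc (2 * i)) = (c i + c (Suc i)) / 2 + (if i = 0 \<or> Suc i = M then 5/2 else 2) * d i"
  by (simp add: two_scale_def Let_def)

lemma two_scale_add:
  "two_scale M c (\<lambda>_. 0) m + two_scale M (\<lambda>_. 0) d m = two_scale M c d m"
  by (simp add: two_scale_def Let_def)

text \<open>Up to the node 2 M only the coefficients d 0, ..., d (M - 1) enter, so the wavelet part
  is a sum of columns, one per wavelet.\<close>

lemma two_scale_sum_delta:
  "(\<Sum>i<M. d i * two_scale M (\<lambda>_. 0) (\<lambda>j. if j = i then 1 else 0) m) = two_scale M (\<lambda>_. 0) d m"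
  if "m \<le> 2 * M" "M \<ge> 1"
proof (cases "even m")
  case True
  then obtain k where k: "m = 2 * k" by blast
  have "(\<Sum>i<M. d i * two_scale M (\<lambda>_. 0) (\<lambda>j. if j = i then 1 else 0) m)
    = (\<Sum>i<M. - (if k = 0 then 0 else (if k = M then 3 else 1) * (if k - 1 = i then d i else 0)))
    + (\<Sum>i<M. - (if k = M then 0 else (if k = 0 then 3 else 1) * (if k = i then d i else 0)))"
    unfolding k two_scale_even sum.distrib[symmetric] by (intro sum.cong) auto
  also have "\<dots> = two_scale M (\<lambda>_. 0) d m"
    using that unfolding k two_scale_even by (auto simp: sum_negf sum_distrib_left[symmetric])
  finally show ?thesis .
next
  case False
  then obtain k where k: "m = Suc (2 * k)" by (auto elim: oddE)
  have "(\<Sum>i<M. d i * two_scale M (\<lambda>_. 0) (\<lambda>j. if j = i then 1 else 0) m)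
    = (\<Sum>i<M. (if k = 0 \<or> Suc k = M then 5/2 else 2) * (if k = i then d i else 0))"
    unfolding k two_scale_odd by (intro sum.cong) auto
  also have "\<dots> = two_scale M (\<lambda>_. 0) d m"
    using that unfolding k two_scale_odd by (simp add: sum_distrib_left[symmetric])
  finally show ?thesis .
qed

text \<open>No cell width is built in; integrals arise after division by the number of cells. This
  is why the coarse side carries a factor 2 whenever M and 2 M cells are compared.\<close>

definition cell_sum :: "(real \<Rightarrow> real \<Rightarrow> real) \<Rightarrow> nat \<Rightarrow> (nat \<Rightarrow> real) \<Rightarrow> real" where
  "cell_sum q M c = (\<Sum>i<M. q (c i) (c (Suc i)))"

lemma sum_lessThan_double:
  "(\<Sum>m<2 * M. f m) = (\<Sum>i<M. f (2 * i) + f (Suc (2 * i)))" for f :: "nat \<Rightarrow> real"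
  by (induction M) auto

text \<open>\<open>G n\<close> is a flux through the node between the cells n - 1 and n. The first
  and the last cell have only one such node, and M \<ge> 2 keeps them apart.\<close>

lemma sum_nonneg_telescope:
  fixes T G :: "nat \<Rightarrow> real"
  assumes "2 \<le> M" "0 \<le> T 0 + G 1"
    and step: "\<And>n. 1 \<le> n \<Longrightarrow> Suc n < M \<Longrightarrow> 0 \<le> T n + G (Suc n) - G n"
    and last: "0 \<le> T (M - 1) - G (M - 1)"
  shows "0 \<le> (\<Sum>i<M. T i)"
proof -
  have "- G (Suc n) \<le> (\<Sum>i<Suc n. T i)" if "Suc n < M" for n
    using that
  proof (induction n)
    case 0
    then show ?case using assms(2) by simp
  next
    case (Suc n)
    then have "- G (Suc n) \<le> (\<Sum>i<Suc n. T i)" by simp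
    then show ?case using step[of "Suc n"] Suc.prems by simp
  qed
  from this[of "M - 2"] have "- G (M - 1) \<le> (\<Sum>i<M - 1. T i)"
    using assms(1) by (simp add: Suc_diff_Suc numeral_2_eq_2)
  moreover have "(\<Sum>i<M. T i) = (\<Sum>i<M - 1. T i) + T (M - 1)"
    using assms(1) by (metis One_nat_def Suc_pred lessThan_Suc_atMost less_le_trans pos2 sum.lessThan_Suc)
  ultimately show ?thesis using last by simp
qed

text \<open>
  The \<open>L^2\<close> norm itself is not monotone along the multiscale decomposition, since wavelets are not
  orthogonal to coarser functions. In terms of \<open>y = (sin (xi / 2))^2\<close> its Fourier multiplier is
  \<open>1 - 2 y / 3\<close>; a multiplier \<open>1 - a y\<close> can gain a fixed multiple of \<open>|d|^2\<close> only for
  \<open>2/3 < a < 1\<close>, and \<open>lower_form\<close> is the choice \<open>a = 4/5\<close>, for which it does.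
\<close>
definition lower_form :: "real \<Rightarrow> real \<Rightarrow> real" where
  "lower_form x y = (3 * x^2 + 4 * x * y + 3 * y^2) / 10"

definition upper_form :: "real \<Rightarrow> real \<Rightarrow> real" where
  "upper_form x y = (x^2 + y^2) / 2"

text \<open>The exact integral of the square of the linear interpolant over a cell of unit
  length.\<close>

definition mass_form :: "real \<Rightarrow> real \<Rightarrow> real" where
  "mass_form x y = (x^2 + x * y + y^2) / 3"

text \<open>The three forms agree for x = y and differ by positive multiples of (x - y)^2
  only.\<close>

lemma mass_form_bounds: "lower_form x y \<le> mass_form x y" "mass_form x y \<le> upper_form x y"
proof -
  have "mass_form x y - lower_form x y = (x - y)^2 / 30"
    by (simp add: mass_form_def lower_form_def power2_eq_square field_simps)
  moreover have "0 \<le> (x - y)^2 / 30" by simp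
  ultimately show "lower_form x y \<le> mass_form x y" by linarith
  have "upper_form x y - mass_form x y = (x - y)^2 / 6"
    by (simp add: mass_form_def upper_form_def power2_eq_square field_simps)
  moreover have "0 \<le> (x - y)^2 / 6" by simp
  ultimately show "mass_form x y \<le> upper_form x y" by linarith
qed

lemma cell_sum_mass_bounds:
  "cell_sum lower_form M c \<le> cell_sum mass_form M c"
  "cell_sum mass_form M c \<le> cell_sum upper_form M c"
  unfolding cell_sum_def by (intro sum_mono mass_form_bounds)+

text \<open>
  \<open>G\<close> is the telescoping term. Its antisymmetry makes the right boundary cell a mirror image of the left one.
\<close>
lemma cell_sum_two_scale:
  assumes "2 \<le> M" and q_sym: "\<And>x y. q x y = q y x"
    and bdy: "\<And>c0 c1 d1 d2. 0 \<le> q (c0 - 3 * d1) ((c0 + c1) / 2 + 5 / 2 * d1)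
         + q ((c0 + c1) / 2 + 5 / 2 * d1) (c1 - d1 - d2)
         - 2 * p c0 c1 - e * d1^2 + G c1 d1 d2"
    and int: "\<And>c0 c1 d0 d1 d2. 0 \<le> q (c0 - d0 - d1) ((c0 + c1) / 2 + 2 * d1)
         + q ((c0 + c1) / 2 + 2 * d1) (c1 - d1 - d2)
         - 2 * p c0 c1 - e * d1^2 + G c1 d1 d2 - G c0 d0 d1"
    and p_sym: "\<And>x y. p x y = p y x" and G_anti: "\<And>c d d'. G c d' d = - G c d d'"
  shows "2 * cell_sum p M c + e * (\<Sum>i<M. (d i)^2) \<le> cell_sum q (2 * M) (two_scale M c d)"
proof -
  let ?v = "two_scale M c d"
  define T where "T = (\<lambda>i. q (?v (2 * i)) (?v (Suc (2 * i))) + q (?v (Suc (2 * i))) (?v (2 * Suc i))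
     - 2 * p (c i) (c (Suc i)) - e * (d i)^2)"
  have "0 \<le> (\<Sum>i<M. T i)"
  \<comment> \<open>The arguments of \<open>G\<close> are exactly what the cells n - 1 and n share:
    the coarse value at their common node and the coefficients of the wavelets on either side of
    it.\<close>
  proof (rule sum_nonneg_telescope[where G = "\<lambda>n. G (c n) (d (n - 1)) (d n)"])
    show "0 \<le> T 0 + G (c 1) (d (1 - 1)) (d 1)"
      using bdy[of "c 0" "d 0" "c 1" "d 1"] assms(1)
      unfolding T_def two_scale_even two_scale_odd by simp
    show "0 \<le> T n + G (c (Suc n)) (d (Suc n - 1)) (d (Suc n)) - G (c n) (d (n - 1)) (d n)"
      if "1 \<le> n" "Suc n < M" for n
      using int[of "c n" "d (n - 1)" "d n" "c (Suc n)" "d (Suc n)"] that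
      unfolding T_def two_scale_even two_scale_odd by simp
    show "0 \<le> T (M - 1) - G (c (M - 1)) (d (M - 1 - 1)) (d (M - 1))"
    proof -
      obtain n where n: "M = Suc n" "n \<ge> 1" using assms(1) by (cases M) auto
      show ?thesis
        using bdy[of "c M" "d n" "c n" "d (n - 1)"] n
          G_anti[of "c n" "d n" "d (n - 1)"] p_sym[of "c n" "c (Suc n)"] q_sym
        unfolding T_def two_scale_even two_scale_odd by (simp add: add.commute diff_diff_eq)
    qed
  qed fact
  then show ?thesis
    by (simp add: T_def cell_sum_def sum_lessThan_double sum.distrib sum_subtractf sum_distrib_left)
qed

text \<open>Refining a coarse function alone already gains (c1 - c0)^2 / 20 per cell:
  \<open>lower_form\<close> is the mass form minus (x - y)^2 / 30, and halving the steps shrinks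
  this penalty. The gain pays for the cross terms between coarse slopes and wavelets; for the mass
  form it would be 0. The linear part of \<open>G\<close> cancels the products of coarse values with
  the cell means of wavelets, so that only c1 - c0 remains; the quadratic part moves squares between
  neighbours.\<close>

lemma cell_sum_two_scale_lower:
  assumes "2 \<le> M"
  shows "2 * cell_sum lower_form M c + 2 / 5 * (\<Sum>i<M. (d i)^2) \<le> cell_sum lower_form (2 * M) (two_scale M c d)"
proof (rule cell_sum_two_scale[where G = "\<lambda>c d d'. - c * (d - d') - 2 / 5 * (d^2 - d'^2)", OF assms])
  fix c0 c1 d0 d1 d2 :: real
  \<comment> \<open>Both identities are completions of squares, here in the order c1 - c0, d1, d2,
    in the interior cell in the order c1 - c0, d0, d1, d2.\<close>
  have "lower_form (c0 - 3 * d1) ((c0 + c1) / 2 + 5 / 2 * d1)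
         + lower_form ((c0 + c1) / 2 + 5 / 2 * d1) (c1 - d1 - d2)
         - 2 * lower_form c0 c1 - 2 / 5 * d1^2 + (- c1 * (d1 - d2) - 2 / 5 * (d1^2 - d2^2))
      = 2 * (1 / 40 * ((c1 - c0) + d1 + 2 * d2)^2 + 19 / 20 * (d1 - 3 / 19 * d2)^2 + 43 / 190 * d2^2)"
    by (simp add: lower_form_def power2_eq_square field_simps)
  also have "\<dots> \<ge> 0" by simp
  finally show "0 \<le> lower_form (c0 - 3 * d1) ((c0 + c1) / 2 + 5 / 2 * d1)
         + lower_form ((c0 + c1) / 2 + 5 / 2 * d1) (c1 - d1 - d2)
         - 2 * lower_form c0 c1 - 2 / 5 * d1^2 + (- c1 * (d1 - d2) - 2 / 5 * (d1^2 - d2^2))" .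
  have "lower_form (c0 - d0 - d1) ((c0 + c1) / 2 + 2 * d1)
         + lower_form ((c0 + c1) / 2 + 2 * d1) (c1 - d1 - d2)
         - 2 * lower_form c0 c1 - 2 / 5 * d1^2 + (- c1 * (d1 - d2) - 2 / 5 * (d1^2 - d2^2))
         - (- c0 * (d0 - d1) - 2 / 5 * (d0^2 - d1^2))
      = 2 * (1 / 40 * ((c1 - c0) - 2 * d0 + 2 * d2)^2 + 1 / 4 * (d0 - d1 / 5 + 2 / 5 * d2)^2
         + 9 / 100 * (d1 - d2 / 3)^2 + 1 / 5 * d2^2)"
    by (simp add: lower_form_def power2_eq_square field_simps)
  also have "\<dots> \<ge> 0" by simp
  finally show "0 \<le> lower_form (c0 - d0 - d1) ((c0 + c1) / 2 + 2 * d1)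
         + lower_form ((c0 + c1) / 2 + 2 * d1) (c1 - d1 - d2)
         - 2 * lower_form c0 c1 - 2 / 5 * d1^2 + (- c1 * (d1 - d2) - 2 / 5 * (d1^2 - d2^2))
         - (- c0 * (d0 - d1) - 2 / 5 * (d0^2 - d1^2))" .
qed (simp_all add: lower_form_def algebra_simps)


text \<open>The cell criterion is applied to the negated form. Refinement now loses (c1 - c0)^2 / 4
  per cell, which absorbs the cross term of the boundary cells; in interior cells none is left after
  telescoping. The constant 16 is generous: at least 3 d1^2 remains in each cell.\<close>

lemma cell_sum_two_scale_upper:
  assumes "2 \<le> M"
  shows "cell_sum upper_form (2 * M) (two_scale M c d) \<le> 2 * cell_sum upper_form M c + 16 * (\<Sum>i<M. (d i)^2)"
proof -
  have "2 * cell_sum (\<lambda>x y. - upper_form x y) M c + - 16 * (\<Sum>i<M. (d i)^2)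
      \<le> cell_sum (\<lambda>x y. - upper_form x y) (2 * M) (two_scale M c d)"
  proof (rule cell_sum_two_scale[where G = "\<lambda>c d d'. c * (d - d') + (d'^2 - d^2)", OF assms])
    fix c0 c1 d0 d1 d2 :: real
    have "- upper_form (c0 - 3 * d1) ((c0 + c1) / 2 + 5 / 2 * d1)
         + - upper_form ((c0 + c1) / 2 + 5 / 2 * d1) (c1 - d1 - d2)
         - 2 * - upper_form c0 c1 - - 16 * d1^2 + (c1 * (d1 - d2) + (d2^2 - d1^2))
      = 1 / 4 * ((c1 - c0) - d1)^2 + 1 / 2 * (d1 - d2)^2 + 3 * d1^2"
      by (simp add: upper_form_def power2_eq_square field_simps)
    also have "\<dots> \<ge> 0" by simp
    finally show "0 \<le> - upper_form (c0 - 3 * d1) ((c0 + c1) / 2 + 5 / 2 * d1)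
         + - upper_form ((c0 + c1) / 2 + 5 / 2 * d1) (c1 - d1 - d2)
         - 2 * - upper_form c0 c1 - - 16 * d1^2 + (c1 * (d1 - d2) + (d2^2 - d1^2))" .
    have "- upper_form (c0 - d0 - d1) ((c0 + c1) / 2 + 2 * d1)
         + - upper_form ((c0 + c1) / 2 + 2 * d1) (c1 - d1 - d2)
         - 2 * - upper_form c0 c1 - - 16 * d1^2 + (c1 * (d1 - d2) + (d2^2 - d1^2))
         - (c0 * (d0 - d1) + (d1^2 - d0^2))
      = 1 / 4 * (c1 - c0)^2 + 1 / 2 * (d0 - d1)^2 + 1 / 2 * (d1 - d2)^2 + 8 * d1^2"
      by (simp add: upper_form_def power2_eq_square field_simps)
    also have "\<dots> \<ge> 0" by simp
    finally show "0 \<le> - upper_form (c0 - d0 - d1) ((c0 + c1) / 2 + 2 * d1)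
         + - upper_form ((c0 + c1) / 2 + 2 * d1) (c1 - d1 - d2)
         - 2 * - upper_form c0 c1 - - 16 * d1^2 + (c1 * (d1 - d2) + (d2^2 - d1^2))
         - (c0 * (d0 - d1) + (d1^2 - d0^2))" .
  qed (simp_all add: upper_form_def algebra_simps)
  then show ?thesis by (simp add: cell_sum_def sum_negf)
qed

text \<open>Gaussian elimination of the first \<open>n + 1\<close> unknowns; \<open>z\<close> is the free value of the next one.\<close>
lemma tridiagonal_elimination:
  fixes \<alpha> \<beta> r :: "nat \<Rightarrow> real"
  assumes nonneg: "\<And>i. 0 \<le> \<alpha> i" "\<And>i. 0 \<le> \<beta> i"
  shows "\<exists>p s. 0 \<le> s \<and> s \<le> 1 \<and> (\<forall>z. \<exists>c. c (Suc n) = z \<and> c n = p - s * z \<and>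
     (\<forall>i\<le>n. (1 + (if i = 0 then 0 else \<alpha> i) + \<beta> i) * c i + (if i = 0 then 0 else \<alpha> i * c (i - 1)) + \<beta> i * c (Suc i) = r i))"
proof (induction n)
  case 0
  define D where "D = 1 + \<beta> 0"
  have D: "D > 0" "\<beta> 0 \<le> D" using nonneg(2)[of 0] by (auto simp: D_def)
  show ?case
  proof (rule exI[of _ "r 0 / D"], rule exI[of _ "\<beta> 0 / D"], intro conjI allI)
    fix z
    have "D * (r 0 / D - \<beta> 0 / D * z) + \<beta> 0 * z = r 0" using D by (simp add: field_simps)
    then show "\<exists>c. c (Suc 0) = z \<and> c 0 = r 0 / D - \<beta> 0 / D * z \<and>
      (\<forall>i\<le>0. (1 + (if i = 0 then 0 else \<alpha> i) + \<beta> i) * c i + (if i = 0 then 0 else \<alpha> i * c (i - 1)) + \<beta> i * c (Suc i) = r i)"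
      by (intro exI[of _ "\<lambda>i. if i = 0 then r 0 / D - \<beta> 0 / D * z else z"]) (simp add: D_def)
  qed (use D nonneg in auto)
next
  case (Suc n)
  then obtain p s where s: "0 \<le> s" "s \<le> 1" and sol: "\<And>z. \<exists>c. c (Suc n) = z \<and> c n = p - s * z \<and>
     (\<forall>i\<le>n. (1 + (if i = 0 then 0 else \<alpha> i) + \<beta> i) * c i + (if i = 0 then 0 else \<alpha> i * c (i - 1)) + \<beta> i * c (Suc i) = r i)"
    by blast
  let ?a = "\<alpha> (Suc n)" and ?b = "\<beta> (Suc n)"
  \<comment> \<open>The pivot after substituting c n = p - s c (n + 1). The invariant s \<le> 1
    keeps it at least 1 + ?b, so the new ratio ?b / D lies in [0, 1] again.\<close>
  define D where "D = 1 + ?a * (1 - s) + ?b"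
  have D: "D > 0" "?b \<le> D"
  proof -
    have "0 \<le> ?a * (1 - s)" using nonneg(1) s by simp
    then show "D > 0" "?b \<le> D" using nonneg(2)[of "Suc n"] by (simp_all add: D_def)
  qed
  define p' where "p' = (r (Suc n) - ?a * p) / D"
  show ?case
  proof (rule exI[of _ p'], rule exI[of _ "?b / D"], intro conjI allI)
    fix z
    define y where "y = p' - ?b / D * z"
    have "D * y = r (Suc n) - ?a * p - ?b * z" using D by (simp add: y_def p'_def field_simps)
    then have row: "(1 + ?a + ?b) * y + ?a * (p - s * y) + ?b * z = r (Suc n)"
      by (simp add: D_def algebra_simps)
    obtain c where c: "c (Suc n) = y" "c n = p - s * y"
      "\<And>i. i \<le> n \<Longrightarrow> (1 + (if i = 0 then 0 else \<alpha> i) + \<beta> i) * c i + (if i = 0 then 0 else \<alpha> i * c (i - 1)) + \<beta> i * c (Suc i) = r i"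
      using sol[of y] by blast
    let ?c = "c(Suc (Suc n) := z)"
    have "(1 + (if i = 0 then 0 else \<alpha> i) + \<beta> i) * ?c i + (if i = 0 then 0 else \<alpha> i * ?c (i - 1)) + \<beta> i * ?c (Suc i) = r i"
      if "i \<le> Suc n" for i
    proof (cases "i = Suc n")
      case True
      then show ?thesis using row c(1,2) by simp
    next
      case False
      then have "i \<le> n" using that by simp
      moreover from this have "?c i = c i" "?c (i - 1) = c (i - 1)" "?c (Suc i) = c (Suc i)" by auto
      ultimately show ?thesis using c(3)[of i] by (cases "i = 0") simp_all
    qed
    then show "\<exists>c. c (Suc (Suc n)) = z \<and> c (Suc n) = p' - ?b / D * z \<and>
      (\<forall>i\<le>Suc n. (1 + (if i = 0 then 0 else \<alpha> i) + \<beta> i) * c i + (if i = 0 then 0 else \<alpha> i * c (i - 1)) + \<beta> i * c (Suc i) = r i)"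
      using c(1) by (intro exI[of _ ?c]) (simp add: y_def)
  qed (use D nonneg in auto)
qed

text \<open>The odd nodes determine \<open>d\<close> from \<open>c\<close>. Substituted into the
  even nodes, this leaves a tridiagonal system for \<open>c\<close> with diagonal 1 + \<alpha> i +
  \<beta> i and off-diagonal entries \<alpha> i and \<beta> i.\<close>

lemma two_scale_surj:
  assumes "2 \<le> M"
  obtains c d where "\<And>m. m \<le> 2 * M \<Longrightarrow> two_scale M c d m = v m"
proof -
  define k :: "nat \<Rightarrow> real" where "k = (\<lambda>i. if i = 0 \<or> Suc i = M then 5/2 else 2)"
  have k0: "k i > 0" for i by (simp add: k_def)
  define \<alpha> where "\<alpha> = (\<lambda>i. (if i = M then 3 else 1) / (2 * k (i - 1)))"
  \<comment> \<open>No wavelet lies to the right of the last node. The entry 0 at i = M closes the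
    system, so the value c (M + 1) left free by the elimination has no influence.\<close>
  define \<beta> where "\<beta> = (\<lambda>i. if i = M then 0 else (if i = 0 then 3 else 1) / (2 * k i))"
  define r where "r = (\<lambda>i. v (2 * i) + (if i = 0 then 0 else 2 * \<alpha> i * v (2 * i - 1)) + 2 * \<beta> i * v (Suc (2 * i)))"
  have nonneg: "0 \<le> \<alpha> i" "0 \<le> \<beta> i" for i
    using k0 less_imp_le by (auto simp: \<alpha>_def \<beta>_def)
  obtain c where c: "\<And>i. i \<le> M \<Longrightarrow> (1 + (if i = 0 then 0 else \<alpha> i) + \<beta> i) * c i
      + (if i = 0 then 0 else \<alpha> i * c (i - 1)) + \<beta> i * c (Suc i) = r i"
    using tridiagonal_elimination[where n = M and \<alpha> = \<alpha> and \<beta> = \<beta> and r = r, OF nonneg] by blast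
  define d where "d = (\<lambda>i. (v (Suc (2 * i)) - (c i + c (Suc i)) / 2) / k i)"
  have "two_scale M c d m = v m" if m: "m \<le> 2 * M" for m
  proof (cases "even m")
    case True
    then obtain i where i: "m = 2 * i" "i \<le> M" using m by auto
    have A: "(if i = 0 then 0 else (if i = M then 3 else 1) * d (i - 1))
       = (if i = 0 then 0 else 2 * \<alpha> i * v (2 * i - 1) - \<alpha> i * (c (i - 1) + c i))"
    proof (cases i)
      case (Suc j)
      then show ?thesis using k0[of j] by (simp add: \<alpha>_def d_def field_simps)
    qed simp
    have B: "(if i = M then 0 else (if i = 0 then 3 else 1) * d i) = 2 * \<beta> i * v (Suc (2 * i)) - \<beta> i * (c i + c (Suc i))"
      using k0[of i] by (simp add: \<beta>_def d_def field_simps)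
    show ?thesis
      unfolding i(1) two_scale_even A B using c[OF i(2)] by (auto simp: r_def algebra_simps split: if_splits)
  next
    case False
    then obtain i where i: "m = Suc (2 * i)" by (auto elim: oddE)
    show ?thesis
      unfolding i two_scale_odd using k0[of i] by (simp add: d_def k_def)
  qed
  then show ?thesis by (rule that)
qed

section \<open>Piecewise linear functions\<close>

text \<open>Stated in the local coordinate \<open>t\<close> of a cell. Nothing is said outside the
  unit interval or about \<open>v\<close> beyond 2^n, which suits nodal vectors given as functions
  on all naturals.\<close>

definition pw_linear :: "nat \<Rightarrow> (nat \<Rightarrow> real) \<Rightarrow> (real \<Rightarrow> real) \<Rightarrow> bool" where
  "pw_linear n v g \<longleftrightarrow>
     (\<forall>i<2^n. \<forall>t\<in>{0..1}. g ((real i + t) / 2^n) = (1 - t) * v i + t * v (Suc i))"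

lemma unit_interval_cell:
  assumes "x \<in> {0..1::real}"
  obtains i t where "i < 2^n" "t \<in> {0..1}" "x = (real i + t) / 2^n"
\<comment> \<open>At x = 1 the floor would give the nonexistent cell 2^n; the point counts as the
  right end of the last cell.\<close>
proof (cases "x = 1")
  case True
  then show ?thesis using that[of "2^n - 1" 1] by (simp add: of_nat_diff)
next
  case False
  define i where "i = nat \<lfloor>2^n * x\<rfloor>"
  have x: "0 \<le> 2^n * x" "2^n * x < 2^n" using assms False by auto
  have i: "real i \<le> 2^n * x" "2^n * x < real i + 1" using x(1) by (auto simp: i_def)
  then have "real i < 2^n" using x by linarith
  then have "i < 2^n" by (metis of_nat_less_iff of_nat_numeral of_nat_power)
  then show ?thesis
    using that[of i "2^n * x - real i"] i by auto
qed

lemma pw_linear_determined: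
  assumes "pw_linear n v g" "pw_linear n v h" "x \<in> {0..1}"
  shows "g x = h x"
  using unit_interval_cell[OF assms(3), of n] assms(1,2) unfolding pw_linear_def by metis

lemma pw_linear_lincomb:
  assumes "pw_linear n v g" "pw_linear n w h"
  shows "pw_linear n (\<lambda>i. a * v i + b * w i) (\<lambda>x. a * g x + b * h x)"
  unfolding pw_linear_def
proof (intro allI impI ballI)
  fix i :: nat and t :: real assume "i < 2^n" "t \<in> {0..1}"
  then have eq: "g ((real i + t) / 2^n) = (1 - t) * v i + t * v (Suc i)"
    "h ((real i + t) / 2^n) = (1 - t) * w i + t * w (Suc i)"
    using assms unfolding pw_linear_def by blast+
  show "a * g ((real i + t) / 2^n) + b * h ((real i + t) / 2^n)
      = (1 - t) * (a * v i + b * w i) + t * (a * v (Suc i) + b * w (Suc i))"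
    unfolding eq by (simp add: algebra_simps)
qed

lemma pw_linear_cmult:
  assumes "pw_linear n v g"
  shows "pw_linear n (\<lambda>i. a * v i) (\<lambda>x. a * g x)"
  using pw_linear_lincomb[OF assms assms, of a 0] by simp

lemma pw_linear_sum:
  assumes "\<And>k. k \<in> A \<Longrightarrow> pw_linear n (v k) (g k)"
  shows "pw_linear n (\<lambda>i. \<Sum>k\<in>A. v k i) (\<lambda>x. \<Sum>k\<in>A. g k x)"
  unfolding pw_linear_def
proof (intro allI impI ballI)
  fix i t assume "i < (2::nat)^n" "t \<in> {0..1::real}"
  then have "(\<Sum>k\<in>A. g k ((real i + t) / 2^n)) = (\<Sum>k\<in>A. (1 - t) * v k i + t * v k (Suc i))"
    using assms unfolding pw_linear_def by (intro sum.cong) auto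
  then show "(\<Sum>k\<in>A. g k ((real i + t) / 2^n)) = (1 - t) * (\<Sum>k\<in>A. v k i) + t * (\<Sum>k\<in>A. v k (Suc i))"
    by (simp add: sum.distrib sum_distrib_left)
qed

lemma pw_linear_cong:
  assumes "pw_linear n v g" "\<And>i. i \<le> 2^n \<Longrightarrow> w i = v i"
  shows "pw_linear n w g"
  using assms unfolding pw_linear_def by simp

lemma two_scale_0:
  "two_scale M c (\<lambda>_. 0) (2 * i) = c i"
  "two_scale M c (\<lambda>_. 0) (Suc (2 * i)) = (c i + c (Suc i)) / 2"
  by (simp_all add: two_scale_even two_scale_odd)

text \<open>Both directions matter: coarse functions are moved to the fine grid for the norm
  estimates, and for density a fine function without wavelet part is recognised as coarse.\<close>

lemma pw_linear_refine:
  "pw_linear (Suc n) (two_scale (2^n) c (\<lambda>_. 0)) g \<longleftrightarrow> pw_linear n c g"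
proof
  assume L: "pw_linear n c g"
  show "pw_linear (Suc n) (two_scale (2^n) c (\<lambda>_. 0)) g"
    unfolding pw_linear_def
  proof (intro allI impI ballI)
    fix m :: nat and t :: real assume m: "m < 2 ^ Suc n" and t: "t \<in> {0..1}"
    show "g ((real m + t) / 2 ^ Suc n) = (1 - t) * two_scale (2^n) c (\<lambda>_. 0) m + t * two_scale (2^n) c (\<lambda>_. 0) (Suc m)"
    proof (cases "even m")
      case True
      then obtain i where i: "m = 2 * i" by blast
      have "g ((real m + t) / 2 ^ Suc n) = g ((real i + t / 2) / 2^n)"
        by (simp add: i field_simps)
      also have "\<dots> = (1 - t / 2) * c i + t / 2 * c (Suc i)"
        using L m t unfolding pw_linear_def i by (auto dest!: spec[of _ i] bspec[of _ _ "t / 2"])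
      finally show ?thesis unfolding i two_scale_0 by (simp add: field_simps)
    next
      case False
      then obtain i where i: "m = Suc (2 * i)" by (auto elim: oddE)
      then have i': "Suc m = 2 * Suc i" by simp
      have "g ((real m + t) / 2 ^ Suc n) = g ((real i + (1 + t) / 2) / 2^n)"
        by (simp add: i field_simps)
      also have "\<dots> = (1 - (1 + t) / 2) * c i + (1 + t) / 2 * c (Suc i)"
        using L m t unfolding pw_linear_def i by (auto dest!: spec[of _ i] bspec[of _ _ "(1 + t) / 2"])
      finally show ?thesis unfolding i' two_scale_0 unfolding i two_scale_0 by (simp add: field_simps)
    qed
  qed
next
  assume L: "pw_linear (Suc n) (two_scale (2^n) c (\<lambda>_. 0)) g"
  show "pw_linear n c g"
    unfolding pw_linear_def
  proof (intro allI impI ballI)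
    fix i :: nat and t :: real assume i: "i < 2 ^ n" and t: "t \<in> {0..1}"
    show "g ((real i + t) / 2 ^ n) = (1 - t) * c i + t * c (Suc i)"
    proof (cases "t \<le> 1 / 2")
      case True
      have "g ((real i + t) / 2 ^ n) = g ((real (2 * i) + 2 * t) / 2 ^ Suc n)"
        by (rule arg_cong[where f = g]) (simp add: field_simps)
      also have "\<dots> = (1 - 2 * t) * two_scale (2^n) c (\<lambda>_. 0) (2 * i) + 2 * t * two_scale (2^n) c (\<lambda>_. 0) (Suc (2 * i))"
        using L i t True unfolding pw_linear_def by (auto dest!: spec[of _ "2 * i"] bspec[of _ _ "2 * t"])
      finally show ?thesis unfolding two_scale_0 by (simp add: field_simps)
    next
      case False
      have "g ((real i + t) / 2 ^ n) = g ((real (Suc (2 * i)) + (2 * t - 1)) / 2 ^ Suc n)"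
        by (rule arg_cong[where f = g]) (simp add: field_simps)
      also have "\<dots> = (1 - (2 * t - 1)) * two_scale (2^n) c (\<lambda>_. 0) (Suc (2 * i)) + (2 * t - 1) * two_scale (2^n) c (\<lambda>_. 0) (2 * Suc i)"
        using L i t False unfolding pw_linear_def by (auto dest!: spec[of _ "Suc (2 * i)"] bspec[of _ _ "2 * t - 1"])
      finally show ?thesis unfolding two_scale_0 by (simp add: field_simps)
    qed
  qed
qed

lemma has_integral_cells:
  fixes h :: "real \<Rightarrow> real"
  assumes N: "N > 0" and eq: "\<And>i t. i < N \<Longrightarrow> t \<in> {0..1} \<Longrightarrow> h ((real i + t) / real N) = H i t"
    and I: "\<And>i. i < N \<Longrightarrow> (H i has_integral I i) {0..1}"
  shows "(h has_integral (\<Sum>i<N. I i) / real N) {0..1}"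
proof -
  have cell: "(h has_integral I i / real N) {real i / real N .. real (Suc i) / real N}" if i: "i < N" for i
  proof -
    have "((\<lambda>x. H i (real N * x + (- real i))) has_integral (1 / \<bar>real N\<bar> ^ DIM(real)) *\<^sub>R I i)
       ((\<lambda>x. (1 / real N) *\<^sub>R x + - ((1 / real N) *\<^sub>R (- real i))) ` cbox 0 1)"
      using has_integral_affinity[of "H i" "I i" 0 1 "real N" "- real i"] I[OF i] N by simp
    moreover have "((\<lambda>x. (1 / real N) *\<^sub>R x + - ((1 / real N) *\<^sub>R (- real i))) ` cbox 0 1)
       = {real i / real N .. real (Suc i) / real N}"
      using N image_affinity_atLeastAtMost[of "1 / real N" "real i / real N" 0 1]
      by (simp add: field_simps)
    ultimately have "((\<lambda>x. H i (real N * x + (- real i))) has_integral I i / real N) {real i / real N .. real (Suc i) / real N}"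
      by simp
    then show ?thesis
    proof (rule has_integral_eq[rotated])
      fix x assume x: "x \<in> {real i / real N .. real (Suc i) / real N}"
      have "real N * x - real i \<in> {0..1}" using x N by (auto simp: field_simps)
      from eq[OF i this] show "H i (real N * x + - real i) = h x" using N by simp
    qed
  qed
  have "(h has_integral (\<Sum>i<k. I i) / real N) {0..real k / real N}" if "k \<le> N" for k
    using that
  proof (induction k)
    case 0
    then show ?case using has_integral_refl(2)[of h "0::real"] by simp
  next
    case (Suc k)
    then have "(h has_integral (\<Sum>i<k. I i) / real N) {0..real k / real N}"
      "(h has_integral I k / real N) {real k / real N .. real (Suc k) / real N}"
      using cell[of k] by auto
    then have "(h has_integral (\<Sum>i<k. I i) / real N + I k / real N) {0..real (Suc k) / real N}"
      using N by (intro has_integral_combine[of 0 "real k / real N"]) (auto simp: divide_right_mono)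
    then show ?case by (simp add: add_divide_distrib)
  qed
  from this[of N] show ?thesis using N by simp
qed

lemma pw_linear_has_integral_square:
  assumes "pw_linear n v g"
  shows "((\<lambda>x. (g x)^2) has_integral cell_sum mass_form (2^n) v / 2^n) {0..1}"
proof -
  have "((\<lambda>x. (g x)^2) has_integral (\<Sum>i<2^n. mass_form (v i) (v (Suc i))) / real (2^n)) {0..1}"
  proof (rule has_integral_cells[where H = "\<lambda>i t. ((1 - t) * v i + t * v (Suc i))^2"])
    show "(g ((real i + t) / real (2 ^ n)))\<^sup>2 = ((1 - t) * v i + t * v (Suc i))\<^sup>2"
      if "i < 2^n" "t \<in> {0..1}" for i t
      using assms that unfolding pw_linear_def by simp
    fix i
    define a b where "a = v i" and "b = v (Suc i) - v i"
    have "((\<lambda>t. a^2 * t + a * b * t^2 + b^2 / 3 * t^3) has_vector_derivative ((1 - t) * v i + t * v (Suc i))^2) (at t within {0..1})" for t :: real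
    proof -
      have "((\<lambda>t. p * t + q * t^2 + r * t^3) has_real_derivative p + 2 * q * t + 3 * r * t^2) (at t within {0..1})" for p q r
        by (auto intro!: derivative_eq_intros)
      from this[of "a^2" "a * b" "b^2 / 3"] show ?thesis
        unfolding has_real_derivative_iff_has_vector_derivative
        by (rule has_vector_derivative_eq_rhs) (simp add: a_def b_def power2_eq_square field_simps)
    qed
    from fundamental_theorem_of_calculus[OF _ this]
    have "((\<lambda>t. ((1 - t) * v i + t * v (Suc i))\<^sup>2) has_integral a^2 + a * b + b^2 / 3) {0..1}"
      by simp
    moreover have "a^2 + a * b + b^2 / 3 = mass_form (v i) (v (Suc i))"
      by (simp add: a_def b_def mass_form_def power2_eq_square field_simps)
    ultimately show "((\<lambda>t. ((1 - t) * v i + t * v (Suc i))\<^sup>2) has_integral mass_form (v i) (v (Suc i))) {0..1}"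
      by simp
  qed simp
  then show ?thesis by (simp add: cell_sum_def)
qed

lemma pw_linear_has_integral:
  assumes "pw_linear n v g"
  shows "(g has_integral (\<Sum>i<2^n. (v i + v (Suc i)) / 2) / 2^n) {0..1}"
proof -
  have "(g has_integral (\<Sum>i<2^n. (v i + v (Suc i)) / 2) / real (2^n)) {0..1}"
  proof (rule has_integral_cells[where H = "\<lambda>i t. (1 - t) * v i + t * v (Suc i)"])
    show "g ((real i + t) / real (2 ^ n)) = (1 - t) * v i + t * v (Suc i)"
      if "i < 2^n" "t \<in> {0..1}" for i t
      using assms that unfolding pw_linear_def by simp
    fix i
    have "((\<lambda>t. v i * t + (v (Suc i) - v i) / 2 * t^2) has_vector_derivative (1 - t) * v i + t * v (Suc i)) (at t within {0..1})" for t :: real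
    proof -
      have "((\<lambda>t. p * t + q * t^2) has_real_derivative p + 2 * q * t) (at t within {0..1})" for p q
        by (auto intro!: derivative_eq_intros)
      from this[of "v i" "(v (Suc i) - v i) / 2"] show ?thesis
        unfolding has_real_derivative_iff_has_vector_derivative
        by (rule has_vector_derivative_eq_rhs) (simp add: field_simps)
    qed
    from fundamental_theorem_of_calculus[OF _ this]
    have "((\<lambda>t. (1 - t) * v i + t * v (Suc i)) has_integral v i + (v (Suc i) - v i) / 2) {0..1}"
      by simp
    then show "((\<lambda>t. (1 - t) * v i + t * v (Suc i)) has_integral (v i + v (Suc i)) / 2) {0..1}"
      by (simp add: field_simps)
  qed simp
  then show ?thesis by simp
qed

lemma pw_linear_L2_norm:
  assumes "primitive01 F g" "pw_linear n v g"
  shows "(L2_norm g)^2 = cell_sum mass_form (2^n) v / 2^n"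
  unfolding L2_norm_power2
  using primitive01_L2(2)[OF assms(1)]
  by (intro LINT_unit_eqI pw_linear_has_integral_square assms(2)) (simp add: L2_space_def)

section \<open>Continuous piecewise linear interpolation\<close>

definition hat :: "real \<Rightarrow> real" where
  "hat y = max 0 (1 - \<bar>y\<bar>)"

definition pl_interp :: "nat \<Rightarrow> (nat \<Rightarrow> real) \<Rightarrow> real \<Rightarrow> real" where
  "pl_interp n v x = (\<Sum>i\<le>2^n. v i * hat (2^n * x - real i))"

lemma pl_interp_continuous: "continuous_on S (pl_interp n v)"
  unfolding pl_interp_def hat_def by (intro continuous_intros)

lemma pl_interp_pw_linear: "pw_linear n v (pl_interp n v)"
  unfolding pw_linear_def
proof (intro allI impI ballI)
  fix k :: nat and t :: real assume k: "k < (2::nat)^n" and t: "t \<in> {0..1}"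
  have "pl_interp n v ((real k + t) / 2^n) = (\<Sum>i\<le>2^n. (if i = k then (1 - t) * v k else 0) + (if i = Suc k then t * v (Suc k) else 0))"
    unfolding pl_interp_def
  proof (intro sum.cong refl)
    fix i assume "i \<in> {..(2::nat)^n}"
    have "2^n * ((real k + t) / 2^n) = real k + t" by simp
    moreover consider "i = k" | "i = Suc k" | "i < k" | "i > Suc k" by linarith
    then have "hat (real k + t - real i) = (if i = k then 1 - t else if i = Suc k then t else 0)"
      using t by cases (auto simp: hat_def max_def)
    ultimately show "v i * hat (2^n * ((real k + t) / 2^n) - real i) = (if i = k then (1 - t) * v k else 0) + (if i = Suc k then t * v (Suc k) else 0)"
      by auto
  qed
  also have "\<dots> = (1 - t) * v k + t * v (Suc k)"
    using k by (simp add: sum.distrib)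
  finally show "pl_interp n v ((real k + t) / 2^n) = (1 - t) * v k + t * v (Suc k)" .
qed

section \<open>Derivatives of the spline wavelets\<close>

lemma DERIV_max_0_power2:
  "((\<lambda>x::real. (max 0 x)^2) has_real_derivative 2 * max 0 x) (at x)"
proof -
  consider "x > 0" | "x < 0" | "x = 0" by linarith
  then show ?thesis
  proof cases
    case 1
    have "((\<lambda>x::real. x^2) has_real_derivative 2 * max 0 x) (at x)"
      using 1 by (auto intro!: derivative_eq_intros)
    then show ?thesis
      by (rule has_field_derivative_transform_within_open[of _ _ _ "{0<..}"]) (use 1 in auto)
  next
    case 2
    have "((\<lambda>x::real. 0) has_real_derivative 2 * max 0 x) (at x)"
      using 2 by (auto intro!: derivative_eq_intros)
    then show ?thesis
      by (rule has_field_derivative_transform_within_open[of _ _ _ "{..<0}"]) (use 2 in auto)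
  next
    case 3
    have "((\<lambda>h::real. ((max 0 (0 + h))^2 - (max 0 0)^2) / h) \<longlongrightarrow> 0) (at 0)"
    proof (rule Lim_null_comparison)
      show "((\<lambda>h::real. \<bar>h\<bar>) \<longlongrightarrow> 0) (at 0)"
        using tendsto_rabs[OF tendsto_ident_at, of "0::real" UNIV] by simp
      show "\<forall>\<^sub>F h::real in at 0. norm (((max 0 (0 + h))^2 - (max 0 0)^2) / h) \<le> \<bar>h\<bar>"
        by (intro always_eventually) (auto simp: max_def power2_eq_square)
    qed
    then show ?thesis using 3 by (simp add: DERIV_def)
  qed
qed

text \<open>\<open>phi\<close> is the quadratic cardinal B-spline, half the third difference of the
  truncated square; hence the coefficients 1, -3, 3, -1. Truncated powers allow differentiation at
  the breakpoints without cases.\<close>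

definition dphi :: "real \<Rightarrow> real" where
  "dphi x = max 0 x - 3 * max 0 (x - 1) + 3 * max 0 (x - 2) - max 0 (x - 3)"

text \<open>Agrees with \<open>phi_b\<close> for \<open>x \<ge> 0\<close> only, but is differentiable at \<open>0\<close>, where \<open>phi_b\<close> has a kink.\<close>
definition phi_b_ext :: "real \<Rightarrow> real" where
  "phi_b_ext x = 3 * x - 9 / 4 * x^2 + 3 * (max 0 (x - 1))^2 - 3 / 4 * (max 0 (x - 2))^2"

definition dphi_b :: "real \<Rightarrow> real" where
  "dphi_b x = 3 - 9 / 2 * x + 6 * max 0 (x - 1) - 3 / 2 * max 0 (x - 2)"

lemma phi_eq:
  "phi x = ((max 0 x)^2 - 3 * (max 0 (x - 1))^2 + 3 * (max 0 (x - 2))^2 - (max 0 (x - 3))^2) / 2"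
proof -
  consider "x < 0" | "0 \<le> x" "x \<le> 1" | "1 < x" "x \<le> 2" | "2 < x" "x \<le> 3" | "3 < x" by linarith
  then show ?thesis
    by cases (auto simp: phi_def max_def power2_eq_square field_simps)
qed

lemma phi_b_eq: "0 \<le> x \<Longrightarrow> phi_b x = phi_b_ext x"
proof -
  assume "0 \<le> x"
  then consider "0 \<le> x" "x \<le> 1" | "1 < x" "x \<le> 2" | "2 < x" by linarith
  then show ?thesis
    by cases (auto simp: phi_b_def phi_b_ext_def max_def power2_eq_square field_simps)
qed

lemma DERIV_max_0_power2_shift:
  "((\<lambda>x::real. (max 0 (x - c))^2) has_real_derivative 2 * max 0 (x - c)) (at x)"
  by (rule DERIV_cong[OF DERIV_chain2[OF DERIV_max_0_power2, where g = "\<lambda>x. x - c" and Db = 1]])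
    (auto intro!: derivative_eq_intros)

lemma phi_DERIV: "(phi has_real_derivative dphi x) (at x)"
proof -
  have eq: "phi = (\<lambda>x. ((max 0 x)^2 - 3 * (max 0 (x - 1))^2 + 3 * (max 0 (x - 2))^2 - (max 0 (x - 3))^2) / 2)"
    using phi_eq by blast
  show ?thesis
    unfolding eq
    by (rule DERIV_cong[OF DERIV_cdivide[OF DERIV_diff[OF DERIV_add[OF DERIV_diff[OF DERIV_max_0_power2
              DERIV_cmult[OF DERIV_max_0_power2_shift]] DERIV_cmult[OF DERIV_max_0_power2_shift]]
              DERIV_max_0_power2_shift]]])
      (simp add: dphi_def)
qed

lemma phi_b_ext_DERIV: "(phi_b_ext has_real_derivative dphi_b x) (at x)"
proof -
  have "((\<lambda>x::real. 3 * x - 9 / 4 * x^2) has_real_derivative 3 - 9 / 2 * x) (at x)"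
    by (auto intro!: derivative_eq_intros)
  from DERIV_diff[OF DERIV_add[OF this DERIV_cmult[OF DERIV_max_0_power2_shift]] DERIV_cmult[OF DERIV_max_0_power2_shift], of 3 1 "3 / 4" 2]
  show ?thesis
    unfolding phi_b_ext_def[abs_def] by (rule DERIV_cong) (simp add: dphi_b_def)
qed

lemma phi_affine_DERIV: "((\<lambda>x. phi (a * x + b)) has_real_derivative a * dphi (a * x + b)) (at x)"
  by (rule DERIV_cong[OF DERIV_chain2[OF phi_DERIV]]) (auto intro!: derivative_eq_intros)

lemma phi_b_ext_affine_DERIV: "((\<lambda>x. phi_b_ext (a * x + b)) has_real_derivative a * dphi_b (a * x + b)) (at x)"
  by (rule DERIV_cong[OF DERIV_chain2[OF phi_b_ext_DERIV]]) (auto intro!: derivative_eq_intros)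

lemma phi_0: "x \<le> 0 \<or> 3 \<le> x \<Longrightarrow> phi x = 0"
  by (auto simp: phi_eq max_def power2_eq_square field_simps)

lemma phi_b_ext_0: "x = 0 \<or> 2 \<le> x \<Longrightarrow> phi_b_ext x = 0"
  by (auto simp: phi_b_ext_def max_def power2_eq_square field_simps)

lemma dphi_continuous [continuous_intros]:
  "continuous_on S f \<Longrightarrow> continuous_on S (\<lambda>x. dphi (f x))"
  unfolding dphi_def by (intro continuous_intros)

lemma dphi_b_continuous [continuous_intros]:
  "continuous_on S f \<Longrightarrow> continuous_on S (\<lambda>x. dphi_b (f x))"
  unfolding dphi_b_def by (intro continuous_intros)

text \<open>Values of \<open>dphi\<close> at the integers, negative ones included because of shifts.
  The boundary analogue below needs naturals only: \<open>dphi_b\<close> does not vanish on the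
  negative axis, but is evaluated at nonnegative arguments only.\<close>

definition phi_node :: "int \<Rightarrow> real" where
  "phi_node m = (if m = 1 then 1 else if m = 2 then -1 else 0)"

definition phi_b_node :: "nat \<Rightarrow> real" where
  "phi_b_node m = (if m = 0 then 3 else if m = 1 then - 3 / 2 else 0)"

lemma dphi_cell:
  assumes "t \<in> {0..1}"
  shows "dphi (of_int m + t) = (1 - t) * phi_node m + t * phi_node (m + 1)"
proof -
  consider "m \<le> -1" | "m = 0" | "m = 1" | "m = 2" | "m \<ge> 3" by linarith
  then show ?thesis
  proof cases
    case 1
    then have "real_of_int m \<le> -1" by linarith
    then show ?thesis using 1 assms by (simp add: dphi_def phi_node_def max_def)
  next
    case 5
    then have "real_of_int m \<ge> 3" by linarith
    then show ?thesis using 5 assms by (simp add: dphi_def phi_node_def max_def)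
  qed (use assms in \<open>auto simp: dphi_def phi_node_def max_def field_simps\<close>)
qed

lemma dphi_b_cell:
  assumes "t \<in> {0..1}"
  shows "dphi_b (real m + t) = (1 - t) * phi_b_node m + t * phi_b_node (Suc m)"
proof -
  consider "m = 0" | "m = 1" | "m \<ge> 2" by linarith
  then show ?thesis
  proof cases
    case 3
    then have "real m \<ge> 2" by simp
    then show ?thesis using 3 assms by (simp add: dphi_b_def phi_b_node_def max_def field_simps)
  qed (use assms in \<open>auto simp: dphi_b_def phi_b_node_def max_def field_simps\<close>)
qed

definition dpsi :: "real \<Rightarrow> real" where
  "dpsi x = dphi (2 * x - 2) - dphi (2 * x - 1)"

definition dpsi_b :: "real \<Rightarrow> real" where
  "dpsi_b x = dphi (2 * x) - dphi_b (2 * x)"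

definition psi_b_ext :: "real \<Rightarrow> real" where
  "psi_b_ext x = - (1/2) * phi_b_ext (2 * x) + (1/2) * phi (2 * x)"

lemma psi_affine_DERIV: "((\<lambda>x. psi (a * x + b)) has_real_derivative a * dpsi (a * x + b)) (at x)"
proof -
  have "((\<lambda>x. - (1/2) * phi ((2 * a) * x + (2 * b - 1)) + (1/2) * phi ((2 * a) * x + (2 * b - 2))) has_real_derivative
     - (1/2) * ((2 * a) * dphi ((2 * a) * x + (2 * b - 1))) + (1/2) * ((2 * a) * dphi ((2 * a) * x + (2 * b - 2)))) (at x)"
    by (intro DERIV_add DERIV_cmult phi_affine_DERIV)
  moreover have "(\<lambda>x. - (1/2) * phi ((2 * a) * x + (2 * b - 1)) + (1/2) * phi ((2 * a) * x + (2 * b - 2))) = (\<lambda>x. psi (a * x + b))"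
    by (simp add: psi_def algebra_simps)
  moreover have "- (1/2) * ((2 * a) * dphi ((2 * a) * x + (2 * b - 1))) + (1/2) * ((2 * a) * dphi ((2 * a) * x + (2 * b - 2))) = a * dpsi (a * x + b)"
    by (simp add: dpsi_def algebra_simps)
  ultimately show ?thesis by simp
qed

lemma psi_b_ext_affine_DERIV: "((\<lambda>x. psi_b_ext (a * x + b)) has_real_derivative a * dpsi_b (a * x + b)) (at x)"
proof -
  have "((\<lambda>x. - (1/2) * phi_b_ext ((2 * a) * x + 2 * b) + (1/2) * phi ((2 * a) * x + 2 * b)) has_real_derivative
     - (1/2) * ((2 * a) * dphi_b ((2 * a) * x + 2 * b)) + (1/2) * ((2 * a) * dphi ((2 * a) * x + 2 * b))) (at x)"
    by (intro DERIV_add DERIV_cmult phi_affine_DERIV phi_b_ext_affine_DERIV)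
  moreover have "(\<lambda>x. - (1/2) * phi_b_ext ((2 * a) * x + 2 * b) + (1/2) * phi ((2 * a) * x + 2 * b)) = (\<lambda>x. psi_b_ext (a * x + b))"
    by (simp add: psi_b_ext_def algebra_simps)
  moreover have "- (1/2) * ((2 * a) * dphi_b ((2 * a) * x + 2 * b)) + (1/2) * ((2 * a) * dphi ((2 * a) * x + 2 * b)) = a * dpsi_b (a * x + b)"
    by (simp add: dpsi_b_def algebra_simps)
  ultimately show ?thesis by simp
qed

lemma psi_b_eq: "0 \<le> x \<Longrightarrow> psi_b x = psi_b_ext x"
  by (simp add: psi_b_def psi_b_ext_def phi_b_eq)

lemma dpsi_cell:
  assumes "t \<in> {0..1}"
  shows "dpsi ((of_int m + t) / 2) = (1 - t) * (phi_node (m - 2) - phi_node (m - 1)) + t * (phi_node (m - 1) - phi_node m)"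
proof -
  have arg: "2 * ((of_int m + t) / 2) - 2 = of_int (m - 2) + t" "2 * ((of_int m + t) / 2) - 1 = of_int (m - 1) + t"
    by (simp_all add: field_simps)
  have m: "m - 2 + 1 = m - 1" "m - 1 + 1 = m" by simp_all
  show ?thesis
    unfolding dpsi_def arg dphi_cell[OF assms] m by (simp add: algebra_simps)
qed

lemma dpsi_b_cell:
  assumes "t \<in> {0..1}"
  shows "dpsi_b ((real m + t) / 2) = (1 - t) * (phi_node (int m) - phi_b_node m) + t * (phi_node (int m + 1) - phi_b_node (Suc m))"
proof -
  have arg: "2 * ((real m + t) / 2) = real m + t" by simp
  have "dphi (real m + t) = (1 - t) * phi_node (int m) + t * phi_node (int m + 1)"
    using dphi_cell[OF assms, of "int m"] by simp
  then show ?thesis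
    unfolding dpsi_b_def arg dphi_b_cell[OF assms] by (simp add: algebra_simps)
qed

text \<open>The inner factor 2 of \<open>psi\<close> and \<open>psi_b\<close> cancels their
  coefficients 1/2 and puts the breakpoints at half cells, hence the level \<open>Suc j\<close>.
  What remains is the scaling 2^(j/2) and the inner derivative 2^j.\<close>

lemma psi_jk_primitive01:
  assumes j: "2 \<le> j" and i: "i < 2^j"
  obtains g where "primitive01 (psi_jk j (int i + 1)) g"
    "pw_linear (Suc j) (\<lambda>m. 2 powr (real j / 2) * 2^j * two_scale (2^j) (\<lambda>_. 0) (\<lambda>l. if l = i then 1 else 0) m) g"
proof -
  define s where "s = 2 powr (real j / 2)"
  define M where "M = (2::nat)^j"
  have M: "4 \<le> M" "i < M" "real M = 2^j" "int M = 2^j"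
    using i power_increasing[OF j, of "2::nat"] by (auto simp: M_def)
  have M4: "(4::real) \<le> 2^j" using M(1,3) by (metis of_nat_le_iff of_nat_numeral)
  consider "i = 0" | "Suc i = M" | "0 < i" "Suc i < M" using M(2) by linarith
  then show ?thesis
  proof cases
    case 1
    define g where "g = (\<lambda>x. s * (2^j * dpsi_b (2^j * x + 0)))"
    have "primitive01 (psi_jk j (int i + 1)) g"
    proof (rule primitive01I_DERIV)
      show "psi_jk j (int i + 1) x = s * psi_b_ext (2^j * x + 0)" if "x \<in> {0..1}" for x
        using that 1 by (simp add: psi_jk_def s_def psi_b_eq)
      show "((\<lambda>x. s * psi_b_ext (2^j * x + 0)) has_real_derivative g x) (at x)" for x
        unfolding g_def by (intro DERIV_cmult psi_b_ext_affine_DERIV)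
      show "continuous_on {0..1} g" unfolding g_def dpsi_b_def by (intro continuous_intros)
      show "s * psi_b_ext (2^j * 0 + 0) = 0" by (simp add: psi_b_ext_def phi_0 phi_b_ext_0)
      show "s * psi_b_ext (2^j * 1 + 0) = 0" using M4 by (simp add: psi_b_ext_def phi_0 phi_b_ext_0)
    qed
    moreover have "pw_linear (Suc j) (\<lambda>m. s * 2^j * two_scale M (\<lambda>_. 0) (\<lambda>l. if l = i then 1 else 0) m) g"
    proof -
      have node: "two_scale M (\<lambda>_. 0) (\<lambda>l. if l = i then 1 else 0) m = phi_node (int m) - phi_b_node m" for m
      proof (cases "even m")
        case True
        then obtain k where k: "m = 2 * k" by blast
        show ?thesis using M(1) 1 unfolding k two_scale_even
          by (auto simp: phi_node_def phi_b_node_def)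
      next
        case False
        then obtain k where k: "m = Suc (2 * k)" by (auto elim: oddE)
        show ?thesis using M(1) 1 unfolding k two_scale_odd
          by (auto simp: phi_node_def phi_b_node_def)
      qed
      have "g ((real m + t) / 2 ^ Suc j) = (1 - t) * (s * 2^j * two_scale M (\<lambda>_. 0) (\<lambda>l. if l = i then 1 else 0) m)
          + t * (s * 2^j * two_scale M (\<lambda>_. 0) (\<lambda>l. if l = i then 1 else 0) (Suc m))"
        if t: "t \<in> {0..1}" for m t
      proof -
        have arg: "2^j * ((real m + t) / 2 ^ Suc j) + 0 = (real m + t) / 2" by simp
        have "int (Suc m) = int m + 1" by simp
        then show ?thesis
          unfolding g_def arg dpsi_b_cell[OF t] node by (simp only: algebra_simps)
      qed
      then show ?thesis by (simp add: pw_linear_def)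
    qed
    ultimately show ?thesis using that unfolding s_def M_def by blast
  next
    case 2
    \<comment> \<open>The minus sign of the last wavelet cancels the one from the reflection, so the
      nodal values are those of the first wavelet, mirrored without a change of sign.\<close>
    define g where "g = (\<lambda>x. - s * (- (2^j) * dpsi_b (- (2^j) * x + 2^j)))"
    have i2: "int i + 1 = 2^j" "i \<noteq> 0" using 2 M(1) unfolding M(4)[symmetric] by linarith+
    have "primitive01 (psi_jk j (int i + 1)) g"
    proof (rule primitive01I_DERIV)
      show "psi_jk j (int i + 1) x = - s * psi_b_ext (- (2^j) * x + 2^j)" if "x \<in> {0..1}" for x
        using that i2 j by (simp add: psi_jk_def s_def psi_b_eq algebra_simps)
      show "((\<lambda>x. - s * psi_b_ext (- (2^j) * x + 2^j)) has_real_derivative g x) (at x)" for x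
        unfolding g_def by (intro DERIV_cmult psi_b_ext_affine_DERIV)
      show "continuous_on {0..1} g" unfolding g_def dpsi_b_def by (intro continuous_intros)
      show "- s * psi_b_ext (- (2^j) * 0 + 2^j) = 0" using M4 by (simp add: psi_b_ext_def phi_0 phi_b_ext_0)
      show "- s * psi_b_ext (- (2^j) * 1 + 2^j) = 0" by (simp add: psi_b_ext_def phi_0 phi_b_ext_0)
    qed
    moreover have "pw_linear (Suc j) (\<lambda>m. s * 2^j * two_scale M (\<lambda>_. 0) (\<lambda>l. if l = i then 1 else 0) m) g"
    proof -
      have node: "two_scale M (\<lambda>_. 0) (\<lambda>l. if l = i then 1 else 0) m = phi_node (int (2 * M - m)) - phi_b_node (2 * M - m)"
        if "m \<le> 2 * M" for m
      proof (cases "even m")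
        case True
        then obtain k where k: "m = 2 * k" by blast
        show ?thesis using that M(1) 2 unfolding k two_scale_even
          by (auto simp: phi_node_def phi_b_node_def)
      next
        case False
        then obtain k where k: "m = Suc (2 * k)" by (auto elim: oddE)
        show ?thesis using that M(1) 2 unfolding k two_scale_odd
          by (auto simp: phi_node_def phi_b_node_def) presburger
      qed
      have "g ((real m + t) / 2 ^ Suc j) = (1 - t) * (s * 2^j * two_scale M (\<lambda>_. 0) (\<lambda>l. if l = i then 1 else 0) m)
          + t * (s * 2^j * two_scale M (\<lambda>_. 0) (\<lambda>l. if l = i then 1 else 0) (Suc m))"
        if m: "m < 2 ^ Suc j" and t: "t \<in> {0..1}" for m t
      proof -
        have m': "m < 2 * M" using m by (simp add: M_def)
        define m1 where "m1 = 2 * M - Suc m"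
        have m1: "2 * M - m = Suc m1" "real m1 = 2 * 2^j - real m - 1"
          using m' M(3) by (auto simp: m1_def of_nat_diff)
        have arg: "- (2^j) * ((real m + t) / 2 ^ Suc j) + 2^j = (real m1 + (1 - t)) / 2"
          by (simp add: m1 field_simps)
        have t': "1 - t \<in> {0..1}" using t by auto
        have v: "two_scale M (\<lambda>_. 0) (\<lambda>l. if l = i then 1 else 0) m = phi_node (int m1 + 1) - phi_b_node (Suc m1)"
          "two_scale M (\<lambda>_. 0) (\<lambda>l. if l = i then 1 else 0) (Suc m) = phi_node (int m1) - phi_b_node m1"
          using node[of m] node[of "Suc m"] m' m1(1) unfolding m1_def[symmetric] by (simp_all add: add.commute)
        show ?thesis
          unfolding g_def arg dpsi_b_cell[OF t'] v by (simp add: algebra_simps)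
      qed
      then show ?thesis by (simp add: pw_linear_def)
    qed
    ultimately show ?thesis using that unfolding s_def M_def by blast
  next
    case 3
    \<comment> \<open>With k = i + 1 the shift -k + 2 becomes 1 - i.\<close>
    define b where "b = 1 - real i"
    define g where "g = (\<lambda>x. s * (2^j * dpsi (2^j * x + b)))"
    have i3: "int i + 1 \<noteq> 1" "int i + 1 \<noteq> 2^j" using 3 M(4) by linarith+
    have "primitive01 (psi_jk j (int i + 1)) g"
    proof (rule primitive01I_DERIV)
      show "psi_jk j (int i + 1) x = s * psi (2^j * x + b)" for x
        using i3 by (simp add: psi_jk_def s_def b_def algebra_simps)
      show "((\<lambda>x. s * psi (2^j * x + b)) has_real_derivative g x) (at x)" for x
        unfolding g_def by (intro DERIV_cmult psi_affine_DERIV)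
      show "continuous_on {0..1} g" unfolding g_def dpsi_def by (intro continuous_intros)
      show "s * psi (2^j * 0 + b) = 0" using 3 by (simp add: psi_def phi_0 b_def)
      have "real i + 2 \<le> 2^j" using 3 M(3) by linarith
      then show "s * psi (2^j * 1 + b) = 0" by (simp add: psi_def phi_0 b_def)
    qed
    moreover have "pw_linear (Suc j) (\<lambda>m. s * 2^j * two_scale M (\<lambda>_. 0) (\<lambda>l. if l = i then 1 else 0) m) g"
    proof -
      have node: "two_scale M (\<lambda>_. 0) (\<lambda>l. if l = i then 1 else 0) m = phi_node (int m - 2 * int i) - phi_node (int m - 2 * int i + 1)" for m
      proof (cases "even m")
        case True
        then obtain k where k: "m = 2 * k" by blast
        show ?thesis using 3 unfolding k two_scale_even
          by (auto simp: phi_node_def)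
      next
        case False
        then obtain k where k: "m = Suc (2 * k)" by (auto elim: oddE)
        show ?thesis using 3 unfolding k two_scale_odd
          by (auto simp: phi_node_def)
      qed
      have "g ((real m + t) / 2 ^ Suc j) = (1 - t) * (s * 2^j * two_scale M (\<lambda>_. 0) (\<lambda>l. if l = i then 1 else 0) m)
          + t * (s * 2^j * two_scale M (\<lambda>_. 0) (\<lambda>l. if l = i then 1 else 0) (Suc m))"
        if t: "t \<in> {0..1}" for m t
      proof -
        have arg: "2^j * ((real m + t) / 2 ^ Suc j) + b = (of_int (int m - 2 * int i + 2) + t) / 2"
          by (simp add: b_def field_simps)
        show ?thesis
          unfolding g_def arg dpsi_cell[OF t] node by (simp add: algebra_simps)
      qed
      then show ?thesis by (simp add: pw_linear_def)
    qed
    ultimately show ?thesis using that unfolding s_def M_def by blast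
  qed
qed

text \<open>Nodal values of the derivative of the coarse function with k = i + 1, up to the factor 8
  = 2^(j/2) * 2^j for j = 2. The minus sign comes from the reflection; truncated subtraction does no
  harm for the nodes m \<le> 4.\<close>

definition coarse_node :: "nat \<Rightarrow> nat \<Rightarrow> real" where
  "coarse_node i m = (if i = 0 then phi_b_node m else if i = 3 then - phi_b_node (4 - m)
     else phi_node (int m - int i + 1))"

lemma phi_jk_primitive01:
  assumes i: "i < 4"
  obtains g where "primitive01 (phi_jk 2 (int i + 1)) g" "pw_linear 2 (\<lambda>m. 8 * coarse_node i m) g"
proof -
  have s: "2 powr (real 2 / 2) = (2::real)" by simp
  consider "i = 0" | "i = 3" | "0 < i" "i < 3" using i by linarith
  then show ?thesis
  proof cases
    case 1
    define g where "g = (\<lambda>x. 2 * (4 * dphi_b (4 * x + 0)))"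
    have "primitive01 (phi_jk 2 (int i + 1)) g"
    proof (rule primitive01I_DERIV)
      show "phi_jk 2 (int i + 1) x = 2 * phi_b_ext (4 * x + 0)" if "x \<in> {0..1}" for x
        using that 1 by (simp add: phi_jk_def phi_b_eq)
      show "((\<lambda>x. 2 * phi_b_ext (4 * x + 0)) has_real_derivative g x) (at x)" for x
        unfolding g_def by (intro DERIV_cmult phi_b_ext_affine_DERIV)
      show "continuous_on {0..1} g" unfolding g_def by (intro continuous_intros)
    qed (simp_all add: phi_b_ext_0)
    moreover have "g ((real m + t) / 2^2) = (1 - t) * (8 * coarse_node i m) + t * (8 * coarse_node i (Suc m))"
      if "t \<in> {0..1}" for m t
    proof -
      have arg: "4 * ((real m + t) / 2^2) + 0 = real m + t" by simp
      show ?thesis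
        using 1 unfolding g_def arg dphi_b_cell[OF that] coarse_node_def by (simp add: algebra_simps)
    qed
    then have "pw_linear 2 (\<lambda>m. 8 * coarse_node i m) g" by (simp add: pw_linear_def)
    ultimately show ?thesis by (rule that)
  next
    case 2
    define g where "g = (\<lambda>x. 2 * (-4 * dphi_b (-4 * x + 4)))"
    have "primitive01 (phi_jk 2 (int i + 1)) g"
    proof (rule primitive01I_DERIV)
      show "phi_jk 2 (int i + 1) x = 2 * phi_b_ext (-4 * x + 4)" if "x \<in> {0..1}" for x
        using that 2 by (simp add: phi_jk_def phi_b_eq algebra_simps)
      show "((\<lambda>x. 2 * phi_b_ext (-4 * x + 4)) has_real_derivative g x) (at x)" for x
        unfolding g_def by (intro DERIV_cmult phi_b_ext_affine_DERIV)
      show "continuous_on {0..1} g" unfolding g_def by (intro continuous_intros)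
    qed (simp_all add: phi_b_ext_0)
    moreover have "g ((real m + t) / 2^2) = (1 - t) * (8 * coarse_node i m) + t * (8 * coarse_node i (Suc m))"
      if "m < 2^2" "t \<in> {0..1}" for m t
    proof -
      have m1: "4 - m = Suc (3 - m)" "4 - Suc m = 3 - m" "real (3 - m) = 3 - real m" using that by auto
      have arg: "-4 * ((real m + t) / 2^2) + 4 = real (3 - m) + (1 - t)"
        by (simp add: m1 field_simps)
      have t': "1 - t \<in> {0..1}" using that by auto
      show ?thesis
        using 2 unfolding g_def arg dphi_b_cell[OF t'] coarse_node_def m1(1,2) by (simp add: algebra_simps)
    qed
    then have "pw_linear 2 (\<lambda>m. 8 * coarse_node i m) g" by (simp add: pw_linear_def)
    ultimately show ?thesis by (rule that)
  next
    case 3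
    define b where "b = 1 - real i"
    define g where "g = (\<lambda>x. 2 * (4 * dphi (4 * x + b)))"
    have "primitive01 (phi_jk 2 (int i + 1)) g"
    proof (rule primitive01I_DERIV)
      show "phi_jk 2 (int i + 1) x = 2 * phi (4 * x + b)" for x
        using 3 by (simp add: phi_jk_def b_def algebra_simps)
      show "((\<lambda>x. 2 * phi (4 * x + b)) has_real_derivative g x) (at x)" for x
        unfolding g_def by (intro DERIV_cmult phi_affine_DERIV)
      show "continuous_on {0..1} g" unfolding g_def by (intro continuous_intros)
    qed (use 3 in \<open>simp_all add: phi_0 b_def\<close>)
    moreover have "g ((real m + t) / 2^2) = (1 - t) * (8 * coarse_node i m) + t * (8 * coarse_node i (Suc m))"
      if "t \<in> {0..1}" for m t
    proof -
      have arg: "4 * ((real m + t) / 2^2) + b = of_int (int m - int i + 1) + t"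
        by (simp add: b_def)
      show ?thesis
        using 3 unfolding g_def arg dphi_cell[OF that] coarse_node_def by (simp add: algebra_simps)
    qed
    then have "pw_linear 2 (\<lambda>m. 8 * coarse_node i m) g" by (simp add: pw_linear_def)
    ultimately show ?thesis by (rule that)
  qed
qed

section \<open>Norm equivalence for finite sums\<close>

definition basis_index :: "(int + nat \<times> int) set" where
  "basis_index = wavelet_index 2 <+> (SIGMA j:{2..}. wavelet_index j)"

definition basis_fun :: "int + nat \<times> int \<Rightarrow> real \<Rightarrow> real" where
  "basis_fun = case_sum
      (\<lambda>k x. phi_jk 2 k x / H1_seminorm (phi_jk 2 k))
      (\<lambda>(j, k) x. psi_jk j k x / H1_seminorm (psi_jk j k))"

text \<open>Derivatives of wavelets of level j live on 2^(j+1) cells, so the levels below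
  \<open>N\<close> are those that fit the grid of 2^N cells.\<close>

definition level_index :: "nat \<Rightarrow> (int + nat \<times> int) set" where
  "level_index N = wavelet_index 2 <+> (SIGMA j:{2..<N}. wavelet_index j)"

lemma wavelet_index_eq: "wavelet_index j = (\<lambda>i. int i + 1) ` {..<2^j}"
proof (intro equalityI subsetI)
  fix k assume "k \<in> wavelet_index j"
  then have k: "1 \<le> k" "k \<le> 2^j" by (auto simp: wavelet_index_def)
  then have "nat (k - 1) < 2^j" by (simp add: nat_less_iff)
  then show "k \<in> (\<lambda>i. int i + 1) ` {..<2^j}"
    using k by (intro image_eqI[of _ _ "nat (k - 1)"]) auto
next
  fix k assume "k \<in> (\<lambda>i. int i + 1) ` {..<2^j}"
  then obtain i where i: "k = int i + 1" "i < 2^j" by auto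
  then have "int (Suc i) \<le> int (2^j)" by (simp only: zle_int Suc_le_eq)
  then show "k \<in> wavelet_index j" using i by (simp add: wavelet_index_def)
qed

lemma finite_wavelet_index: "finite (wavelet_index j)"
  by (simp add: wavelet_index_eq)

lemma finite_level_index: "finite (level_index N)"
  by (simp add: level_index_def finite_wavelet_index)

lemma sum_level_index_2:
  "(\<Sum>i\<in>level_index 2. f i) = (\<Sum>i<4. f (Inl (int i + 1)))" for f :: "_ \<Rightarrow> real"
proof -
  have "level_index 2 = (\<lambda>i. Inl (int i + 1)) ` {..<4}"
    by (auto simp: level_index_def wavelet_index_eq Plus_def image_image)
  then show ?thesis by (simp add: sum.reindex inj_on_def)
qed

lemma sum_level_index_Suc:
  fixes f :: "_ \<Rightarrow> real"
  assumes "2 \<le> N"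
  shows "(\<Sum>i\<in>level_index (Suc N). f i) = (\<Sum>i\<in>level_index N. f i) + (\<Sum>i<2^N. f (Inr (N, int i + 1)))"
proof -
  have "level_index (Suc N) = level_index N \<union> (\<lambda>i. Inr (N, int i + 1)) ` {..<2^N}"
    using assms by (auto simp: level_index_def wavelet_index_eq less_Suc_eq)
  moreover have "level_index N \<inter> (\<lambda>i. Inr (N, int i + 1)) ` {..<2^N} = {}"
    by (auto simp: level_index_def)
  ultimately show ?thesis
    by (simp add: sum.union_disjoint finite_level_index sum.reindex inj_on_def)
qed

lemma finite_subset_level_index:
  assumes "finite F" "F \<subseteq> basis_index"
  obtains N where "2 \<le> N" "F \<subseteq> level_index N"
proof -
  define N where "N = Suc (Suc (Max (insert 0 ((\<lambda>i. case i of Inl _ \<Rightarrow> 0 | Inr (j, k) \<Rightarrow> j) ` F))))"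
  have "i \<in> level_index N" if i: "i \<in> F" for i
  proof (cases i)
    case (Inl k)
    then show ?thesis using assms(2) i by (auto simp: basis_index_def level_index_def)
  next
    case (Inr p)
    obtain j k where p: "p = (j, k)" by (cases p)
    have "j \<in> insert 0 ((\<lambda>i. case i of Inl _ \<Rightarrow> 0 | Inr (j, k) \<Rightarrow> j) ` F)"
      using i Inr p by (force intro!: image_eqI[of _ _ i])
    then have "j \<le> Max (insert 0 ((\<lambda>i. case i of Inl _ \<Rightarrow> 0 | Inr (j, k) \<Rightarrow> j) ` F))"
      using assms(1) by (intro Max_ge) auto
    then have "j < N" by (simp add: N_def)
    then show ?thesis using assms(2) i Inr p by (auto simp: basis_index_def level_index_def)
  qed
  then show ?thesis by (intro that[of N]) (auto simp: N_def)
qed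

lemma cell_sum_scale:
  "cell_sum mass_form M (\<lambda>m. a * v m) = a^2 * cell_sum mass_form M v"
  by (simp add: cell_sum_def mass_form_def sum_distrib_left power2_eq_square field_simps)

text \<open>The two growth estimates, applied to c = 0 and a single wavelet, bound its mass sum
  \<kappa> between 2/5 and 16, at the boundary and inside alike. Normalisation gives e^2 = 2 * 2^j /
  \<kappa>, hence the factors 1/8 and 5.\<close>

lemma basis_fun_wavelet:
  assumes j: "2 \<le> j" and i: "i < 2^j"
  obtains g e where "primitive01 (basis_fun (Inr (j, int i + 1))) g"
    "pw_linear (Suc j) (\<lambda>m. e * two_scale (2^j) (\<lambda>_. 0) (\<lambda>l. if l = i then 1 else 0) m) g"
    "2^j / 8 \<le> e^2" "e^2 \<le> 5 * 2^j"
proof -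
  define s where "s = 2 powr (real j / 2) * 2^j"
  have s: "s > 0" by (simp add: s_def)
  define \<delta> where "\<delta> = (\<lambda>l. if l = i then 1 else (0::real))"
  define w where "w = two_scale (2^j) (\<lambda>_. 0) \<delta>"
  obtain g where g: "primitive01 (psi_jk j (int i + 1)) g" "pw_linear (Suc j) (\<lambda>m. s * w m) g"
    using psi_jk_primitive01[OF assms] unfolding s_def w_def \<delta>_def by metis
  define n where "n = H1_seminorm (psi_jk j (int i + 1))"
  define \<kappa> where "\<kappa> = cell_sum mass_form (2 * 2^j) w"
  have j2: "(2::nat) \<le> 2^j" using power_increasing[of 1 j "2::nat"] j by simp
  have sq: "(\<Sum>l<2^j. (\<delta> l)^2) = 1"
    using i by (simp add: \<delta>_def if_distrib[of "\<lambda>x. x^2"] cong: if_cong)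
  have zero: "cell_sum lower_form (2^j) (\<lambda>_. 0) = 0" "cell_sum upper_form (2^j) (\<lambda>_. 0) = 0"
    by (simp_all add: cell_sum_def lower_form_def upper_form_def)
  have \<kappa>: "2 / 5 \<le> \<kappa>" "\<kappa> \<le> 16"
    using cell_sum_two_scale_lower[OF j2, of "\<lambda>_. 0" \<delta>] cell_sum_two_scale_upper[OF j2, of "\<lambda>_. 0" \<delta>]
      cell_sum_mass_bounds[of "2 * 2^j" w]
    unfolding sq zero \<kappa>_def w_def by auto
  have n2: "n^2 = s^2 * \<kappa> / (2 * 2^j)"
    using pw_linear_L2_norm[OF g] primitive01_norm(3)[OF g(1)]
    by (simp add: n_def cell_sum_scale \<kappa>_def)
  have "n^2 > 0" unfolding n2 using s \<kappa>(1) by (intro divide_pos_pos mult_pos_pos) auto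
  then have n0: "n \<noteq> 0" by auto
  have e2: "(s / n)^2 = 2 * 2^j / \<kappa>"
    unfolding power_divide n2 using s \<kappa>(1) by (simp add: field_simps)
  show ?thesis
  proof (rule that[of "\<lambda>x. (1 / n) * g x" "s / n"])
    have "basis_fun (Inr (j, int i + 1)) = (\<lambda>x. (1 / n) * psi_jk j (int i + 1) x)"
      by (simp add: basis_fun_def n_def)
    then show "primitive01 (basis_fun (Inr (j, int i + 1))) (\<lambda>x. (1 / n) * g x)"
      by (simp only: primitive01_cmult[OF g(1)])
    show "pw_linear (Suc j) (\<lambda>m. s / n * two_scale (2^j) (\<lambda>_. 0) (\<lambda>l. if l = i then 1 else 0) m) (\<lambda>x. (1 / n) * g x)"
      using pw_linear_cmult[OF g(2), of "1 / n"] by (simp add: w_def \<delta>_def)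
    show "2^j / 8 \<le> (s / n)^2" unfolding e2 using \<kappa> by (simp add: field_simps)
    show "(s / n)^2 \<le> 5 * 2^j" unfolding e2 using \<kappa> by (simp add: field_simps)
  qed
qed

text \<open>A nonzero norm is enough here, since uniform bounds over four functions come for
  free.\<close>

lemma basis_fun_coarse:
  assumes i: "i < 4"
  obtains g e where "primitive01 (basis_fun (Inl (int i + 1))) g"
    "pw_linear 2 (\<lambda>m. e * coarse_node i m) g" "e > 0"
proof -
  obtain g where g: "primitive01 (phi_jk 2 (int i + 1)) g" "pw_linear 2 (\<lambda>m. 8 * coarse_node i m) g"
    using phi_jk_primitive01[OF i] by blast
  define n where "n = H1_seminorm (phi_jk 2 (int i + 1))"
  have n2: "n^2 = 64 * cell_sum mass_form 4 (coarse_node i) / 4"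
    using pw_linear_L2_norm[OF g] primitive01_norm(3)[OF g(1)] by (simp add: n_def cell_sum_scale)
  consider "i = 0" | "i = 1" | "i = 2" | "i = 3" using i by linarith
  then have "cell_sum mass_form 4 (coarse_node i) > 0"
    by cases (simp_all add: cell_sum_def eval_nat_numeral mass_form_def coarse_node_def phi_node_def phi_b_node_def)
  then have n0: "n \<noteq> 0" using n2 by auto
  have "n \<ge> 0" unfolding n_def H1_seminorm_def by (rule L2_norm_nonneg)
  with n0 have n: "n > 0" by simp
  show ?thesis
  proof (rule that[of "\<lambda>x. (1 / n) * g x" "8 / n"])
    have "basis_fun (Inl (int i + 1)) = (\<lambda>x. (1 / n) * phi_jk 2 (int i + 1) x)"
      by (simp add: basis_fun_def n_def)
    then show "primitive01 (basis_fun (Inl (int i + 1))) (\<lambda>x. (1 / n) * g x)"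
      by (simp only: primitive01_cmult[OF g(1)])
    show "pw_linear 2 (\<lambda>m. 8 / n * coarse_node i m) (\<lambda>x. (1 / n) * g x)"
      using pw_linear_cmult[OF g(2), of "1 / n"] by simp
  qed (use n in simp)
qed

lemma basis_fun_primitive01:
  assumes "i \<in> basis_index"
  obtains g where "primitive01 (basis_fun i) g"
proof -
  have "\<exists>g. primitive01 (basis_fun i) g"
  proof (cases i)
    case (Inl k)
    then obtain l where "k = int l + 1" "l < 4"
      using assms by (auto simp: basis_index_def wavelet_index_eq)
    then show ?thesis using basis_fun_coarse[of l] Inl by metis
  next
    case (Inr p)
    obtain j k where p: "p = (j, k)" by (cases p)
    then obtain l where "k = int l + 1" "l < 2^j" "2 \<le> j"
      using assms Inr by (auto simp: basis_index_def wavelet_index_eq)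
    then show ?thesis using basis_fun_wavelet[of j l] Inr p by metis
  qed
  then show ?thesis using that by blast
qed

text \<open>The factors \<open>e\<close> and derivatives \<open>g\<close> are fixed before the
  coefficients \<open>b\<close>, so one choice serves all linear combinations of the level.\<close>

lemma wavelet_level_combination:
  assumes N: "2 \<le> N"
  obtains e g where "\<And>i. i < 2^N \<Longrightarrow> 2^N / 8 \<le> (e i)^2 \<and> (e i)^2 \<le> 5 * 2^N"
    "\<And>b. primitive01 (\<lambda>x. \<Sum>i<2^N. b i * basis_fun (Inr (N, int i + 1)) x) (\<lambda>x. \<Sum>i<2^N. b i * g i x)"
    "\<And>b. pw_linear (Suc N) (two_scale (2^N) (\<lambda>_. 0) (\<lambda>i. b i * e i)) (\<lambda>x. \<Sum>i<2^N. b i * g i x)"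
proof -
  have "\<exists>g e. primitive01 (basis_fun (Inr (N, int i + 1))) g \<and>
    pw_linear (Suc N) (\<lambda>m. e * two_scale (2^N) (\<lambda>_. 0) (\<lambda>l. if l = i then 1 else 0) m) g \<and>
    2^N / 8 \<le> e^2 \<and> e^2 \<le> 5 * 2^N" if "i < 2^N" for i
    using basis_fun_wavelet[OF N that] by metis
  then obtain g e where ge: "\<And>i. i < 2^N \<Longrightarrow> primitive01 (basis_fun (Inr (N, int i + 1))) (g i) \<and>
    pw_linear (Suc N) (\<lambda>m. e i * two_scale (2^N) (\<lambda>_. 0) (\<lambda>l. if l = i then 1 else 0) m) (g i) \<and>
    2^N / 8 \<le> (e i)^2 \<and> (e i)^2 \<le> 5 * 2^N"
    by metis
  show ?thesis
  proof (rule that[of e g])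
    fix b :: "nat \<Rightarrow> real"
    show "primitive01 (\<lambda>x. \<Sum>i<2^N. b i * basis_fun (Inr (N, int i + 1)) x) (\<lambda>x. \<Sum>i<2^N. b i * g i x)"
      using ge by (intro primitive01_sum primitive01_cmult) auto
    have "pw_linear (Suc N) (\<lambda>m. \<Sum>i<2^N. b i * (e i * two_scale (2^N) (\<lambda>_. 0) (\<lambda>l. if l = i then 1 else 0) m))
        (\<lambda>x. \<Sum>i<2^N. b i * g i x)"
      using ge by (intro pw_linear_sum pw_linear_cmult) auto
    then show "pw_linear (Suc N) (two_scale (2^N) (\<lambda>_. 0) (\<lambda>i. b i * e i)) (\<lambda>x. \<Sum>i<2^N. b i * g i x)"
    proof (rule pw_linear_cong)
      fix m :: nat assume "m \<le> 2 ^ Suc N"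
      then show "two_scale (2^N) (\<lambda>_. 0) (\<lambda>i. b i * e i) m
          = (\<Sum>i<2^N. b i * (e i * two_scale (2^N) (\<lambda>_. 0) (\<lambda>l. if l = i then 1 else 0) m))"
        using two_scale_sum_delta[of m "2^N" "\<lambda>i. b i * e i"] by (simp add: mult.assoc)
    qed
  qed (use ge in auto)
qed

definition coarse_nodes :: "(nat \<Rightarrow> real) \<Rightarrow> nat \<Rightarrow> real" where
  "coarse_nodes x m = (\<Sum>i<4. x i * coarse_node i m)"

lemma coarse_nodes_eval:
  "coarse_nodes x 0 = 3 * x 0" "coarse_nodes x 1 = x 1 - 3 / 2 * x 0" "coarse_nodes x 2 = x 2 - x 1"
  "coarse_nodes x 3 = 3 / 2 * x 3 - x 2" "coarse_nodes x 4 = - 3 * x 3"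
  by (simp_all add: coarse_nodes_def eval_nat_numeral coarse_node_def phi_node_def phi_b_node_def)

lemma coarse_combination:
  obtains e g where "\<And>i. i < 4 \<Longrightarrow> 0 < (e i :: real)"
    "\<And>b. primitive01 (\<lambda>x. \<Sum>i<4. b i * basis_fun (Inl (int i + 1)) x) (\<lambda>x. \<Sum>i<4. b i * g i x)"
    "\<And>b. pw_linear 2 (coarse_nodes (\<lambda>i. b i * e i)) (\<lambda>x. \<Sum>i<4. b i * g i x)"
proof -
  have "\<exists>g e. primitive01 (basis_fun (Inl (int i + 1))) g \<and>
    pw_linear 2 (\<lambda>m. e * coarse_node i m) g \<and> e > 0" if "i < 4" for i
    using basis_fun_coarse[OF that] by metis
  then obtain g e where ge: "\<And>i. i < 4 \<Longrightarrow> primitive01 (basis_fun (Inl (int i + 1))) (g i) \<and>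
    pw_linear 2 (\<lambda>m. e i * coarse_node i m) (g i) \<and> e i > 0"
    by metis
  show ?thesis
  proof (rule that[of e g])
    fix b :: "nat \<Rightarrow> real"
    show "primitive01 (\<lambda>x. \<Sum>i<4. b i * basis_fun (Inl (int i + 1)) x) (\<lambda>x. \<Sum>i<4. b i * g i x)"
      using ge by (intro primitive01_sum primitive01_cmult) auto
    have "pw_linear 2 (\<lambda>m. \<Sum>i<4. b i * (e i * coarse_node i m)) (\<lambda>x. \<Sum>i<4. b i * g i x)"
      using ge by (intro pw_linear_sum pw_linear_cmult) auto
    then show "pw_linear 2 (coarse_nodes (\<lambda>i. b i * e i)) (\<lambda>x. \<Sum>i<4. b i * g i x)"
      by (rule pw_linear_cong) (simp add: coarse_nodes_def mult.assoc)
  qed (use ge in auto)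
qed

section \<open>Bounds on the coarsest level\<close>

lemma sum_lessThan_4: "(\<Sum>i<4. f i) = f 0 + f 1 + f 2 + f 3" for f :: "nat \<Rightarrow> real"
  by (simp add: eval_nat_numeral)

lemma cell_sum_4:
  "cell_sum q 4 v = q (v 0) (v 1) + q (v 1) (v 2) + q (v 2) (v 3) + q (v 3) (v 4)"
  by (simp add: cell_sum_def sum_lessThan_4 eval_nat_numeral)

lemma cell_sum_coarse_lower:
  "(\<Sum>i<4. (x i)^2) / 10 \<le> cell_sum lower_form 4 (coarse_nodes x)"
proof -
  let ?v = "coarse_nodes x"
  have q: "(a^2 + b^2) / 10 \<le> lower_form a b" for a b
    using zero_le_power2[of "a + b"] by (simp add: lower_form_def power2_eq_square field_simps)
  \<comment> \<open>Recovers an inner coefficient from the nodal value c - 3/2 a next to the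
    boundary; the price 9/2 a^2 is covered by the square 9 a^2 of the endpoint value 3 a.\<close>
  have y: "c^2 \<le> 2 * (c - 3 / 2 * a)^2 + 9 / 2 * a^2" for a c :: real
  proof -
    have "2 * (c - 3 / 2 * a)^2 + 9 / 2 * a^2 - c^2 = (c - 3 * a)^2"
      by (simp add: power2_eq_square algebra_simps)
    then show ?thesis using zero_le_power2[of "c - 3 * a"] by linarith
  qed
  have "((?v 0)^2 + 2 * (?v 1)^2 + 2 * (?v 2)^2 + 2 * (?v 3)^2 + (?v 4)^2) / 10 \<le> cell_sum lower_form 4 ?v"
    using q[of "?v 0" "?v 1"] q[of "?v 1" "?v 2"] q[of "?v 2" "?v 3"] q[of "?v 3" "?v 4"]
    unfolding cell_sum_4 by argo
  moreover have "(\<Sum>i<4. (x i)^2) \<le> (?v 0)^2 + 2 * (?v 1)^2 + 2 * (?v 2)^2 + 2 * (?v 3)^2 + (?v 4)^2"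
  proof -
    have sq: "(3 * x 0)^2 = 9 * (x 0)^2" "(- 3 * x 3)^2 = 9 * (x 3)^2" by (simp_all add: power_mult_distrib)
    show ?thesis
      using y[of "x 1" "x 0"] y[of "x 2" "x 3"] zero_le_power2[of "x 2 - x 1"] zero_le_power2[of "x 0"] zero_le_power2[of "x 3"]
      unfolding sum_lessThan_4 coarse_nodes_eval sq power2_commute[of "3 / 2 * x 3" "x 2"] by linarith
  qed
  ultimately show ?thesis by argo
qed

lemma cell_sum_coarse_upper:
  "cell_sum upper_form 4 (coarse_nodes x) \<le> 20 * (\<Sum>i<4. (x i)^2)"
proof -
  let ?v = "coarse_nodes x"
  have y: "(c - a)^2 \<le> 2 * c^2 + 2 * a^2" for a c :: real
    using zero_le_power2[of "c + a"] by (simp add: power2_eq_square algebra_simps)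
  have "cell_sum upper_form 4 ?v = ((?v 0)^2 + 2 * (?v 1)^2 + 2 * (?v 2)^2 + 2 * (?v 3)^2 + (?v 4)^2) / 2"
    unfolding cell_sum_4 upper_form_def by argo
  also have "\<dots> \<le> 20 * (\<Sum>i<4. (x i)^2)"
  proof -
    have sq: "(3 * x 0)^2 = 9 * (x 0)^2" "(- 3 * x 3)^2 = 9 * (x 3)^2"
      "(3 / 2 * x 0)^2 = 9 / 4 * (x 0)^2" "(3 / 2 * x 3)^2 = 9 / 4 * (x 3)^2"
      by (simp_all add: power_mult_distrib power_divide)
    show ?thesis
      using y[of "x 1" "3 / 2 * x 0"] y[of "x 2" "x 1"] y[of "3 / 2 * x 3" "x 2"]
        zero_le_power2[of "x 0"] zero_le_power2[of "x 1"] zero_le_power2[of "x 2"] zero_le_power2[of "x 3"]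
      unfolding sum_lessThan_4 coarse_nodes_eval sq by argo
  qed
  finally show ?thesis .
qed

text \<open>The induction carries the two auxiliary forms, as the L^2 norm does not satisfy the
  step. The factor 2 of the two-scale estimates cancels against the halved cell width, so the
  constants stay the same from level to level.\<close>

lemma level_bounds:
  obtains A B where "0 < A" "0 < B"
    "\<And>N b. 2 \<le> N \<Longrightarrow> \<exists>g v. primitive01 (\<lambda>x. \<Sum>i\<in>level_index N. b i * basis_fun i x) g \<and> pw_linear N v g \<and>
       cell_sum upper_form (2^N) v / 2^N \<le> B * (\<Sum>i\<in>level_index N. (b i)^2) \<and>
       A * (\<Sum>i\<in>level_index N. (b i)^2) \<le> cell_sum lower_form (2^N) v / 2^N"
proof -
  obtain e g0 where e: "\<And>i. i < 4 \<Longrightarrow> 0 < (e i :: real)"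
    and p0: "\<And>b. primitive01 (\<lambda>x. \<Sum>i<4. b i * basis_fun (Inl (int i + 1)) x) (\<lambda>x. \<Sum>i<4. b i * g0 i x)"
    and l0: "\<And>b. pw_linear 2 (coarse_nodes (\<lambda>i. b i * e i)) (\<lambda>x. \<Sum>i<4. b i * g0 i x)"
    using coarse_combination by blast
  define lo hi where "lo = Min ((\<lambda>i. (e i)^2) ` {..<4})" and "hi = Max ((\<lambda>i. (e i)^2) ` {..<4})"
  have lohi: "lo \<le> (e i)^2" "(e i)^2 \<le> hi" if "i < 4" for i
    using that by (auto simp: lo_def hi_def)
  have lo: "0 < lo"
  proof -
    have "lo \<in> (\<lambda>i. (e i)^2) ` {..<4}" unfolding lo_def by (intro Min_in) (auto simp: lessThan_empty_iff)
    then obtain i where "i < 4" "lo = (e i)^2" by auto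
    then show ?thesis using e[of i] by simp
  qed
  \<comment> \<open>Divided by 4 cells, the coarse constants 20 and 1/10 become 5 and 1/40; a
    wavelet step contributes 16 * 5 / 2 = 40 and 2/5 * 1/8 / 2 = 1/40.\<close>
  define A B where "A = min (lo / 40) (1 / 40)" and "B = max (5 * hi) 40"
  have A: "0 < A" "A \<le> lo / 40" "A \<le> 1 / 40" using lo by (auto simp: A_def)
  have B: "0 < B" "5 * hi \<le> B" "40 \<le> B" by (auto simp: B_def)
  have "\<exists>g v. primitive01 (\<lambda>x. \<Sum>i\<in>level_index N. b i * basis_fun i x) g \<and> pw_linear N v g \<and>
       cell_sum upper_form (2^N) v / 2^N \<le> B * (\<Sum>i\<in>level_index N. (b i)^2) \<and>
       A * (\<Sum>i\<in>level_index N. (b i)^2) \<le> cell_sum lower_form (2^N) v / 2^N" if "2 \<le> N" for N and b :: "_ \<Rightarrow> real"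
    using that
  proof (induction N rule: dec_induct)
    case base
    define c where "c = (\<lambda>i. b (Inl (int i + 1)))"
    let ?v = "coarse_nodes (\<lambda>i. c i * e i)"
    have "cell_sum upper_form 4 ?v / 4 \<le> 5 * (\<Sum>i<4. (c i * e i)^2)"
      using cell_sum_coarse_upper[of "\<lambda>i. c i * e i"] by simp
    also have "\<dots> \<le> 5 * (\<Sum>i<4. (c i)^2 * hi)"
      using lohi(2) by (intro mult_left_mono sum_mono) (auto simp: power_mult_distrib intro!: mult_left_mono)
    also have "\<dots> = 5 * hi * (\<Sum>i<4. (c i)^2)" by (simp add: sum_distrib_right[symmetric])
    also have "\<dots> \<le> B * (\<Sum>i<4. (c i)^2)" using B(2) by (intro mult_right_mono sum_nonneg) auto
    finally have U: "cell_sum upper_form (2^2) ?v / 2^2 \<le> B * (\<Sum>i<4. (c i)^2)" by simp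
    have "A * (\<Sum>i<4. (c i)^2) \<le> lo / 40 * (\<Sum>i<4. (c i)^2)"
      using A(2) by (intro mult_right_mono sum_nonneg) auto
    also have "\<dots> = (\<Sum>i<4. (c i)^2 * lo) / 40" by (simp add: sum_distrib_right[symmetric])
    also have "\<dots> \<le> (\<Sum>i<4. (c i * e i)^2) / 40"
      using lohi(1) by (intro divide_right_mono sum_mono) (auto simp: power_mult_distrib intro!: mult_left_mono)
    also have "\<dots> \<le> cell_sum lower_form (2^2) ?v / 2^2"
      using cell_sum_coarse_lower[of "\<lambda>i. c i * e i"] by simp
    finally have L: "A * (\<Sum>i<4. (c i)^2) \<le> cell_sum lower_form (2^2) ?v / 2^2" .
    show ?case
      unfolding sum_level_index_2 using p0[of c] l0[of c] U L unfolding c_def by blast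
  next
    case (step N)
    then obtain g v where IH: "primitive01 (\<lambda>x. \<Sum>i\<in>level_index N. b i * basis_fun i x) g" "pw_linear N v g"
       "cell_sum upper_form (2^N) v / 2^N \<le> B * (\<Sum>i\<in>level_index N. (b i)^2)"
       "A * (\<Sum>i\<in>level_index N. (b i)^2) \<le> cell_sum lower_form (2^N) v / 2^N" by blast
    obtain e' h where e': "\<And>i. i < 2^N \<Longrightarrow> 2^N / 8 \<le> (e' i)^2 \<and> (e' i)^2 \<le> 5 * 2^N"
      and ph: "\<And>b. primitive01 (\<lambda>x. \<Sum>i<2^N. b i * basis_fun (Inr (N, int i + 1)) x) (\<lambda>x. \<Sum>i<2^N. b i * h i x)"
      and lh: "\<And>b. pw_linear (Suc N) (two_scale (2^N) (\<lambda>_. 0) (\<lambda>i. b i * e' i)) (\<lambda>x. \<Sum>i<2^N. b i * h i x)"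
      using wavelet_level_combination[OF step.hyps(1)] by blast
    define c where "c = (\<lambda>i. b (Inr (N, int i + 1)))"
    define d where "d = (\<lambda>i. c i * e' i)"
    define v' where "v' = two_scale (2^N) v d"
    define S where "S = (\<Sum>i<2^N. (c i)^2)"
    have N2: "(2::nat) \<le> 2^N" using power_increasing[of 1 N "2::nat"] step.hyps(1) by simp
    have "primitive01 (\<lambda>x. 1 * (\<Sum>i\<in>level_index N. b i * basis_fun i x) + 1 * (\<Sum>i<2^N. c i * basis_fun (Inr (N, int i + 1)) x))
      (\<lambda>x. 1 * g x + 1 * (\<Sum>i<2^N. c i * h i x))"
      by (rule primitive01_lincomb[OF IH(1) ph])
    then have 1: "primitive01 (\<lambda>x. \<Sum>i\<in>level_index (Suc N). b i * basis_fun i x) (\<lambda>x. g x + (\<Sum>i<2^N. c i * h i x))"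
      by (simp add: sum_level_index_Suc[OF step.hyps(1)] c_def)
    have "pw_linear (Suc N) (\<lambda>m. 1 * two_scale (2^N) v (\<lambda>_. 0) m + 1 * two_scale (2^N) (\<lambda>_. 0) d m)
      (\<lambda>x. 1 * g x + 1 * (\<Sum>i<2^N. c i * h i x))"
      unfolding d_def by (intro pw_linear_lincomb lh) (simp add: pw_linear_refine IH(2))
    then have 2: "pw_linear (Suc N) v' (\<lambda>x. g x + (\<Sum>i<2^N. c i * h i x))"
      by (simp add: two_scale_add v'_def)
    have d_hi: "(\<Sum>i<2^N. (d i)^2) \<le> 5 * 2^N * S"
    proof -
      have "(\<Sum>i<2^N. (d i)^2) \<le> (\<Sum>i<2^N. (c i)^2 * (5 * 2^N))"
        unfolding d_def power_mult_distrib using e' by (intro sum_mono mult_left_mono) auto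
      then show ?thesis by (simp add: S_def sum_distrib_right[symmetric] mult.commute)
    qed
    have d_lo: "2^N / 8 * S \<le> (\<Sum>i<2^N. (d i)^2)"
    proof -
      have "(\<Sum>i<2^N. (c i)^2 * (2^N / 8)) \<le> (\<Sum>i<2^N. (d i)^2)"
        unfolding d_def power_mult_distrib using e' by (intro sum_mono mult_left_mono) auto
      then show ?thesis unfolding S_def sum_distrib_right[symmetric] by (simp only: mult.commute)
    qed
    have S0: "0 \<le> S" by (simp add: S_def sum_nonneg)
    have "cell_sum upper_form (2 * 2^N) v' \<le> 2 * cell_sum upper_form (2^N) v + 16 * (5 * 2^N * S)"
      using cell_sum_two_scale_upper[OF N2, of v d] d_hi by (simp add: v'_def)
    then have "cell_sum upper_form (2 ^ Suc N) v' / 2 ^ Suc N \<le> cell_sum upper_form (2^N) v / 2^N + 40 * S"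
      by (simp add: field_simps)
    also have "\<dots> \<le> B * (\<Sum>i\<in>level_index N. (b i)^2) + B * S"
      using IH(3) B(3) S0 by (intro add_mono mult_right_mono)
    also have "\<dots> = B * (\<Sum>i\<in>level_index (Suc N). (b i)^2)"
      by (simp add: sum_level_index_Suc[OF step.hyps(1)] S_def c_def distrib_left)
    finally have 3: "cell_sum upper_form (2 ^ Suc N) v' / 2 ^ Suc N \<le> B * (\<Sum>i\<in>level_index (Suc N). (b i)^2)" .
    have "A * (\<Sum>i\<in>level_index (Suc N). (b i)^2) = A * (\<Sum>i\<in>level_index N. (b i)^2) + A * S"
      by (simp add: sum_level_index_Suc[OF step.hyps(1)] S_def c_def distrib_left)
    also have "\<dots> \<le> cell_sum lower_form (2^N) v / 2^N + 1 / 40 * S"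
      using IH(4) A(3) S0 by (intro add_mono mult_right_mono)
    also have "\<dots> = (2 * cell_sum lower_form (2^N) v + 2 / 5 * (2^N / 8 * S)) / 2 ^ Suc N"
      by (simp add: field_simps)
    also have "\<dots> \<le> cell_sum lower_form (2 * 2^N) v' / 2 ^ Suc N"
    proof (rule divide_right_mono)
      have "2 / 5 * (2^N / 8 * S) \<le> 2 / 5 * (\<Sum>i<2^N. (d i)^2)"
        using d_lo by (intro mult_left_mono) auto
      then show "2 * cell_sum lower_form (2^N) v + 2 / 5 * (2^N / 8 * S) \<le> cell_sum lower_form (2 * 2^N) v'"
        using cell_sum_two_scale_lower[OF N2, of v d] unfolding v'_def by argo
    qed simp
    finally have 4: "A * (\<Sum>i\<in>level_index (Suc N). (b i)^2) \<le> cell_sum lower_form (2 ^ Suc N) v' / 2 ^ Suc N" by simp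
    show ?case using 1 2 3 4 by blast
  qed
  then show ?thesis using that A(1) B(1) by blast
qed

lemma finite_sum_bounds:
  obtains A B where "0 < A" "0 < B"
    "\<And>F b. finite F \<Longrightarrow> F \<subseteq> basis_index \<Longrightarrow>
       A * sqrt (\<Sum>i\<in>F. (b i)^2) \<le> H1_norm (\<lambda>x. \<Sum>i\<in>F. b i * basis_fun i x) \<and>
       H1_norm (\<lambda>x. \<Sum>i\<in>F. b i * basis_fun i x) \<le> B * sqrt (\<Sum>i\<in>F. (b i)^2)"
proof -
  obtain A B where AB: "0 < A" "0 < B"
    and bnd: "\<And>N b. 2 \<le> N \<Longrightarrow> \<exists>g v. primitive01 (\<lambda>x. \<Sum>i\<in>level_index N. b i * basis_fun i x) g \<and> pw_linear N v g \<and>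
       cell_sum upper_form (2^N) v / 2^N \<le> B * (\<Sum>i\<in>level_index N. (b i)^2) \<and>
       A * (\<Sum>i\<in>level_index N. (b i)^2) \<le> cell_sum lower_form (2^N) v / 2^N"
    using level_bounds by blast
  show ?thesis
  proof (rule that[of "sqrt A" "2 * sqrt B"])
    fix F and b :: "_ \<Rightarrow> real" assume F: "finite F" "F \<subseteq> basis_index"
    obtain N where N: "2 \<le> N" "F \<subseteq> level_index N" using finite_subset_level_index[OF F] by blast
    \<comment> \<open>Zero coefficients fill \<open>F\<close> up to a full set of levels without
      changing either sum.\<close>
    define c where "c = (\<lambda>i. if i \<in> F then b i else 0)"
    have c: "(\<Sum>i\<in>level_index N. c i * f i) = (\<Sum>i\<in>F. b i * f i)" for f
      using N(2) by (intro sum.mono_neutral_cong_right finite_level_index) (auto simp: c_def)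
    have c2: "(\<Sum>i\<in>level_index N. (c i)^2) = (\<Sum>i\<in>F. (b i)^2)"
      using N(2) by (intro sum.mono_neutral_cong_right finite_level_index) (auto simp: c_def)
    obtain g v where g: "primitive01 (\<lambda>x. \<Sum>i\<in>F. b i * basis_fun i x) g" "pw_linear N v g"
       "cell_sum upper_form (2^N) v / 2^N \<le> B * (\<Sum>i\<in>F. (b i)^2)"
       "A * (\<Sum>i\<in>F. (b i)^2) \<le> cell_sum lower_form (2^N) v / 2^N"
      using bnd[OF N(1), of c] unfolding c c2 by blast
    have "A * (\<Sum>i\<in>F. (b i)^2) \<le> (L2_norm g)^2"
      unfolding pw_linear_L2_norm[OF g(1,2)]
      by (rule order_trans[OF g(4) divide_right_mono[OF cell_sum_mass_bounds(1)]]) simp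
    moreover have "(L2_norm g)^2 \<le> B * (\<Sum>i\<in>F. (b i)^2)"
      unfolding pw_linear_L2_norm[OF g(1,2)]
      by (rule order_trans[OF divide_right_mono[OF cell_sum_mass_bounds(2)] g(3)]) simp
    ultimately have "sqrt A * sqrt (\<Sum>i\<in>F. (b i)^2) \<le> L2_norm g" "L2_norm g \<le> sqrt B * sqrt (\<Sum>i\<in>F. (b i)^2)"
      using real_sqrt_le_mono[of _ "(L2_norm g)^2"] real_sqrt_le_mono[of "(L2_norm g)^2"] L2_norm_nonneg[of g]
      by (simp_all add: real_sqrt_mult[symmetric])
    then show "sqrt A * sqrt (\<Sum>i\<in>F. (b i)^2) \<le> H1_norm (\<lambda>x. \<Sum>i\<in>F. b i * basis_fun i x) \<and>
       H1_norm (\<lambda>x. \<Sum>i\<in>F. b i * basis_fun i x) \<le> 2 * sqrt B * sqrt (\<Sum>i\<in>F. (b i)^2)"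
      using primitive01_norm(1,2)[OF g(1)] by auto
  qed (use AB in auto)
qed

section \<open>Density of the span\<close>

lemma lin_span_cmult_mem:
  assumes "i \<in> J"
  shows "(\<lambda>x. a * f i x) \<in> lin_span J f"
  unfolding lin_span_def using assms by (auto intro!: exI[of _ "\<lambda>_. a"] exI[of _ "{i}"])

lemma lin_span_add:
  assumes "u \<in> lin_span J f" "v \<in> lin_span J f"
  shows "(\<lambda>x. u x + v x) \<in> lin_span J f"
proof -
  obtain a F where u: "u = (\<lambda>x. \<Sum>i\<in>F. a i * f i x)" "finite F" "F \<subseteq> J"
    using assms(1) by (auto simp: lin_span_def)
  obtain b G where v: "v = (\<lambda>x. \<Sum>i\<in>G. b i * f i x)" "finite G" "G \<subseteq> J"
    using assms(2) by (auto simp: lin_span_def)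
  define c where "c = (\<lambda>i. (if i \<in> F then a i else 0) + (if i \<in> G then b i else 0))"
  have "(\<Sum>i\<in>F \<union> G. c i * f i x) = u x + v x" for x
  proof -
    have "(\<Sum>i\<in>F \<union> G. (if i \<in> F then a i else 0) * f i x) = u x"
      unfolding u(1) using u(2) v(2) by (intro sum.mono_neutral_cong_right) auto
    moreover have "(\<Sum>i\<in>F \<union> G. (if i \<in> G then b i else 0) * f i x) = v x"
      unfolding v(1) using u(2) v(2) by (intro sum.mono_neutral_cong_right) auto
    ultimately show ?thesis by (simp add: c_def distrib_right sum.distrib)
  qed
  then have "(\<lambda>x. u x + v x) = (\<lambda>x. \<Sum>i\<in>F \<union> G. c i * f i x)" by simp
  then show ?thesis
    unfolding lin_span_def using u(2,3) v(2,3) by blast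
qed

lemma lin_span_sum:
  assumes "finite K" "\<And>k. k \<in> K \<Longrightarrow> u k \<in> lin_span J f"
  shows "(\<lambda>x. \<Sum>k\<in>K. u k x) \<in> lin_span J f"
  using assms
proof (induction K)
  case empty
  have "(\<lambda>x. 0) = (\<lambda>x. \<Sum>i\<in>{}. 0 * f i x)" by simp
  then show ?case unfolding lin_span_def by force
next
  case (insert k K)
  then show ?case using lin_span_add[of "u k" J f "\<lambda>x. \<Sum>k\<in>K. u k x"] by simp
qed

text \<open>Five nodal values face four unknowns. The nodes 0, 1, 2 and 4 fix the unknowns, and the
  equation at node 3 is then the mean-zero condition.\<close>

lemma coarse_nodes_surj:
  assumes "(\<Sum>i<4. (v i + v (Suc i)) / 2) = (0::real)"
  obtains x where "\<And>m. m \<le> 4 \<Longrightarrow> coarse_nodes x m = v m"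
proof -
  define x where "x = (\<lambda>i::nat. if i = 0 then v 0 / 3 else if i = 1 then v 1 + v 0 / 2
      else if i = 2 then v 2 + v 1 + v 0 / 2 else - v 4 / 3)"
  have mean: "v 0 / 2 + v 1 + v 2 + v 3 + v 4 / 2 = 0"
    using assms by (simp add: sum_lessThan_4 eval_nat_numeral field_simps)
  have "coarse_nodes x m = v m" if "m \<le> 4" for m
  proof -
    consider "m = 0" | "m = 1" | "m = 2" | "m = 3" | "m = 4" using \<open>m \<le> 4\<close> by linarith
    then show ?thesis
    proof cases
      case 4
      then show ?thesis using mean by (simp add: coarse_nodes_eval x_def)
    qed (simp_all only: coarse_nodes_eval, simp_all add: x_def)
  qed
  then show ?thesis by (rule that)
qed

text \<open>Solving the two-scale equations and subtracting the wavelet part leaves a function on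
  the coarser grid. \<open>primitive01\<close> carries the mean-zero condition down to level 2,
  where it is used. The conclusion speaks of a primitive \<open>h\<close> of the same
  \<open>g\<close>, since \<open>F\<close> itself may differ from the span outside the unit
  interval.\<close>

lemma pw_linear_in_span:
  assumes "2 \<le> N" "primitive01 F g" "pw_linear N v g"
  shows "\<exists>h\<in>lin_span basis_index basis_fun. primitive01 h g"
  using assms
proof (induction N arbitrary: F g v rule: dec_induct)
  case base
  obtain e g0 where e: "\<And>i. i < 4 \<Longrightarrow> 0 < (e i :: real)"
    and p0: "\<And>b. primitive01 (\<lambda>x. \<Sum>i<4. b i * basis_fun (Inl (int i + 1)) x) (\<lambda>x. \<Sum>i<4. b i * g0 i x)"
    and l0: "\<And>b. pw_linear 2 (coarse_nodes (\<lambda>i. b i * e i)) (\<lambda>x. \<Sum>i<4. b i * g0 i x)"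
    using coarse_combination by blast
  have "(g has_integral 0) {0..1}" using base(1) by (auto simp: primitive01_def dest!: bspec[of _ _ 1])
  with pw_linear_has_integral[OF base(2)] have "(\<Sum>i<2^2. (v i + v (Suc i)) / 2) / 2^2 = 0"
    by (rule has_integral_unique)
  then have mean: "(\<Sum>i<4. (v i + v (Suc i)) / 2) = 0" by simp
  obtain x where x: "\<And>m. m \<le> 4 \<Longrightarrow> coarse_nodes x m = v m"
    using coarse_nodes_surj[OF mean] by blast
  define b where "b = (\<lambda>i. x i / e i)"
  have "coarse_nodes (\<lambda>i. b i * e i) = coarse_nodes x"
  proof
    fix m
    have "b i * e i = x i" if "i < 4" for i using e[OF that] by (simp add: b_def)
    then show "coarse_nodes (\<lambda>i. b i * e i) m = coarse_nodes x m"
      unfolding coarse_nodes_def by (intro sum.cong) auto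
  qed
  then have "pw_linear 2 (coarse_nodes x) (\<lambda>x. \<Sum>i<4. b i * g0 i x)" using l0[of b] by simp
  then have "pw_linear 2 v (\<lambda>x. \<Sum>i<4. b i * g0 i x)"
    by (rule pw_linear_cong) (simp add: x)
  then have "primitive01 (\<lambda>x. \<Sum>i<4. b i * basis_fun (Inl (int i + 1)) x) g"
    using pw_linear_determined[OF base(2)] by (intro primitive01_cong[OF p0[of b]]) auto
  moreover have "(\<lambda>x. \<Sum>i<4. b i * basis_fun (Inl (int i + 1)) x) \<in> lin_span basis_index basis_fun"
    by (intro lin_span_sum lin_span_cmult_mem) (auto simp: basis_index_def wavelet_index_eq)
  ultimately show ?case by blast
next
  case (step N)
  obtain e h where e: "\<And>i. i < 2^N \<Longrightarrow> 2^N / 8 \<le> (e i)^2 \<and> (e i)^2 \<le> 5 * 2^N"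
    and ph: "\<And>b. primitive01 (\<lambda>x. \<Sum>i<2^N. b i * basis_fun (Inr (N, int i + 1)) x) (\<lambda>x. \<Sum>i<2^N. b i * h i x)"
    and lh: "\<And>b. pw_linear (Suc N) (two_scale (2^N) (\<lambda>_. 0) (\<lambda>i. b i * e i)) (\<lambda>x. \<Sum>i<2^N. b i * h i x)"
    using wavelet_level_combination[OF step.hyps(1)] by blast
  have N2: "(2::nat) \<le> 2^N" using power_increasing[of 1 N "2::nat"] step.hyps(1) by simp
  obtain c d where cd: "\<And>m. m \<le> 2 * 2^N \<Longrightarrow> two_scale (2^N) c d m = v m"
    using two_scale_surj[OF N2] by blast
  define b where "b = (\<lambda>i. d i / e i)"
  let ?w = "\<lambda>x. \<Sum>i<2^N. b i * basis_fun (Inr (N, int i + 1)) x"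
  let ?gw = "\<lambda>x. \<Sum>i<2^N. b i * h i x"
  have be: "b i * e i = d i" if "i < 2^N" for i
  proof -
    have "(0::real) < 2^N / 8" by simp
    then have "e i \<noteq> 0" using e[OF that] by (metis less_le_trans power_zero_numeral less_irrefl)
    then show ?thesis by (simp add: b_def)
  qed
  have "pw_linear (Suc N) (\<lambda>m. 1 * v m + -1 * two_scale (2^N) (\<lambda>_. 0) (\<lambda>i. b i * e i) m) (\<lambda>x. 1 * g x + -1 * ?gw x)"
    by (intro pw_linear_lincomb step.prems(2) lh)
  then have "pw_linear (Suc N) (two_scale (2^N) c (\<lambda>_. 0)) (\<lambda>x. 1 * g x + -1 * ?gw x)"
  proof (rule pw_linear_cong)
    fix m :: nat assume m: "m \<le> 2 ^ Suc N"
    then have m2: "m \<le> 2 * 2^N" by simp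
    \<comment> \<open>\<open>b i * e i\<close> and \<open>d i\<close> agree for i < 2^N only, so the
      vectors are compared through the sum of columns, which sees no other index.\<close>
    have "two_scale (2^N) (\<lambda>_. 0) (\<lambda>i. b i * e i) m = two_scale (2^N) (\<lambda>_. 0) d m"
    proof -
      have M1: "(1::nat) \<le> 2^N" by simp
      let ?d = "\<lambda>i. two_scale (2^N) (\<lambda>_. 0) (\<lambda>j. if j = i then 1 else 0) m"
      have "two_scale (2^N) (\<lambda>_. 0) (\<lambda>i. b i * e i) m = (\<Sum>i<2^N. b i * e i * ?d i)"
        by (rule two_scale_sum_delta[OF m2 M1, symmetric])
      also have "\<dots> = (\<Sum>i<2^N. d i * ?d i)"
        using be by (intro sum.cong) auto
      also have "\<dots> = two_scale (2^N) (\<lambda>_. 0) d m"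
        by (rule two_scale_sum_delta[OF m2 M1])
      finally show ?thesis .
    qed
    then show "two_scale (2^N) c (\<lambda>_. 0) m = 1 * v m + -1 * two_scale (2^N) (\<lambda>_. 0) (\<lambda>i. b i * e i) m"
      using cd[OF m2] two_scale_add[of "2^N" c m d] by simp
  qed
  then have "pw_linear N c (\<lambda>x. 1 * g x + -1 * ?gw x)" by (simp only: pw_linear_refine)
  from step.IH[OF primitive01_lincomb[OF step.prems(1) ph] this]
  obtain u where u: "u \<in> lin_span basis_index basis_fun" "primitive01 u (\<lambda>x. 1 * g x + -1 * ?gw x)" by blast
  have "primitive01 (\<lambda>x. 1 * u x + 1 * ?w x) (\<lambda>x. 1 * (1 * g x + -1 * ?gw x) + 1 * ?gw x)"
    by (rule primitive01_lincomb[OF u(2) ph])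
  then have "primitive01 (\<lambda>x. u x + ?w x) g" by simp
  moreover have "?w \<in> lin_span basis_index basis_fun"
    using step.hyps(1) by (intro lin_span_sum lin_span_cmult_mem) (auto simp: basis_index_def wavelet_index_eq)
  ultimately show ?case using lin_span_add[OF u(1)] by blast
qed

text \<open>Interpolation on a dyadic grid finer than the modulus of continuity: in a cell the
  interpolant is a convex combination of two values of \<open>g\<close> within \<open>e\<close> of g
  x.\<close>

lemma pw_linear_approx:
  assumes g: "continuous_on {0..1} g" and e: "(0::real) < e"
  obtains N v p where "2 \<le> N" "continuous_on {0..1} p" "pw_linear N v p"
    "\<And>x. x \<in> {0..1} \<Longrightarrow> \<bar>p x - g x\<bar> \<le> e"
proof -
  have "uniformly_continuous_on {0..1} g"
    using g compact_uniformly_continuous compact_Icc by blast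
  then obtain \<delta> where \<delta>: "0 < \<delta>" "\<And>x y. x \<in> {0..1} \<Longrightarrow> y \<in> {0..1} \<Longrightarrow> \<bar>x - y\<bar> < \<delta> \<Longrightarrow> \<bar>g x - g y\<bar> < e"
    using e unfolding uniformly_continuous_on_def dist_real_def by metis
  obtain N0 where N0: "(1/2::real)^N0 < \<delta>" using real_arch_pow_inv[OF \<delta>(1), of "1/2"] by auto
  define N where "N = N0 + 2"
  have N: "1 / 2^N < \<delta>"
  proof -
    have "(1/2::real)^N \<le> (1/2)^N0" by (rule power_decreasing) (auto simp: N_def)
    then show ?thesis using N0 by (simp add: power_divide)
  qed
  define v where "v = (\<lambda>i. g (real i / 2^N))"
  show ?thesis
  proof (rule that[of N "pl_interp N v" v])
    show "\<bar>pl_interp N v x - g x\<bar> \<le> e" if x: "x \<in> {0..1}" for x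
    proof -
      obtain i t where it: "i < 2^N" "t \<in> {0..1}" "x = (real i + t) / 2^N"
        using unit_interval_cell[OF x, of N] by blast
      have iN: "real i + 1 \<le> 2^N"
      proof -
        have "Suc i \<le> 2^N" using it(1) by simp
        then have "real (Suc i) \<le> real (2^N)" by (simp only: of_nat_le_iff)
        then show ?thesis by simp
      qed
      have mem: "real i / 2^N \<in> {0..1}" "real (Suc i) / 2^N \<in> {0..1}" unfolding atLeastAtMost_iff
        using iN by (auto intro!: divide_le_eq_1_pos[THEN iffD2] simp del: of_nat_le_numeral_power_cancel_iff)
      have "real i / 2^N - x = - t / 2^N" "real (Suc i) / 2^N - x = (1 - t) / 2^N"
        unfolding it(3) by (simp_all add: field_simps)
      moreover have "t / 2^N \<le> 1 / 2^N" "(1 - t) / 2^N \<le> 1 / 2^N" "0 \<le> t / 2^N" "0 \<le> (1 - t) / 2^N"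
        using it(2) by (auto intro!: divide_right_mono)
      ultimately have "\<bar>real i / 2^N - x\<bar> < \<delta>" "\<bar>real (Suc i) / 2^N - x\<bar> < \<delta>"
        using N by auto
      then have a: "\<bar>v i - g x\<bar> < e" "\<bar>v (Suc i) - g x\<bar> < e"
        unfolding v_def using \<delta>(2) mem x by blast+
      have "pl_interp N v x = (1 - t) * v i + t * v (Suc i)"
        using pl_interp_pw_linear[of N v] it unfolding pw_linear_def by blast
      then have "\<bar>pl_interp N v x - g x\<bar> = \<bar>(1 - t) * (v i - g x) + t * (v (Suc i) - g x)\<bar>"
        by (simp add: algebra_simps)
      also have "\<dots> \<le> (1 - t) * \<bar>v i - g x\<bar> + t * \<bar>v (Suc i) - g x\<bar>"
        using it(2) by (intro order_trans[OF abs_triangle_ineq]) (simp add: abs_mult)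
      also have "\<dots> \<le> (1 - t) * e + t * e"
        using it(2) a by (intro add_mono mult_left_mono) auto
      finally show ?thesis by (simp add: algebra_simps)
    qed
  qed (auto simp: N_def pl_interp_continuous pl_interp_pw_linear)
qed

text \<open>The approximant \<open>p\<close> of the derivative may have a nonzero mean m, but |m|
  \<le> e/4. Subtracting it makes the total error at most e/2, and the Poincare factor 2 gives
  \<open>e\<close>.\<close>

lemma span_dense:
  assumes F: "primitive01 F g" and e: "0 < e"
  obtains h where "h \<in> lin_span basis_index basis_fun" "h \<in> H1_space" "H1_norm (\<lambda>x. F x - h x) \<le> e"
proof -
  have gc: "continuous_on {0..1} g" using F by (simp add: primitive01_def)
  have e4: "0 < e / 4" using e by simp
  obtain N v p where p: "2 \<le> N" "continuous_on {0..1} p" "pw_linear N v p"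
    "\<And>x. x \<in> {0..1} \<Longrightarrow> \<bar>p x - g x\<bar> \<le> e / 4"
    using pw_linear_approx[OF gc e4] by metis
  define m where "m = integral {0..1} p"
  have pint: "(p has_integral m) {0..1}"
    unfolding m_def using integrable_continuous_interval[OF p(2)] by (rule integrable_integral)
  have gint: "(g has_integral 0) {0..1}" using F by (auto simp: primitive01_def dest!: bspec[of _ _ 1])
  have m: "\<bar>m\<bar> \<le> e / 4"
  proof -
    have d: "((\<lambda>x. p x - g x) has_integral (m - 0)) {0..1}" by (rule has_integral_diff[OF pint gint])
    have c: "((\<lambda>_::real. a) has_integral a) {0..1}" for a :: real
      using has_integral_const_real[of a 0 1] by simp
    have "p x - g x \<le> e / 4" "- (e / 4) \<le> p x - g x" if "x \<in> {0..1}" for x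
      using p(4)[OF that] by linarith+
    then have "m - 0 \<le> e / 4" "- (e / 4) \<le> m - 0"
      using has_integral_le[OF d c] has_integral_le[OF c d] by blast+
    then show ?thesis by simp
  qed
  define q where "q = (\<lambda>x. p x - m)"
  have qc: "continuous_on {0..1} q" unfolding q_def by (intro continuous_intros p(2))
  define Q where "Q = (\<lambda>x. integral {0..x} q)"
  have Q: "primitive01 Q q"
    unfolding primitive01_def
  proof (intro conjI ballI qc)
    show "(q has_integral Q x) {0..x}" if "x \<in> {0..1}" for x
      unfolding Q_def using that
      by (intro integrable_integral integrable_continuous_interval continuous_on_subset[OF qc]) auto
    have "(q has_integral (m - m)) {0..1}"
      unfolding q_def using has_integral_const_real[of m 0 1] by (intro has_integral_diff pint) simp
    then show "Q 1 = 0" unfolding Q_def by (simp add: integral_unique)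
  qed
  have "pw_linear N (\<lambda>i. v i - m) q"
    using p(3) by (simp add: pw_linear_def q_def algebra_simps)
  from pw_linear_in_span[OF p(1) Q this]
  obtain h where h: "h \<in> lin_span basis_index basis_fun" "primitive01 h q" by blast
  have "H1_norm (\<lambda>x. F x - h x) \<le> 2 * L2_norm (\<lambda>x. g x - q x)"
    by (rule primitive01_norm(2)[OF primitive01_diff[OF F h(2)]])
  also have "L2_norm (\<lambda>x. g x - q x) \<le> e / 2"
  proof (rule L2_norm_le_bound)
    show "(\<lambda>x. g x - q x) \<in> borel_measurable unit_measure"
      by (intro L2_space_measurable L2_space_diff L2_space_continuous gc qc)
    show "\<bar>g x - q x\<bar> \<le> e / 2" if "x \<in> {0<..<1}" for x
    proof -
      have "\<bar>p x - g x\<bar> \<le> e / 4" using that by (intro p(4)) auto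
      then show ?thesis using m unfolding q_def by linarith
    qed
  qed (use e in simp)
  finally show ?thesis using that h primitive01_H1_space by simp
qed

text \<open>Test functions are dense by definition of the space and are primitives of continuous
  functions, so approximating them is enough.\<close>

lemma closure_span: "closure_in H01_space H1_norm (lin_span basis_index basis_fun) = H01_space"
proof (intro equalityI subsetI)
  fix u assume u: "u \<in> H01_space"
  have "\<exists>h\<in>lin_span basis_index basis_fun. H1_norm (\<lambda>x. u x - h x) < e" if "e > 0" for e
  proof -
    have e3: "e / 3 > 0" using that by simp
    then obtain t where t: "t \<in> test_functions" "H1_norm (\<lambda>x. u x - t x) < e / 3"
      using u unfolding H01_space_def closure_in_def by blast
    obtain h where h: "h \<in> lin_span basis_index basis_fun" "h \<in> H1_space" "H1_norm (\<lambda>x. t x - h x) \<le> e / 3"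
      using span_dense[OF test_function_primitive01[OF t(1)] e3] by blast
    have "H1_norm (\<lambda>x. u x - h x) \<le> H1_norm (\<lambda>x. u x - t x) + H1_norm (\<lambda>x. t x - h x)"
      using u t(1) h(2) H01_space_subset test_functions_H1_space by (intro H1_norm_triangle_diff) auto
    then have "H1_norm (\<lambda>x. u x - h x) < e" using t(2) h(3) that by simp
    then show ?thesis using h(1) by blast
  qed
  with u show "u \<in> closure_in H01_space H1_norm (lin_span basis_index basis_fun)"
    by (simp add: closure_in_def)
qed (simp add: closure_in_def)

section \<open>Infinite sums\<close>

lemma summable_on_small_tail:
  fixes f :: "'i \<Rightarrow> real"
  assumes "f summable_on J" "\<And>i. 0 \<le> f i" "e > 0"
  obtains F where "finite F" "F \<subseteq> J" "\<And>G. finite G \<Longrightarrow> G \<subseteq> J - F \<Longrightarrow> sum f G < e"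
proof -
  have "(sum f \<longlongrightarrow> infsum f J) (finite_subsets_at_top J)"
    using assms(1) by (simp add: has_sum_def[symmetric])
  then have "\<forall>\<^sub>F F in finite_subsets_at_top J. infsum f J - e < sum f F"
    by (rule order_tendstoD) (use assms(3) in simp)
  then obtain F where F: "finite F" "F \<subseteq> J" "infsum f J - e < sum f F"
    unfolding eventually_finite_subsets_at_top by blast
  have "sum f G < e" if G: "finite G" "G \<subseteq> J - F" for G
  proof -
    have "sum f F + sum f G = sum f (F \<union> G)"
      using F G by (intro sum.union_disjoint[symmetric]) auto
    also have "\<dots> \<le> infsum f J"
      using F G assms by (intro finite_sum_le_infsum) auto
    finally show ?thesis using F(3) by simp
  qed
  with F show ?thesis using that by blast
qed

text \<open>The upper bound makes the net of partial sums Cauchy, since S G - S F is the partial sum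
  over G - F, whose coefficients form a tail of \<open>b\<close>. Both norm bounds then pass to the
  limit.\<close>

lemma basis_series:
  assumes b: "b \<in> l2_space basis_index" and AB: "0 < B"
    and low: "\<And>F b. finite F \<Longrightarrow> F \<subseteq> basis_index \<Longrightarrow>
       A * sqrt (\<Sum>i\<in>F. (b i)^2) \<le> H1_norm (\<lambda>x. \<Sum>i\<in>F. b i * basis_fun i x)"
    and upp: "\<And>F b. finite F \<Longrightarrow> F \<subseteq> basis_index \<Longrightarrow>
       H1_norm (\<lambda>x. \<Sum>i\<in>F. b i * basis_fun i x) \<le> B * sqrt (\<Sum>i\<in>F. (b i)^2)"
  obtains s where "has_sum_in H01_space H1_norm (\<lambda>i x. b i * basis_fun i x) basis_index s"
    "A * l2_norm basis_index b \<le> H1_norm s" "H1_norm s \<le> B * l2_norm basis_index b"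
proof -
  define S where "S = (\<lambda>F x. \<Sum>i\<in>F. b i * basis_fun i x)"
  have sm: "(\<lambda>i. (b i)^2) summable_on basis_index" using b by (simp add: l2_space_def)
  have S01: "S F \<in> H01_space" if F: "finite F" "F \<subseteq> basis_index" for F
  proof -
    have "\<forall>i\<in>F. \<exists>g. primitive01 (basis_fun i) g" using F(2) basis_fun_primitive01 by blast
    then obtain g where "\<And>i. i \<in> F \<Longrightarrow> primitive01 (basis_fun i) (g i)" by metis
    then have "primitive01 (S F) (\<lambda>x. \<Sum>i\<in>F. b i * g i x)"
      unfolding S_def using F(1) by (intro primitive01_sum primitive01_cmult)
    then show ?thesis by (rule primitive01_H01_space)
  qed
  have S1: "S F \<in> H1_space" if "finite F" "F \<subseteq> basis_index" for F
    using S01[OF that] H01_space_subset by blast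
  have tail: "\<exists>F. finite F \<and> F \<subseteq> basis_index \<and>
      (\<forall>G. finite G \<longrightarrow> F \<subseteq> G \<longrightarrow> G \<subseteq> basis_index \<longrightarrow> H1_norm (\<lambda>x. S G x - S F x) < e)" if e: "e > 0" for e
  proof -
    have "(e / B)^2 > 0" using e AB by simp
    then obtain F where F: "finite F" "F \<subseteq> basis_index"
      "\<And>G. finite G \<Longrightarrow> G \<subseteq> basis_index - F \<Longrightarrow> (\<Sum>i\<in>G. (b i)^2) < (e / B)^2"
      using summable_on_small_tail[OF sm] by (metis zero_le_power2)
    have "H1_norm (\<lambda>x. S G x - S F x) < e" if G: "finite G" "F \<subseteq> G" "G \<subseteq> basis_index" for G
    proof -
      have "(\<lambda>x. S G x - S F x) = S (G - F)"
        using G by (simp add: S_def sum_diff)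
      then have "H1_norm (\<lambda>x. S G x - S F x) \<le> B * sqrt (\<Sum>i\<in>G - F. (b i)^2)"
        using upp[of "G - F" b] G by (auto simp: S_def)
      also have "\<dots> < B * (e / B)"
      proof (rule mult_strict_left_mono[OF _ AB])
        have "sqrt (\<Sum>i\<in>G - F. (b i)^2) < sqrt ((e / B)^2)"
          using F(3)[of "G - F"] G by (intro real_sqrt_less_mono) auto
        then show "sqrt (\<Sum>i\<in>G - F. (b i)^2) < e / B" using e AB by simp
      qed
      finally show ?thesis using AB by simp
    qed
    with F(1,2) show ?thesis by blast
  qed
  have "\<exists>F. finite F \<and> F \<subseteq> basis_index \<and>
      (\<forall>G. finite G \<longrightarrow> F \<subseteq> G \<longrightarrow> G \<subseteq> basis_index \<longrightarrow> H1_norm (\<lambda>x. S G x - S F x) < 1 / real (Suc n))" for n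
    by (rule tail) simp
  then obtain T where T: "\<And>n. finite (T n)" "\<And>n. T n \<subseteq> basis_index"
    "\<And>n G. finite G \<Longrightarrow> T n \<subseteq> G \<Longrightarrow> G \<subseteq> basis_index \<Longrightarrow> H1_norm (\<lambda>x. S G x - S (T n) x) < 1 / real (Suc n)"
    by metis
  \<comment> \<open>Increasing finite sets extract a sequence from the net, as completeness is
    available for sequences.\<close>
  define U where "U = (\<lambda>n. \<Union>k\<le>n. T k)"
  have U: "finite (U n)" "U n \<subseteq> basis_index" for n using T by (auto simp: U_def)
  have close: "H1_norm (\<lambda>x. S F x - S G x) < 2 / real (Suc n)"
    if "finite F" "finite G" "T n \<subseteq> F" "T n \<subseteq> G" "F \<subseteq> basis_index" "G \<subseteq> basis_index" for n F G
  proof -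
    have "H1_norm (\<lambda>x. S F x - S G x) \<le> H1_norm (\<lambda>x. S F x - S (T n) x) + H1_norm (\<lambda>x. S (T n) x - S G x)"
      using that T by (intro H1_norm_triangle_diff S1) auto
    also have "H1_norm (\<lambda>x. S (T n) x - S G x) = H1_norm (\<lambda>x. S G x - S (T n) x)"
      using that T by (intro H1_norm_minus_commute S1) auto
    finally show ?thesis using T(3)[of F n] T(3)[of G n] that by simp
  qed
  have TU: "T n \<subseteq> U m" if "n \<le> m" for n m using that by (auto simp: U_def)
  have arch: "\<exists>n. 2 / real (Suc n) < e" if "e > 0" for e :: real
  proof -
    have e2: "0 < e / 2" using that by simp
    obtain n where "inverse (real (Suc n)) < e / 2"
      using reals_Archimedean[OF e2] by blast
    then have "2 * (1 / real (Suc n)) < e" by (simp add: inverse_eq_divide field_simps)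
    then show ?thesis by (intro exI[of _ n]) simp
  qed
  obtain s where s: "s \<in> H1_space" "(\<lambda>n. H1_norm (\<lambda>x. s x - S (U n) x)) \<longlonglongrightarrow> 0"
  proof (rule H1_complete[of "\<lambda>n. S (U n)"])
    show "S (U n) \<in> H1_space" for n using U by (rule S1)
    show "\<exists>N. \<forall>m\<ge>N. \<forall>n\<ge>N. H1_norm (\<lambda>x. S (U m) x - S (U n) x) < e" if "e > 0" for e
    proof -
      obtain N where N: "2 / real (Suc N) < e" using arch[OF \<open>e > 0\<close>] by blast
      show ?thesis
      proof (intro exI[of _ N] allI impI)
        fix m n assume "N \<le> m" "N \<le> n"
        then have "H1_norm (\<lambda>x. S (U m) x - S (U n) x) < 2 / real (Suc N)"
          by (intro close U TU)
        then show "H1_norm (\<lambda>x. S (U m) x - S (U n) x) < e" using N by (rule less_trans)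
      qed
    qed
  qed
  \<comment> \<open>Letting \<open>m\<close> grow in the comparison with \<open>S (U m)\<close>
    carries the sequential limit back to every finite set containing \<open>T n\<close>.\<close>
  have near: "H1_norm (\<lambda>x. s x - S F x) \<le> 2 / real (Suc n)" if F: "finite F" "T n \<subseteq> F" "F \<subseteq> basis_index" for F n
  proof (rule tendsto_lowerbound)
    show "(\<lambda>m. H1_norm (\<lambda>x. s x - S (U m) x) + 2 / real (Suc n)) \<longlonglongrightarrow> 2 / real (Suc n)"
      using tendsto_add[OF s(2) tendsto_const] by simp
    have "H1_norm (\<lambda>x. s x - S F x) \<le> H1_norm (\<lambda>x. s x - S (U m) x) + 2 / real (Suc n)" if "n \<le> m" for m
    proof -
      have "H1_norm (\<lambda>x. s x - S F x) \<le> H1_norm (\<lambda>x. s x - S (U m) x) + H1_norm (\<lambda>x. S (U m) x - S F x)"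
        using F U by (intro H1_norm_triangle_diff S1 s(1)) auto
      then show ?thesis using close[OF U(1) F(1) TU[OF that] F(2) U(2) F(3)] by simp
    qed
    then show "\<forall>\<^sub>F m in sequentially. H1_norm (\<lambda>x. s x - S F x) \<le> H1_norm (\<lambda>x. s x - S (U m) x) + 2 / real (Suc n)"
      by (rule eventually_sequentiallyI)
  qed simp
  have s01: "s \<in> H01_space"
  proof (rule H01_space_closed[OF s(1)])
    fix e :: real assume "e > 0"
    then obtain n where n: "2 / real (Suc n) < e" using arch by blast
    have "H1_norm (\<lambda>x. s x - S (T n) x) \<le> 2 / real (Suc n)" using T by (intro near) auto
    then show "\<exists>v\<in>H01_space. H1_norm (\<lambda>x. s x - v x) < e"
      using n S01[OF T(1,2)] by (intro bexI[of _ "S (T n)"]) auto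
  qed
  have lim: "((\<lambda>F. H1_norm (\<lambda>x. s x - S F x)) \<longlongrightarrow> 0) (finite_subsets_at_top basis_index)"
  proof (rule tendstoI)
    fix e :: real assume "e > 0"
    then obtain n where n: "2 / real (Suc n) < e" using arch by blast
    have "dist (H1_norm (\<lambda>x. s x - S F x)) 0 < e" if "finite F" "T n \<subseteq> F" "F \<subseteq> basis_index" for F
      using near[OF that] n H1_norm_nonneg[of "\<lambda>x. s x - S F x"] by (simp add: dist_real_def)
    then show "\<forall>\<^sub>F F in finite_subsets_at_top basis_index. dist (H1_norm (\<lambda>x. s x - S F x)) 0 < e"
      unfolding eventually_finite_subsets_at_top using T(1,2) by (intro exI[of _ "T n"]) auto
  qed
  have l2: "((\<lambda>F. sqrt (\<Sum>i\<in>F. (b i)^2)) \<longlongrightarrow> l2_norm basis_index b) (finite_subsets_at_top basis_index)"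
    unfolding l2_norm_def using sm by (intro tendsto_real_sqrt) (simp add: has_sum_def[symmetric])
  have ev: "\<forall>\<^sub>F F in finite_subsets_at_top basis_index. finite F \<and> F \<subseteq> basis_index"
    by (rule eventually_finite_subsets_at_top_weakI) auto
  have norm_s: "H1_norm s \<le> H1_norm (\<lambda>x. s x - S F x) + H1_norm (S F)"
    "H1_norm (S F) \<le> H1_norm s + H1_norm (\<lambda>x. s x - S F x)" if "finite F" "F \<subseteq> basis_index" for F
  proof -
    note SF = S1[OF that]
    show "H1_norm s \<le> H1_norm (\<lambda>x. s x - S F x) + H1_norm (S F)"
      using H1_norm_triangle[OF H1_space_diff[OF s(1) SF] SF] by simp
    have "H1_norm (S F) \<le> H1_norm s + H1_norm (\<lambda>x. S F x - s x)"
      using H1_norm_triangle[OF s(1) H1_space_diff[OF SF s(1)]] by simp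
    then show "H1_norm (S F) \<le> H1_norm s + H1_norm (\<lambda>x. s x - S F x)"
      using H1_norm_minus_commute[OF SF s(1)] by simp
  qed
  show ?thesis
  proof (rule that[of s])
    show "has_sum_in H01_space H1_norm (\<lambda>i x. b i * basis_fun i x) basis_index s"
      using s01 lim by (simp add: has_sum_in_def S_def)
    show "A * l2_norm basis_index b \<le> H1_norm s"
    proof (rule tendsto_le[OF finite_subsets_at_top_neq_bot])
      show "((\<lambda>F. H1_norm s + H1_norm (\<lambda>x. s x - S F x)) \<longlongrightarrow> H1_norm s) (finite_subsets_at_top basis_index)"
        using tendsto_add[OF tendsto_const lim] by simp
      show "((\<lambda>F. A * sqrt (\<Sum>i\<in>F. (b i)^2)) \<longlongrightarrow> A * l2_norm basis_index b) (finite_subsets_at_top basis_index)"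
        by (intro tendsto_mult_left l2)
      show "\<forall>\<^sub>F F in finite_subsets_at_top basis_index. A * sqrt (\<Sum>i\<in>F. (b i)^2) \<le> H1_norm s + H1_norm (\<lambda>x. s x - S F x)"
        using ev
      proof eventually_elim
        case (elim F)
        then show ?case using low[of F b] norm_s(2)[of F] by (simp add: S_def)
      qed
    qed
    show "H1_norm s \<le> B * l2_norm basis_index b"
    proof (rule tendsto_le[OF finite_subsets_at_top_neq_bot])
      show "((\<lambda>F. H1_norm (\<lambda>x. s x - S F x) + B * sqrt (\<Sum>i\<in>F. (b i)^2)) \<longlongrightarrow> B * l2_norm basis_index b) (finite_subsets_at_top basis_index)"
        using tendsto_add[OF lim tendsto_mult_left[OF l2, of B]] by simp
      show "((\<lambda>F. H1_norm s) \<longlongrightarrow> H1_norm s) (finite_subsets_at_top basis_index)" by simp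
      show "\<forall>\<^sub>F F in finite_subsets_at_top basis_index. H1_norm s \<le> H1_norm (\<lambda>x. s x - S F x) + B * sqrt (\<Sum>i\<in>F. (b i)^2)"
        using ev
      proof eventually_elim
        case (elim F)
        then show ?case using upp[of F b] norm_s(1)[of F] by (simp add: S_def)
      qed
    qed
  qed
qed

theorem theorem12:
  shows "riesz_basis H01_space H1_norm
    (wavelet_index 2 <+> (SIGMA j:{2..}. wavelet_index j))
    (case_sum
      (\<lambda>k x. phi_jk 2 k x / H1_seminorm (phi_jk 2 k))
      (\<lambda>(j, k) x. psi_jk j k x / H1_seminorm (psi_jk j k)))"
proof -
  obtain A B where AB: "0 < A" "0 < B"
    and bnd: "\<And>F b. finite F \<Longrightarrow> F \<subseteq> basis_index \<Longrightarrow>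
       A * sqrt (\<Sum>i\<in>F. (b i)^2) \<le> H1_norm (\<lambda>x. \<Sum>i\<in>F. b i * basis_fun i x) \<and>
       H1_norm (\<lambda>x. \<Sum>i\<in>F. b i * basis_fun i x) \<le> B * sqrt (\<Sum>i\<in>F. (b i)^2)"
    using finite_sum_bounds by blast
  have "riesz_basis H01_space H1_norm basis_index basis_fun"
    unfolding riesz_basis_def
  proof (intro conjI ballI)
    show "countable basis_index" by (rule countableI_type)
    show "basis_fun i \<in> H01_space" if "i \<in> basis_index" for i
      using basis_fun_primitive01[OF that] primitive01_H01_space by blast
    show "closure_in H01_space H1_norm (lin_span basis_index basis_fun) = H01_space"
      by (rule closure_span)
    have "\<exists>s. has_sum_in H01_space H1_norm (\<lambda>i x. b i * basis_fun i x) basis_index s \<and>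
      A * l2_norm basis_index b \<le> H1_norm s \<and> H1_norm s \<le> B * l2_norm basis_index b"
      if b: "b \<in> l2_space basis_index" for b
    proof (rule basis_series[OF b AB(2), of A])
      show "A * sqrt (\<Sum>i\<in>F. (b i)^2) \<le> H1_norm (\<lambda>x. \<Sum>i\<in>F. b i * basis_fun i x)"
        "H1_norm (\<lambda>x. \<Sum>i\<in>F. b i * basis_fun i x) \<le> B * sqrt (\<Sum>i\<in>F. (b i)^2)"
        if "finite F" "F \<subseteq> basis_index" for F b
        using bnd[OF that, of b] by auto
    qed blast
    then show "\<exists>c>0. \<exists>C>0. \<forall>b\<in>l2_space basis_index.
      \<exists>s. has_sum_in H01_space H1_norm (\<lambda>i x. b i * basis_fun i x) basis_index s \<and>
        c * l2_norm basis_index b \<le> H1_norm s \<and> H1_norm s \<le> C * l2_norm basis_index b"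
      using AB by blast
  qed
  then show ?thesis unfolding basis_index_def basis_fun_def .
qed

end
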